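(* Let $1\le r_1,r_2,p,q\le\infty$, and let $L_{r_1}=L_{r_1}(\mu)$ and $L_{r_2}=L_{r_2}(\nu)$ for measures $\mu,\nu$. Then every bounded linear operator from $L_{r_1}$ to $L_{r_2}$ is $(p,q)$-regular, i.e. $\mathcal R_{p,q}(L_{r_1},L_{r_2})=L(L_{r_1},L_{r_2})$, in each of the following cases: 1. $q\le r_1=r_2\le p$. 2. $r_1=r_2=1$ and $1\le q\le p\le\infty$. 3. $r_1=r_2=\infty$ and $1\le q\le p\le\infty$. 4. $1\le r_2\le r_1<2$ and there exists $t$ such that $q\le t\le p$ and $r_1<t\le2$. 5. $2<r_2\le r_1\le\infty$ and there exists $t$ such that $q\le t\le p$ and $2\le t<r_2$. 6. $1\le r_2\le2\le r_1\le\infty$ and $q\le2\le p$.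
   Context: A linear map $T:X\to Y$ between Banach lattices is $(p,q)$-regular if there is $K>0$ with $\big\|(\sum_{i=1}^n|Tx_i|^p)^{1/p}\big\|\le K\big\|(\sum_{i=1}^n|x_i|^q)^{1/q}\big\|$ for every finite family $\{x_i\}_{i=1}^n\subset X$ (with $\bigvee_i|\cdot|$ replacing the corresponding expression when an exponent is $\infty$). $\mathcal R_{p,q}(X,Y)$ is the space of $(p,q)$-regular operators and $L(X,Y)$ the space of bounded linear operators. *)

theory Defs
  imports "HOL-Probability.Probability"
begin

text \<open>
  \<^bold>\<open>The real Lebesgue spaces.\<close> The space depends on the measure, hence is a set of equivalence
  classes rather than a type. Exponents are extended reals, always assumed to be at least \<open>1\<close>.
\<close>

definition Lp_fun :: "ereal \<Rightarrow> 'a measure \<Rightarrow> ('a \<Rightarrow> real) set" where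
  "Lp_fun r M = {f \<in> borel_measurable M.
     if r = \<infinity> then esssup M (\<lambda>x. ennreal \<bar>f x\<bar>) < \<infinity>
     else integrable M (\<lambda>x. \<bar>f x\<bar> powr real_of_ereal r)}"

text \<open>Only used on \<^term>\<open>Lp_fun r M\<close>, so the default values of the integral and of
  \<^const>\<open>enn2real\<close> play no role. Taking the essential supremum in the nonnegative extended reals
  gives the value \<open>0\<close> for the zero measure.\<close>

definition Lp_fun_norm :: "ereal \<Rightarrow> 'a measure \<Rightarrow> ('a \<Rightarrow> real) \<Rightarrow> real" where
  "Lp_fun_norm r M f =
     (if r = \<infinity> then enn2real (esssup M (\<lambda>x. ennreal \<bar>f x\<bar>))
      else (\<integral>x. \<bar>f x\<bar> powr real_of_ereal r \<partial>M) powr (1 / real_of_ereal r))"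

definition ae_class :: "'a measure \<Rightarrow> ('a \<Rightarrow> real) \<Rightarrow> ('a \<Rightarrow> real) set" where
  "ae_class M f = {g \<in> borel_measurable M. AE x in M. g x = f x}"

definition ae_rep :: "('a \<Rightarrow> real) set \<Rightarrow> ('a \<Rightarrow> real)" where
  "ae_rep F = (SOME f. f \<in> F)"

definition Lp :: "ereal \<Rightarrow> 'a measure \<Rightarrow> ('a \<Rightarrow> real) set set" where
  "Lp r M = ae_class M ` Lp_fun r M"

definition Lp_norm :: "ereal \<Rightarrow> 'a measure \<Rightarrow> ('a \<Rightarrow> real) set \<Rightarrow> real" where
  "Lp_norm r M F = Lp_fun_norm r M (ae_rep F)"

definition Lp_add :: "'a measure \<Rightarrow> ('a \<Rightarrow> real) set \<Rightarrow> ('a \<Rightarrow> real) set \<Rightarrow> ('a \<Rightarrow> real) set" where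
  "Lp_add M F G = ae_class M (\<lambda>x. ae_rep F x + ae_rep G x)"

definition Lp_scale :: "'a measure \<Rightarrow> real \<Rightarrow> ('a \<Rightarrow> real) set \<Rightarrow> ('a \<Rightarrow> real) set" where
  "Lp_scale M c F = ae_class M (\<lambda>x. c * ae_rep F x)"

definition pnorm :: "ereal \<Rightarrow> nat \<Rightarrow> (nat \<Rightarrow> real) \<Rightarrow> real" where
  "pnorm p n a =
     (if p = \<infinity> then (MAX i\<in>{..<n}. \<bar>a i\<bar>)
      else (\<Sum>i<n. \<bar>a i\<bar> powr real_of_ereal p) powr (1 / real_of_ereal p))"

text \<open>The lattice expression \<open>(\<Sum>\<^sub>i |F\<^sub>i|^p)^(1/p)\<close>, respectively \<open>\<Or>\<^sub>i |F\<^sub>i|\<close>. In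
  a Lebesgue space the functional calculus is pointwise almost everywhere.\<close>

definition Lp_psum :: "ereal \<Rightarrow> 'a measure \<Rightarrow> nat \<Rightarrow> (nat \<Rightarrow> ('a \<Rightarrow> real) set) \<Rightarrow> ('a \<Rightarrow> real) set" where
  "Lp_psum p M n F = ae_class M (\<lambda>x. pnorm p n (\<lambda>i. ae_rep (F i) x))"

text \<open>Operators are extensional functions, so that two operators are equal iff they agree
  on the domain space.\<close>

definition linear_ops ::
  "ereal \<Rightarrow> 'a measure \<Rightarrow> ereal \<Rightarrow> 'b measure \<Rightarrow> (('a \<Rightarrow> real) set \<Rightarrow> ('b \<Rightarrow> real) set) set" where
  "linear_ops r M s N = {T \<in> Lp r M \<rightarrow>\<^sub>E Lp s N.
     (\<forall>F\<in>Lp r M. \<forall>G\<in>Lp r M. T (Lp_add M F G) = Lp_add N (T F) (T G)) \<and>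
     (\<forall>c. \<forall>F\<in>Lp r M. T (Lp_scale M c F) = Lp_scale N c (T F))}"

definition bounded_ops ::
  "ereal \<Rightarrow> 'a measure \<Rightarrow> ereal \<Rightarrow> 'b measure \<Rightarrow> (('a \<Rightarrow> real) set \<Rightarrow> ('b \<Rightarrow> real) set) set" where
  "bounded_ops r M s N = {T \<in> linear_ops r M s N.
     \<exists>K. \<forall>F\<in>Lp r M. Lp_norm s N (T F) \<le> K * Lp_norm r M F}"

definition regular_ops ::
  "ereal \<Rightarrow> ereal \<Rightarrow> ereal \<Rightarrow> 'a measure \<Rightarrow> ereal \<Rightarrow> 'b measure \<Rightarrow>
    (('a \<Rightarrow> real) set \<Rightarrow> ('b \<Rightarrow> real) set) set" where
  "regular_ops p q r M s N = {T \<in> linear_ops r M s N.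
     \<exists>K>0. \<forall>n\<ge>1. \<forall>F. (\<forall>i<n. F i \<in> Lp r M) \<longrightarrow>
       Lp_norm s N (Lp_psum p N n (\<lambda>i. T (F i))) \<le> K * Lp_norm r M (Lp_psum q M n F)}"

end

theory Submission
  imports Defs
begin

text \<open>
  Step functions approximate both the arguments of an operator and the images of indicator
  functions, so regularity reduces to an inequality for finite real matrices with a constant that
  does not depend on the size: if \<open>\<Sum> A j k * u j * v k \<le> C * \<parallel>u\<parallel> * \<parallel>v\<parallel>\<close> holds for scalars, then it
  holds up to a factor for vectors. Since both norms are monotone in the exponents \<open>p\<close> and \<open>q\<close>, it suffices
  to treat \<open>p = q = t\<close>.
  In bilinear form the matrix inequality is invariant under transposition, which replaces
  \<open>(r1, r2, t)\<close> by \<open>(r2', r1', t')\<close> and thus case 5 by case 4 and case 3 by case 2. For \<open>t = 2\<close> the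
  inequality is Grothendieck's. For \<open>r1 < t < 2\<close> one averages the case \<open>t = 2\<close> over
  positive random weights.
\<close>

text \<open>A bounded operator between Lebesgue spaces need not have a bounded modulus, so its norm
  gives no direct control of lattice expressions. The measures are arbitrary, so duality between
  Lebesgue spaces is not at hand for every exponent. All duality is therefore taken in finite
  dimensions, where each norm is attained by an explicit vector, also at the exponents 1 and
  \<infinity>.

  For r1 < t < 2 the i-th vector is multiplied by the square root of a random variable, a scalar
  that commutes with the operator. Sums of positive t/2-stable variables would turn the resulting
  square function into the t-function. The stable law itself is replaced by a negative power of a
  uniform variable: its truncated moments are elementary integrals, and since constants are free, a
  two-sided comparison of moments suffices. The arguments need an upper bound for the moment of
  order r1/2, the images a lower bound for the moment of order 1/2. Both orders lie below t/2, where
  moments are finite; this is the role of r1 < t.\<close>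

lemma exponent_cases:
  assumes "1 \<le> (r::ereal)"
  obtains (inf) "r = \<infinity>" | (fin) s where "r = ereal s" "1 \<le> s"
  using assms by (cases r) auto

text \<open>Convexity on the open half-line, extended to the endpoint 0. There one term of the
  combination disappears, and \<open>c powr s \<le> c\<close> for \<open>c\<close> in [0, 1]
  suffices.\<close>

lemma powr_convex_nonneg:
  fixes a b s l :: real
  assumes "1 \<le> s" "0 \<le> a" "0 \<le> b" "0 \<le> l" "l \<le> 1"
  shows "(l * a + (1 - l) * b) powr s \<le> l * a powr s + (1 - l) * b powr s"
proof -
  have small: "(c * d) powr s \<le> c * d powr s" if "0 \<le> c" "c \<le> 1" "0 \<le> d" for c d :: real
  proof -
    have "c powr s \<le> c"
      using that assms powr_mono'[of 1 s c] by (cases "c = 0") auto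
    then show ?thesis using that by (simp add: powr_mult mult_right_mono)
  qed
  consider "a = 0" | "b = 0" | "a > 0" "b > 0" using assms by linarith
  then show ?thesis
  proof cases
    case 3
    have "convex_on {0<..} (\<lambda>x. x powr s)" by (rule powr_convex) fact
    from convex_onD[OF this, of "1 - l" a b] 3 assms show ?thesis by auto
  qed (use small[of l a] small[of "1 - l" b] assms in auto)
qed

text \<open>The pointwise step of Minkowski's inequality: |f| + |g| is a + b times the convex
  combination of |f| / a and |g| / b with weights a / (a + b) and b / (a + b). With a and b the
  norms of f and g, the right-hand side integrates to \<open>(a + b) powr s\<close>.\<close>

lemma powr_add_le_normalized:
  fixes f g a b s :: real
  assumes "1 \<le> s" "0 < a" "0 < b"
  shows "\<bar>f + g\<bar> powr s \<le>
    (a + b) powr s * (a / (a + b) * (\<bar>f\<bar> powr s / a powr s) + b / (a + b) * (\<bar>g\<bar> powr s / b powr s))"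
proof -
  let ?l = "a / (a + b)"
  have l: "1 - ?l = b / (a + b)" using assms by (simp add: field_simps)
  have "?l * (\<bar>f\<bar> / a) + (1 - ?l) * (\<bar>g\<bar> / b) = (\<bar>f\<bar> + \<bar>g\<bar>) / (a + b)"
    unfolding l using assms by (simp add: add_divide_distrib)
  with powr_convex_nonneg[of s "\<bar>f\<bar> / a" "\<bar>g\<bar> / b" ?l] assms
  have "((\<bar>f\<bar> + \<bar>g\<bar>) / (a + b)) powr s \<le>
      ?l * (\<bar>f\<bar> powr s / a powr s) + b / (a + b) * (\<bar>g\<bar> powr s / b powr s)"
    by (simp add: l powr_divide)
  then have "(\<bar>f\<bar> + \<bar>g\<bar>) powr s \<le>
      (a + b) powr s * (?l * (\<bar>f\<bar> powr s / a powr s) + b / (a + b) * (\<bar>g\<bar> powr s / b powr s))"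
    using assms by (simp add: powr_divide pos_divide_le_eq mult.commute)
  moreover have "\<bar>f + g\<bar> powr s \<le> (\<bar>f\<bar> + \<bar>g\<bar>) powr s"
    using assms by (intro powr_mono2) auto
  ultimately show ?thesis by linarith
qed

section \<open>Lebesgue spaces of functions\<close>

lemma Lp_fun_measurable [measurable_dest]: "f \<in> Lp_fun r M \<Longrightarrow> f \<in> borel_measurable M"
  by (simp add: Lp_fun_def)

lemma Lp_fun_ereal: "f \<in> Lp_fun (ereal s) M \<longleftrightarrow>
    f \<in> borel_measurable M \<and> integrable M (\<lambda>x. \<bar>f x\<bar> powr s)"
  by (simp add: Lp_fun_def)

lemma Lp_fun_norm_ereal: "Lp_fun_norm (ereal s) M f = (\<integral>x. \<bar>f x\<bar> powr s \<partial>M) powr (1 / s)"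
  by (simp add: Lp_fun_norm_def)

lemma Lp_fun_norm_nonneg [simp]: "0 \<le> Lp_fun_norm r M f"
  by (simp add: Lp_fun_norm_def)

lemma Lp_fun_norm_powr:
  assumes "1 \<le> s"
  shows "Lp_fun_norm (ereal s) M f powr s = (\<integral>x. \<bar>f x\<bar> powr s \<partial>M)"
  using assms by (simp add: Lp_fun_norm_ereal powr_powr)

lemma Lp_fun_PInf_AE:
  assumes "f \<in> Lp_fun \<infinity> M"
  shows "AE x in M. \<bar>f x\<bar> \<le> Lp_fun_norm \<infinity> M f"
proof -
  have fin: "esssup M (\<lambda>x. ennreal \<bar>f x\<bar>) < \<infinity>" using assms by (simp add: Lp_fun_def)
  show ?thesis using esssup_AE[of "\<lambda>x. ennreal \<bar>f x\<bar>" M]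
  proof eventually_elim
    case (elim x)
    then have "enn2real (ennreal \<bar>f x\<bar>) \<le> enn2real (esssup M (\<lambda>x. ennreal \<bar>f x\<bar>))"
      by (intro enn2real_mono) (use fin in auto)
    then show ?case by (simp add: Lp_fun_norm_def)
  qed
qed

lemma Lp_fun_PInfI:
  assumes "f \<in> borel_measurable M" "AE x in M. \<bar>f x\<bar> \<le> C" "0 \<le> C"
  shows "f \<in> Lp_fun \<infinity> M" "Lp_fun_norm \<infinity> M f \<le> C"
proof -
  have "esssup M (\<lambda>x. ennreal \<bar>f x\<bar>) \<le> ennreal C"
    using assms by (intro esssup_I) (auto elim!: eventually_mono intro!: ennreal_leI)
  then show "f \<in> Lp_fun \<infinity> M" "Lp_fun_norm \<infinity> M f \<le> C"
    using assms enn2real_mono[of "esssup M (\<lambda>x. ennreal \<bar>f x\<bar>)" "ennreal C"]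
    by (auto simp: Lp_fun_def Lp_fun_norm_def intro: le_less_trans)
qed

lemma Lp_fun_mono:
  assumes "1 \<le> r" "g \<in> Lp_fun r M" "f \<in> borel_measurable M" "AE x in M. \<bar>f x\<bar> \<le> \<bar>g x\<bar>"
  shows "f \<in> Lp_fun r M" "Lp_fun_norm r M f \<le> Lp_fun_norm r M g"
proof -
  have [measurable]: "g \<in> borel_measurable M" "f \<in> borel_measurable M"
    using assms by (auto dest: Lp_fun_measurable)
  have "f \<in> Lp_fun r M \<and> Lp_fun_norm r M f \<le> Lp_fun_norm r M g"
    using \<open>1 \<le> r\<close>
  proof (cases rule: exponent_cases)
    case inf
    have "AE x in M. \<bar>f x\<bar> \<le> Lp_fun_norm \<infinity> M g"
      using Lp_fun_PInf_AE[OF assms(2)[unfolded inf]] assms(4) by eventually_elim simp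
    then show ?thesis using Lp_fun_PInfI[OF assms(3)] inf by auto
  next
    case (fin s)
    have *: "AE x in M. \<bar>f x\<bar> powr s \<le> \<bar>g x\<bar> powr s"
      using assms(4) fin by (auto elim!: eventually_mono intro!: powr_mono2)
    have int: "integrable M (\<lambda>x. \<bar>g x\<bar> powr s)" using assms(2) fin by (simp add: Lp_fun_ereal)
    then have int': "integrable M (\<lambda>x. \<bar>f x\<bar> powr s)"
      by (rule Bochner_Integration.integrable_bound) (use * in auto)
    then have "(\<integral>x. \<bar>f x\<bar> powr s \<partial>M) \<le> (\<integral>x. \<bar>g x\<bar> powr s \<partial>M)"
      by (intro integral_mono_AE int *)
    then have "Lp_fun_norm r M f \<le> Lp_fun_norm r M g"
      unfolding fin Lp_fun_norm_ereal using fin by (intro powr_mono2 integral_nonneg) auto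
    with int' show ?thesis by (simp add: fin Lp_fun_ereal)
  qed
  then show "f \<in> Lp_fun r M" "Lp_fun_norm r M f \<le> Lp_fun_norm r M g" by auto
qed

lemma Lp_fun_cong_AE:
  assumes "1 \<le> r" "g \<in> Lp_fun r M" "f \<in> borel_measurable M" "AE x in M. f x = g x"
  shows "f \<in> Lp_fun r M" "Lp_fun_norm r M f = Lp_fun_norm r M g"
proof -
  have 1: "AE x in M. \<bar>f x\<bar> \<le> \<bar>g x\<bar>" "AE x in M. \<bar>g x\<bar> \<le> \<bar>f x\<bar>"
    using assms(4) by (auto elim!: eventually_mono)
  show *: "f \<in> Lp_fun r M" by (rule Lp_fun_mono[OF assms(1-3) 1(1)])
  show "Lp_fun_norm r M f = Lp_fun_norm r M g"
    using Lp_fun_mono(2)[OF assms(1-3) 1(1)]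
      Lp_fun_mono(2)[OF assms(1) * Lp_fun_measurable[OF assms(2)] 1(2)] by simp
qed

text \<open>Both norms depend only on the function up to null sets, also outside the space, so this
  applies to representatives before membership is known.\<close>

lemma Lp_fun_norm_cong_AE:
  assumes [measurable]: "f \<in> borel_measurable M" "g \<in> borel_measurable M" and "AE x in M. f x = g x"
  shows "Lp_fun_norm r M f = Lp_fun_norm r M g"
proof -
  have "(\<integral>x. \<bar>f x\<bar> powr real_of_ereal r \<partial>M) = (\<integral>x. \<bar>g x\<bar> powr real_of_ereal r \<partial>M)"
    using assms(3) by (intro integral_cong_AE) (auto elim!: eventually_mono)
  moreover have "esssup M (\<lambda>x. ennreal \<bar>f x\<bar>) = esssup M (\<lambda>x. ennreal \<bar>g x\<bar>)"
    using assms(3) by (intro esssup_AE_cong) (auto elim!: eventually_mono)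
  ultimately show ?thesis by (simp add: Lp_fun_norm_def)
qed

lemma Lp_fun_scale:
  assumes "1 \<le> r" "f \<in> Lp_fun r M"
  shows "(\<lambda>x. c * f x) \<in> Lp_fun r M" "Lp_fun_norm r M (\<lambda>x. c * f x) = \<bar>c\<bar> * Lp_fun_norm r M f"
proof -
  have le: "(\<lambda>x. c * f x) \<in> Lp_fun r M \<and> Lp_fun_norm r M (\<lambda>x. c * f x) \<le> \<bar>c\<bar> * Lp_fun_norm r M f"
    if "f \<in> Lp_fun r M" for f c
    using \<open>1 \<le> r\<close>
  proof (cases rule: exponent_cases)
    case inf
    have [measurable]: "f \<in> borel_measurable M" using that by (rule Lp_fun_measurable)
    have "AE x in M. \<bar>c * f x\<bar> \<le> \<bar>c\<bar> * Lp_fun_norm \<infinity> M f"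
      using Lp_fun_PInf_AE[OF that[unfolded inf]]
      by eventually_elim (simp add: abs_mult mult_left_mono)
    then show ?thesis unfolding inf by (intro conjI Lp_fun_PInfI) auto
  next
    case (fin s)
    then show ?thesis using that
      by (auto simp: Lp_fun_ereal Lp_fun_norm_ereal abs_mult powr_mult powr_powr)
  qed
  show "(\<lambda>x. c * f x) \<in> Lp_fun r M" using le assms by blast
  show "Lp_fun_norm r M (\<lambda>x. c * f x) = \<bar>c\<bar> * Lp_fun_norm r M f"
  proof (cases "c = 0")
    case False
    \<comment> \<open>The reverse inequality is the one already shown, applied to the function c f
      and the factor 1 / c.\<close>
    have "(\<lambda>x. (1 / c) * (c * f x)) = f" using False by auto
    with le[of "\<lambda>x. c * f x" "1 / c"] le[of f c] assms
    have "Lp_fun_norm r M f \<le> \<bar>1 / c\<bar> * Lp_fun_norm r M (\<lambda>x. c * f x)" by metis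
    then have "\<bar>c\<bar> * Lp_fun_norm r M f \<le> Lp_fun_norm r M (\<lambda>x. c * f x)"
      using False by (simp add: field_simps)
    with le[of f c] assms show ?thesis by auto
  next
    case True
    then show ?thesis using le[of f c] assms Lp_fun_norm_nonneg[of r M "\<lambda>x. 0"] by (simp add: True antisym del: Lp_fun_norm_nonneg)
  qed
qed

lemma Lp_fun_zero [simp]:
  assumes "1 \<le> r"
  shows "(\<lambda>x. 0) \<in> Lp_fun r M" "Lp_fun_norm r M (\<lambda>x. 0) = 0"
proof -
  show *: "(\<lambda>x. 0) \<in> Lp_fun r M" using assms
    by (cases rule: exponent_cases) (auto simp: Lp_fun_ereal intro!: Lp_fun_PInfI(1)[where C=0])
  show "Lp_fun_norm r M (\<lambda>x. 0) = 0" using Lp_fun_scale(2)[OF assms *, of 0] by simp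
qed

lemma Lp_fun_norm_eq_0_AE:
  assumes "1 \<le> r" "f \<in> Lp_fun r M" "Lp_fun_norm r M f = 0"
  shows "AE x in M. f x = 0"
  using \<open>1 \<le> r\<close>
proof (cases rule: exponent_cases)
  case inf
  then show ?thesis using Lp_fun_PInf_AE[of f M] assms by auto
next
  case (fin s)
  have "(\<integral>x. \<bar>f x\<bar> powr s \<partial>M) = 0" "integrable M (\<lambda>x. \<bar>f x\<bar> powr s)"
    using Lp_fun_norm_powr[of s M f] assms fin by (auto simp: Lp_fun_ereal)
  then have "AE x in M. \<bar>f x\<bar> powr s = 0" by (subst (asm) integral_nonneg_eq_0_iff_AE) auto
  then show ?thesis by auto
qed

lemma Lp_fun_add:
  assumes "1 \<le> r" "f \<in> Lp_fun r M" "g \<in> Lp_fun r M"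
  shows "(\<lambda>x. f x + g x) \<in> Lp_fun r M"
    "Lp_fun_norm r M (\<lambda>x. f x + g x) \<le> Lp_fun_norm r M f + Lp_fun_norm r M g"
proof -
  have m [measurable]: "f \<in> borel_measurable M" "g \<in> borel_measurable M"
    using assms by (auto dest: Lp_fun_measurable)
  let ?a = "Lp_fun_norm r M f" and ?b = "Lp_fun_norm r M g"
  have "(\<lambda>x. f x + g x) \<in> Lp_fun r M \<and> Lp_fun_norm r M (\<lambda>x. f x + g x) \<le> ?a + ?b"
  proof (cases "?a = 0 \<or> ?b = 0")
    case True
    have "AE x in M. f x = 0" if "?a = 0" using Lp_fun_norm_eq_0_AE assms that by blast
    moreover have "AE x in M. g x = 0" if "?b = 0" using Lp_fun_norm_eq_0_AE assms that by blast
    ultimately consider "AE x in M. f x + g x = g x" | "AE x in M. f x + g x = f x" using True by auto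
    then show ?thesis
    proof cases
      case 1
      from Lp_fun_cong_AE[OF assms(1,3) _ this] show ?thesis by simp
    next
      case 2
      from Lp_fun_cong_AE[OF assms(1,2) _ this] show ?thesis by simp
    qed
  next
    case False
    then have pos: "?a > 0" "?b > 0" using Lp_fun_norm_nonneg[of r M] by (auto simp: less_le)
    show ?thesis using \<open>1 \<le> r\<close>
    proof (cases rule: exponent_cases)
      case inf
      have "AE x in M. \<bar>f x + g x\<bar> \<le> ?a + ?b"
        using Lp_fun_PInf_AE[OF assms(2)[unfolded inf]] Lp_fun_PInf_AE[OF assms(3)[unfolded inf]]
        unfolding inf by eventually_elim auto
      then show ?thesis using Lp_fun_PInfI[of "\<lambda>x. f x + g x" M "?a + ?b"] pos inf by auto
    next
      case (fin s)
      have int: "integrable M (\<lambda>x. \<bar>f x\<bar> powr s)" "integrable M (\<lambda>x. \<bar>g x\<bar> powr s)"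
        using assms fin by (auto simp: Lp_fun_ereal)
      let ?h = "\<lambda>x. (?a + ?b) powr s * (?a / (?a + ?b) * (\<bar>f x\<bar> powr s / ?a powr s)
         + ?b / (?a + ?b) * (\<bar>g x\<bar> powr s / ?b powr s))"
      have *: "\<bar>f x + g x\<bar> powr s \<le> ?h x" for x
        using powr_add_le_normalized[of s ?a ?b "f x" "g x"] pos fin by blast
      have inth: "integrable M ?h" using int by auto
      have int': "integrable M (\<lambda>x. \<bar>f x + g x\<bar> powr s)"
        by (rule Bochner_Integration.integrable_bound[OF inth])
          (auto intro!: AE_I2 order.trans[OF *])
      have "(\<integral>x. \<bar>f x + g x\<bar> powr s \<partial>M) \<le> (\<integral>x. ?h x \<partial>M)"
        by (intro integral_mono int' inth *)
      also have "\<dots> = (?a + ?b) powr s"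
      proof -
        have "(\<integral>x. \<bar>f x\<bar> powr s \<partial>M) = ?a powr s" "(\<integral>x. \<bar>g x\<bar> powr s \<partial>M) = ?b powr s"
          using Lp_fun_norm_powr[of s M] fin by auto
        then show ?thesis using int pos by (simp flip: add_divide_distrib)
      qed
      finally have "(\<integral>x. \<bar>f x + g x\<bar> powr s \<partial>M) powr (1 / s) \<le> ((?a + ?b) powr s) powr (1 / s)"
        using fin by (intro powr_mono2) auto
      also have "\<dots> = ?a + ?b" using fin pos by (simp add: powr_powr)
      finally show ?thesis using int' unfolding fin by (simp add: Lp_fun_ereal Lp_fun_norm_ereal)
    qed
  qed
  then show "(\<lambda>x. f x + g x) \<in> Lp_fun r M"
    "Lp_fun_norm r M (\<lambda>x. f x + g x) \<le> Lp_fun_norm r M f + Lp_fun_norm r M g" by auto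
qed

lemma Lp_fun_sum:
  assumes "1 \<le> r" "finite I" "\<And>i. i \<in> I \<Longrightarrow> f i \<in> Lp_fun r M"
  shows "(\<lambda>x. \<Sum>i\<in>I. f i x) \<in> Lp_fun r M"
    "Lp_fun_norm r M (\<lambda>x. \<Sum>i\<in>I. f i x) \<le> (\<Sum>i\<in>I. Lp_fun_norm r M (f i))"
proof -
  have "(\<lambda>x. \<Sum>i\<in>I. f i x) \<in> Lp_fun r M \<and>
      Lp_fun_norm r M (\<lambda>x. \<Sum>i\<in>I. f i x) \<le> (\<Sum>i\<in>I. Lp_fun_norm r M (f i))"
    using assms(2,3)
  proof (induction I)
    case (insert i I)
    then show ?case using Lp_fun_add[OF assms(1), of "f i" M "\<lambda>x. \<Sum>i\<in>I. f i x"] by simp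
  qed (use assms in auto)
  then show "(\<lambda>x. \<Sum>i\<in>I. f i x) \<in> Lp_fun r M"
    "Lp_fun_norm r M (\<lambda>x. \<Sum>i\<in>I. f i x) \<le> (\<Sum>i\<in>I. Lp_fun_norm r M (f i))" by auto
qed

lemma Lp_fun_diff:
  assumes "1 \<le> r" "f \<in> Lp_fun r M" "g \<in> Lp_fun r M"
  shows "(\<lambda>x. f x - g x) \<in> Lp_fun r M"
  using Lp_fun_add(1)[OF assms(1,2) Lp_fun_scale(1)[OF assms(1,3), of "-1"]] by simp

lemma Lp_fun_abs:
  assumes "1 \<le> r" "f \<in> Lp_fun r M"
  shows "(\<lambda>x. \<bar>f x\<bar>) \<in> Lp_fun r M" "Lp_fun_norm r M (\<lambda>x. \<bar>f x\<bar>) = Lp_fun_norm r M f"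
proof -
  have [measurable]: "f \<in> borel_measurable M" using assms(2) by (rule Lp_fun_measurable)
  show "(\<lambda>x. \<bar>f x\<bar>) \<in> Lp_fun r M" by (rule Lp_fun_mono(1)[OF assms]) auto
  show "Lp_fun_norm r M (\<lambda>x. \<bar>f x\<bar>) = Lp_fun_norm r M f" by (simp add: Lp_fun_norm_def)
qed

section \<open>Finite sequences\<close>

lemma pnorm_ereal: "pnorm (ereal s) n a = (\<Sum>i<n. \<bar>a i\<bar> powr s) powr (1 / s)"
  by (simp add: pnorm_def)

lemma pnorm_ereal_powr: "1 \<le> s \<Longrightarrow> pnorm (ereal s) n a powr s = (\<Sum>i<n. \<bar>a i\<bar> powr s)"
  by (simp add: pnorm_ereal powr_powr sum_nonneg)

lemma pnorm_PInf: "pnorm \<infinity> n a = (MAX i\<in>{..<n}. \<bar>a i\<bar>)"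
  by (simp add: pnorm_def)

lemma pnorm_one: "pnorm 1 n a = (\<Sum>i<n. \<bar>a i\<bar>)"
  using pnorm_ereal[of 1 n a] by (simp add: sum_nonneg flip: one_ereal_def)

lemma pnorm_two: "pnorm 2 n a = sqrt (\<Sum>i<n. (a i)\<^sup>2)"
  using pnorm_ereal[of 2 n a] by (simp add: powr_half_sqrt sum_nonneg)

lemma pnorm_cong: "(\<And>i. i < n \<Longrightarrow> \<bar>a i\<bar> = \<bar>b i\<bar>) \<Longrightarrow> pnorm p n a = pnorm p n b"
  by (auto simp: pnorm_def intro!: arg_cong[where f=Max] arg_cong[where f="\<lambda>x. x powr _"] sum.cong image_cong)

text \<open>Counting measure makes \<open>pnorm\<close> a Lebesgue norm, so that homogeneity,
  monotonicity and the triangle inequality are inherited. The assumption \<open>1 \<le> n\<close>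
  keeps the maximum for \<open>p = \<infinity>\<close> from ranging over the empty set.\<close>

lemma pnorm_eq_Lp_fun_norm:
  assumes "1 \<le> p" "1 \<le> n"
  shows "a \<in> Lp_fun p (count_space {..<n})" "pnorm p n a = Lp_fun_norm p (count_space {..<n}) a"
proof -
  have "a \<in> Lp_fun p (count_space {..<n}) \<and> pnorm p n a = Lp_fun_norm p (count_space {..<n}) a"
    using \<open>1 \<le> p\<close>
  proof (cases rule: exponent_cases)
    case inf
    have ne: "{..<n} \<noteq> {}" using \<open>1 \<le> n\<close> by (auto simp: lessThan_empty_iff)
    have "AE x in count_space {..<n}. \<bar>a x\<bar> \<le> pnorm \<infinity> n a"
      by (auto simp: AE_count_space pnorm_PInf)
    moreover have "0 \<le> pnorm \<infinity> n a"
      using ne assms by (subst pnorm_PInf, subst Max_ge_iff) (auto intro!: bexI[of _ 0])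
    ultimately have *: "a \<in> Lp_fun \<infinity> (count_space {..<n})"
      "Lp_fun_norm \<infinity> (count_space {..<n}) a \<le> pnorm \<infinity> n a"
      by (auto intro: Lp_fun_PInfI)
    moreover have "pnorm \<infinity> n a \<le> Lp_fun_norm \<infinity> (count_space {..<n}) a"
      using Lp_fun_PInf_AE[OF *(1)] ne by (auto simp: AE_count_space pnorm_PInf)
    ultimately show ?thesis using inf by auto
  next
    case (fin s)
    then show ?thesis
      by (simp add: Lp_fun_ereal Lp_fun_norm_ereal pnorm_ereal lebesgue_integral_count_space_finite
         integrable_count_space)
  qed
  then show "a \<in> Lp_fun p (count_space {..<n})" "pnorm p n a = Lp_fun_norm p (count_space {..<n}) a"
    by auto
qed

lemma pnorm_nonneg: "1 \<le> p \<Longrightarrow> 1 \<le> n \<Longrightarrow> 0 \<le> pnorm p n a"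
  by (simp add: pnorm_eq_Lp_fun_norm(2))

lemma pnorm_scale: "1 \<le> p \<Longrightarrow> 1 \<le> n \<Longrightarrow> pnorm p n (\<lambda>i. c * a i) = \<bar>c\<bar> * pnorm p n a"
  by (simp add: pnorm_eq_Lp_fun_norm Lp_fun_scale)

lemma pnorm_zero: "1 \<le> p \<Longrightarrow> 1 \<le> n \<Longrightarrow> pnorm p n (\<lambda>i. 0) = 0"
  by (simp add: pnorm_eq_Lp_fun_norm)

lemma pnorm_mono:
  assumes "1 \<le> p" "1 \<le> n" "\<And>i. i < n \<Longrightarrow> \<bar>a i\<bar> \<le> \<bar>b i\<bar>"
  shows "pnorm p n a \<le> pnorm p n b"
  unfolding pnorm_eq_Lp_fun_norm(2)[OF assms(1,2)]
  by (rule Lp_fun_mono(2)[OF assms(1) pnorm_eq_Lp_fun_norm(1)[OF assms(1,2)]])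
    (use assms(3) in \<open>auto simp: AE_count_space\<close>)

lemma pnorm_sum:
  assumes "1 \<le> p" "1 \<le> n" "finite J"
  shows "pnorm p n (\<lambda>i. \<Sum>j\<in>J. f j i) \<le> (\<Sum>j\<in>J. pnorm p n (f j))"
  using assms by (simp add: pnorm_eq_Lp_fun_norm Lp_fun_sum)

lemma pnorm_add:
  assumes "1 \<le> p" "1 \<le> n"
  shows "pnorm p n (\<lambda>i. f i + g i) \<le> pnorm p n f + pnorm p n g"
  using assms by (simp add: pnorm_eq_Lp_fun_norm Lp_fun_add)

lemma abs_le_pnorm:
  assumes "1 \<le> p" "i < n"
  shows "\<bar>a i\<bar> \<le> pnorm p n a"
  using \<open>1 \<le> p\<close>
proof (cases rule: exponent_cases)
  case inf
  then show ?thesis using assms by (auto simp: pnorm_PInf)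
next
  case (fin s)
  have "\<bar>a i\<bar> = (\<bar>a i\<bar> powr s) powr (1 / s)" using fin by (simp add: powr_powr)
  also have "\<dots> \<le> (\<Sum>i<n. \<bar>a i\<bar> powr s) powr (1 / s)"
    using fin assms by (intro powr_mono2 member_le_sum) auto
  finally show ?thesis using fin by (simp add: pnorm_ereal)
qed

lemma pnorm_unit:
  assumes "1 \<le> p" "j < n"
  shows "pnorm p n (\<lambda>i. if i = j then c else 0) = \<bar>c\<bar>"
  using \<open>1 \<le> p\<close>
proof (cases rule: exponent_cases)
  case inf
  show ?thesis unfolding inf pnorm_PInf using assms by (intro Max_eqI) auto
next
  case (fin s)
  have "(\<Sum>i<n. \<bar>if i = j then c else 0\<bar> powr s) = (\<Sum>i<n. if i = j then \<bar>c\<bar> powr s else 0)"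
    by (intro sum.cong) auto
  then show ?thesis using fin assms by (simp add: pnorm_ereal powr_powr)
qed

lemma pnorm_le_sum_abs:
  assumes "1 \<le> p" "1 \<le> n"
  shows "pnorm p n a \<le> (\<Sum>i<n. \<bar>a i\<bar>)"
proof -
  have "pnorm p n a = pnorm p n (\<lambda>i. \<Sum>j<n. if i = j then a j else 0)"
    by (intro pnorm_cong) auto
  also have "\<dots> \<le> (\<Sum>j<n. pnorm p n (\<lambda>i. if i = j then a j else 0))"
    using assms by (intro pnorm_sum) auto
  also have "\<dots> = (\<Sum>i<n. \<bar>a i\<bar>)" using assms by (intro sum.cong pnorm_unit) auto
  finally show ?thesis .
qed

lemma pnorm_eq_0_iff:
  assumes "1 \<le> p" "1 \<le> n"
  shows "pnorm p n a = 0 \<longleftrightarrow> (\<forall>i<n. a i = 0)"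
proof
  assume "pnorm p n a = 0"
  then show "\<forall>i<n. a i = 0" using abs_le_pnorm[OF assms(1), of _ n a] by fastforce
next
  assume "\<forall>i<n. a i = 0"
  then show "pnorm p n a = 0" using pnorm_le_sum_abs[OF assms, of a] pnorm_nonneg[OF assms, of a] by simp
qed

text \<open>Every |a_i| is at most the norm N with the smaller exponent t. Splitting |a_i|^s as
  |a_i|^t |a_i|^(s - t) and bounding the second factor by N^(s - t) gives the claim.\<close>

lemma pnorm_antimono_exponent:
  assumes "1 \<le> q" "q \<le> p" "1 \<le> n"
  shows "pnorm p n a \<le> pnorm q n a"
proof -
  have p: "1 \<le> p" using assms by simp
  then show ?thesis
  proof (cases rule: exponent_cases)
    case inf
    have ne: "{..<n} \<noteq> {}" using \<open>1 \<le> n\<close> by (auto simp: lessThan_empty_iff)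
    show ?thesis unfolding inf pnorm_PInf using abs_le_pnorm[OF assms(1)] ne by (intro Max.boundedI) auto
  next
    case (fin s)
    obtain t where t: "q = ereal t" "1 \<le> t" "t \<le> s"
      using assms fin by (cases q) auto
    let ?N = "pnorm q n a"
    show ?thesis
    proof (cases "?N = 0")
      case True
      then have "pnorm p n a = 0" using pnorm_eq_0_iff[OF assms(1,3), of a] pnorm_eq_0_iff[OF p assms(3), of a] by blast
      then show ?thesis using True by simp
    next
      case False
      then have N: "?N > 0" using pnorm_nonneg[OF assms(1,3), of a] by simp
      have "(\<Sum>i<n. \<bar>a i\<bar> powr s) \<le> (\<Sum>i<n. \<bar>a i\<bar> powr t * ?N powr (s - t))"
      proof (intro sum_mono)
        fix i assume "i \<in> {..<n}"
        then have "\<bar>a i\<bar> powr (s - t) \<le> ?N powr (s - t)"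
          using t abs_le_pnorm[OF assms(1), of i n a] by (intro powr_mono2) auto
        then have "\<bar>a i\<bar> powr t * \<bar>a i\<bar> powr (s - t) \<le> \<bar>a i\<bar> powr t * ?N powr (s - t)"
          by (intro mult_left_mono) auto
        then show "\<bar>a i\<bar> powr s \<le> \<bar>a i\<bar> powr t * ?N powr (s - t)" by (simp flip: powr_add)
      qed
      also have "\<dots> = ?N powr t * ?N powr (s - t)"
        using pnorm_ereal_powr[of t n a] t by (simp add: sum_distrib_right)
      also have "\<dots> = ?N powr s" by (simp flip: powr_add)
      finally have "(\<Sum>i<n. \<bar>a i\<bar> powr s) powr (1 / s) \<le> (?N powr s) powr (1 / s)"
        using fin by (intro powr_mono2 sum_nonneg) auto
      then show ?thesis using fin N by (simp add: pnorm_ereal powr_powr)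
    qed
  qed
qed

lemma pnorm_measurable [measurable]:
  assumes "1 \<le> p" "1 \<le> n" and [measurable]: "\<And>i. i < n \<Longrightarrow> f i \<in> borel_measurable M"
  shows "(\<lambda>x. pnorm p n (\<lambda>i. f i x)) \<in> borel_measurable M"
  using \<open>1 \<le> p\<close>
proof (cases rule: exponent_cases)
  case inf
  have "(\<lambda>x. Max ((\<lambda>i. \<bar>f i x\<bar>) ` {..<n})) \<in> borel_measurable M"
    by (intro borel_measurable_Max) auto
  then show ?thesis unfolding inf pnorm_PInf .
next
  case (fin s)
  show ?thesis unfolding fin pnorm_ereal by measurable
qed

section \<open>Conjugate exponents\<close>

definition conj_exp :: "ereal \<Rightarrow> ereal" where
  "conj_exp p = (if p = 1 then \<infinity> else if p = \<infinity> then 1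
     else ereal (real_of_ereal p / (real_of_ereal p - 1)))"

lemma conj_exp_simps [simp]: "conj_exp 1 = \<infinity>" "conj_exp \<infinity> = 1" "conj_exp 2 = 2"
  by (auto simp: conj_exp_def one_ereal_def)

lemma conj_exp_ereal: "1 < s \<Longrightarrow> conj_exp (ereal s) = ereal (s / (s - 1))"
  by (auto simp: conj_exp_def one_ereal_def)

text \<open>The relation \<open>s' * (s - 1) = s\<close> is the form of conjugacy that the extremal
  vector in Hoelder's inequality uses.\<close>

lemma conj_exponent_cases:
  assumes "1 \<le> (p::ereal)"
  obtains (one) "p = 1" "conj_exp p = \<infinity>" | (inf) "p = \<infinity>" "conj_exp p = 1"
  | (fin) s s' where "p = ereal s" "conj_exp p = ereal s'" "1 < s" "1 < s'" "1 / s + 1 / s' = 1" "s' * (s - 1) = s"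
proof (cases "p = 1 \<or> p = \<infinity>")
  case True
  then show ?thesis using that by auto
next
  case False
  then obtain s where s: "p = ereal s" "1 < s"
    using assms by (cases p) (auto simp: one_ereal_def)
  show ?thesis
    by (rule that(3)[OF s(1) _ s(2), of "s / (s - 1)"]) (use s in \<open>auto simp: conj_exp_ereal field_simps\<close>)
qed

lemma one_le_conj_exp [simp]: "1 \<le> p \<Longrightarrow> 1 \<le> conj_exp p"
  by (erule conj_exponent_cases) (auto simp: one_ereal_def)

lemma conj_exp_conj_exp:
  assumes "1 \<le> p"
  shows "conj_exp (conj_exp p) = p"
  using assms
proof (cases rule: conj_exponent_cases)
  case (fin s s')
  then have "s' = s / (s - 1)" by (simp add: field_simps)
  moreover have "s / (s - 1) - 1 = 1 / (s - 1)" using fin by (simp add: field_simps)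
  ultimately show ?thesis using fin by (simp add: conj_exp_ereal)
qed auto

text \<open>Needed to carry \<open>t < r2\<close> over to the conjugate exponents, where the results
  for exponents below 2 apply.\<close>

lemma conj_exp_strict_antimono:
  assumes "1 \<le> p" "p < q"
  shows "conj_exp q < conj_exp p"
proof -
  have "1 \<le> q" using assms by auto
  then show ?thesis
  proof (cases rule: conj_exponent_cases)
    case one
    then show ?thesis using assms by auto
  next
    case inf
    note inf' = this
    show ?thesis using \<open>1 \<le> p\<close>
      by (cases rule: conj_exponent_cases) (use assms inf' in \<open>auto simp: one_ereal_def\<close>)
  next
    case (fin s s')
    note fin' = this
    show ?thesis using \<open>1 \<le> p\<close>
    proof (cases rule: conj_exponent_cases)
      case (fin u u')
      have "u < s" using assms fin fin' by auto
      then have "1 / s < 1 / u" using fin by (simp add: frac_less2)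
      then have "1 / u' < 1 / s'" using fin fin' by linarith
      then have "s' < u'" using fin fin' by (simp add: field_simps)
      then show ?thesis using fin fin' by simp
    qed (use fin assms in auto)
  qed
qed

lemma pnorm_Holder_one_PInf: "(\<Sum>i<n. a i * b i) \<le> pnorm 1 n a * pnorm \<infinity> n b"
proof -
  have "(\<Sum>i<n. a i * b i) \<le> (\<Sum>i<n. \<bar>a i\<bar> * pnorm \<infinity> n b)"
  proof (intro sum_mono)
    fix i assume "i \<in> {..<n}"
    then have "\<bar>a i\<bar> * \<bar>b i\<bar> \<le> \<bar>a i\<bar> * pnorm \<infinity> n b"
      by (intro mult_left_mono abs_le_pnorm) auto
    then show "a i * b i \<le> \<bar>a i\<bar> * pnorm \<infinity> n b"
      by (metis abs_ge_self abs_mult order_trans)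
  qed
  then show ?thesis by (simp add: pnorm_one sum_distrib_right)
qed

lemma pnorm_Holder:
  assumes "1 \<le> p" "1 \<le> n"
  shows "(\<Sum>i<n. a i * b i) \<le> pnorm p n a * pnorm (conj_exp p) n b"
  using \<open>1 \<le> p\<close>
proof (cases rule: conj_exponent_cases)
  case one
  then show ?thesis using pnorm_Holder_one_PInf by simp
next
  case inf
  then show ?thesis using pnorm_Holder_one_PInf[of b a] by (simp add: mult.commute)
next
  case (fin s s')
  let ?N = "pnorm p n a" and ?N' = "pnorm (conj_exp p) n b"
  have nn: "?N \<ge> 0" "?N' \<ge> 0" using assms by (simp_all add: pnorm_nonneg)
  show ?thesis
  proof (cases "?N = 0 \<or> ?N' = 0")
    case True
    then have "(\<forall>i<n. a i = 0) \<or> (\<forall>i<n. b i = 0)"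
      using pnorm_eq_0_iff[OF assms, of a] pnorm_eq_0_iff[OF one_le_conj_exp[OF assms(1)] assms(2), of b] by blast
    then have "(\<Sum>i<n. a i * b i) = 0" by (intro sum.neutral) auto
    then show ?thesis using nn by simp
  next
    case False
    then have pos: "?N > 0" "?N' > 0" using nn by auto
    have pw: "?N powr s = (\<Sum>i<n. \<bar>a i\<bar> powr s)" "?N' powr s' = (\<Sum>i<n. \<bar>b i\<bar> powr s')"
      using fin pnorm_ereal_powr by auto
    \<comment> \<open>Both vectors are scaled to norm 1, where Young's inequality summed over i
      gives 1 / s + 1 / s' = 1.\<close>
    have "(\<Sum>i<n. a i * b i) / (?N * ?N') = (\<Sum>i<n. a i / ?N * (b i / ?N'))"
      by (simp add: sum_divide_distrib)
    also have "\<dots> \<le> (\<Sum>i<n. (\<bar>a i\<bar> / ?N) powr s / s + (\<bar>b i\<bar> / ?N') powr s' / s')"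
    proof (intro sum_mono)
      fix i
      have "a i / ?N * (b i / ?N') \<le> \<bar>a i\<bar> / ?N * (\<bar>b i\<bar> / ?N')"
        using pos abs_ge_self[of "a i * b i"] by (simp add: divide_right_mono abs_mult)
      also have "\<dots> \<le> (\<bar>a i\<bar> / ?N) powr s / s + (\<bar>b i\<bar> / ?N') powr s' / s'"
        using fin pos by (intro Youngs_inequality) auto
      finally show "a i / ?N * (b i / ?N') \<le> (\<bar>a i\<bar> / ?N) powr s / s + (\<bar>b i\<bar> / ?N') powr s' / s'" .
    qed
    also have "\<dots> = (\<Sum>i<n. \<bar>a i\<bar> powr s) / ?N powr s / s + (\<Sum>i<n. \<bar>b i\<bar> powr s') / ?N' powr s' / s'"
      using pos by (simp add: sum.distrib powr_divide sum_divide_distrib)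
    also have "\<dots> = 1" using pos fin by (simp flip: pw)
    finally show ?thesis using pos by (simp add: divide_le_eq)
  qed
qed

text \<open>Equality in Hoelder's inequality is attained: by the signs for exponent 1, by a unit
  vector at a largest entry for \<infinity>, and by a normalised power with signs in between.
  Attainment makes the passage between forms and operators free of constants.\<close>

lemma pnorm_norming:
  assumes "1 \<le> p" "1 \<le> n"
  obtains b where "(\<Sum>i<n. a i * b i) = pnorm p n a" "pnorm (conj_exp p) n b \<le> 1"
  using \<open>1 \<le> p\<close>
proof (cases rule: conj_exponent_cases)
  case one
  have "pnorm \<infinity> n (\<lambda>i. sgn (a i)) \<le> 1"
    unfolding pnorm_PInf using assms by (subst Max_le_iff) (auto simp: sgn_if lessThan_empty_iff)
  then show ?thesis using one by (intro that[of "\<lambda>i. sgn (a i)"]) (auto simp: pnorm_one abs_sgn)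
next
  case inf
  have "Max ((\<lambda>i. \<bar>a i\<bar>) ` {..<n}) \<in> (\<lambda>i. \<bar>a i\<bar>) ` {..<n}"
    using assms by (intro Max_in) (auto simp: lessThan_empty_iff)
  then obtain k where k: "k < n" "pnorm \<infinity> n a = \<bar>a k\<bar>" by (auto simp: pnorm_PInf)
  show ?thesis
  proof (rule that[of "\<lambda>i. if i = k then sgn (a k) else 0"])
    show "(\<Sum>i<n. a i * (if i = k then sgn (a k) else 0)) = pnorm p n a"
      using k inf by (simp add: if_distrib[of "\<lambda>x. a _ * x"] sum.delta abs_sgn cong: if_cong)
    show "pnorm (conj_exp p) n (\<lambda>i. if i = k then sgn (a k) else 0) \<le> 1"
      using pnorm_unit[OF one_le_conj_exp[OF assms(1)] k(1), of "sgn (a k)"] by (simp add: sgn_if)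
  qed
next
  case (fin s s')
  let ?N = "pnorm p n a"
  have pw: "?N powr s = (\<Sum>i<n. \<bar>a i\<bar> powr s)" using fin pnorm_ereal_powr by auto
  show ?thesis
  proof (cases "?N = 0")
    case True
    then show ?thesis using pnorm_eq_0_iff[OF assms, of a] pnorm_zero[OF one_le_conj_exp[OF assms(1)] assms(2)]
      by (intro that[of "\<lambda>i. 0"]) auto
  next
    case False
    then have N: "?N > 0" using pnorm_nonneg[OF assms, of a] by simp
    \<comment> \<open>Since \<open>s' * (s - 1) = s\<close>, the s'-th powers of these entries are
      |a_i|^s / N^s in absolute value and sum to 1; pairing with a gives N^s / N^(s - 1) =
      N.\<close>
    let ?b = "\<lambda>i. sgn (a i) * \<bar>a i\<bar> powr (s - 1) / ?N powr (s - 1)"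
    show ?thesis
    proof (rule that[of ?b])
      have "a i * ?b i = \<bar>a i\<bar> powr s / ?N powr (s - 1)" for i
      proof (cases "a i = 0")
        case False
        then have "\<bar>a i\<bar> powr s = \<bar>a i\<bar> * \<bar>a i\<bar> powr (s - 1)"
          using powr_add[of "\<bar>a i\<bar>" 1 "s - 1"] by simp
        then show ?thesis using abs_sgn[of "a i"] by simp
      qed simp
      then have "(\<Sum>i<n. a i * ?b i) = ?N powr s / ?N powr (s - 1)"
        by (simp only: pw sum_divide_distrib)
      also have "\<dots> = ?N" using N by (simp flip: powr_diff)
      finally show "(\<Sum>i<n. a i * ?b i) = ?N" .
      have "\<bar>?b i\<bar> powr s' = \<bar>a i\<bar> powr s / ?N powr s" for i
        using fin by (cases "a i = 0") (auto simp: abs_mult powr_divide powr_powr mult.commute abs_sgn_eq)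
      then have "(\<Sum>i<n. \<bar>?b i\<bar> powr s') = ?N powr s / ?N powr s"
        by (simp only: pw sum_divide_distrib)
      then have "(\<Sum>i<n. \<bar>?b i\<bar> powr s') = 1" using N by simp
      then show "pnorm (conj_exp p) n ?b \<le> 1" using fin by (simp add: pnorm_ereal)
    qed
  qed
qed

section \<open>Matrices acting on finite sequences of vectors\<close>

text \<open>The index i numbers the vectors and j their coordinates, so this is the discrete form of
  the norm of the t-th lattice sum of n elements of L_r.\<close>

definition mnorm :: "ereal \<Rightarrow> ereal \<Rightarrow> nat \<Rightarrow> nat \<Rightarrow> (nat \<Rightarrow> nat \<Rightarrow> real) \<Rightarrow> real" where
  "mnorm r t n m X = pnorm r m (\<lambda>j. pnorm t n (\<lambda>i. X i j))"

lemma mnorm_nonneg: "1 \<le> r \<Longrightarrow> 1 \<le> m \<Longrightarrow> 0 \<le> mnorm r t n m X"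
  by (simp add: mnorm_def pnorm_nonneg)

lemma mnorm_Holder:
  assumes "1 \<le> r" "1 \<le> t" "1 \<le> n" "1 \<le> m"
  shows "(\<Sum>i<n. \<Sum>j<m. X i j * Y i j) \<le> mnorm r t n m X * mnorm (conj_exp r) (conj_exp t) n m Y"
proof -
  have "(\<Sum>i<n. \<Sum>j<m. X i j * Y i j) = (\<Sum>j<m. \<Sum>i<n. X i j * Y i j)" by (rule sum.swap)
  also have "\<dots> \<le> (\<Sum>j<m. pnorm t n (\<lambda>i. X i j) * pnorm (conj_exp t) n (\<lambda>i. Y i j))"
    by (intro sum_mono pnorm_Holder assms)
  also have "\<dots> \<le> mnorm r t n m X * mnorm (conj_exp r) (conj_exp t) n m Y"
    unfolding mnorm_def by (intro pnorm_Holder assms)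
  finally show ?thesis .
qed

text \<open>Choose a norming vector for each column and one for the vector of column norms. In their
  product the j-th column has norm at most the j-th entry of the latter, by homogeneity.\<close>

lemma mnorm_norming:
  assumes "1 \<le> r" "1 \<le> t" "1 \<le> n" "1 \<le> m"
  obtains Y where "(\<Sum>i<n. \<Sum>j<m. X i j * Y i j) = mnorm r t n m X"
    "mnorm (conj_exp r) (conj_exp t) n m Y \<le> 1"
proof -
  have "\<exists>b. (\<Sum>i<n. X i j * b i) = pnorm t n (\<lambda>i. X i j) \<and> pnorm (conj_exp t) n b \<le> 1" for j
    using pnorm_norming[OF assms(2,3), of "\<lambda>i. X i j"] by metis
  then obtain b where b: "\<And>j. (\<Sum>i<n. X i j * b j i) = pnorm t n (\<lambda>i. X i j)"
    "\<And>j. pnorm (conj_exp t) n (b j) \<le> 1" by metis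
  obtain v where v: "(\<Sum>j<m. pnorm t n (\<lambda>i. X i j) * v j) = mnorm r t n m X" "pnorm (conj_exp r) m v \<le> 1"
    using pnorm_norming[OF assms(1,4)] unfolding mnorm_def by metis
  show ?thesis
  proof (rule that[of "\<lambda>i j. v j * b j i"])
    have "(\<Sum>i<n. \<Sum>j<m. X i j * (v j * b j i)) = (\<Sum>j<m. \<Sum>i<n. X i j * (v j * b j i))" by (rule sum.swap)
    also have "\<dots> = (\<Sum>j<m. (\<Sum>i<n. X i j * b j i) * v j)"
      by (simp add: sum_distrib_left sum_distrib_right mult_ac)
    finally show "(\<Sum>i<n. \<Sum>j<m. X i j * (v j * b j i)) = mnorm r t n m X" by (simp add: b v)
    have "mnorm (conj_exp r) (conj_exp t) n m (\<lambda>i j. v j * b j i) \<le> pnorm (conj_exp r) m v"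
      unfolding mnorm_def
    proof (rule pnorm_mono)
      fix j
      have "pnorm (conj_exp t) n (\<lambda>i. v j * b j i) = \<bar>v j\<bar> * pnorm (conj_exp t) n (b j)"
        by (intro pnorm_scale one_le_conj_exp assms)
      also have "\<dots> \<le> \<bar>v j\<bar>" using b(2)[of j] by (simp add: mult_left_le)
      finally show "\<bar>pnorm (conj_exp t) n (\<lambda>i. v j * b j i)\<bar> \<le> \<bar>v j\<bar>"
        using pnorm_nonneg[OF one_le_conj_exp[OF assms(2)] assms(3), of "\<lambda>i. v j * b j i"] by simp
    qed (use assms in auto)
    then show "mnorm (conj_exp r) (conj_exp t) n m (\<lambda>i j. v j * b j i) \<le> 1" using v by simp
  qed
qed

section \<open>Bilinear and operator forms of the matrix inequality\<close>

definition bilin_bound :: "ereal \<Rightarrow> ereal \<Rightarrow> nat \<Rightarrow> nat \<Rightarrow> (nat \<Rightarrow> nat \<Rightarrow> real) \<Rightarrow> real \<Rightarrow> bool" where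
  "bilin_bound r s m l A C \<longleftrightarrow>
     (\<forall>u v. (\<Sum>j<m. \<Sum>k<l. A j k * u j * v k) \<le> C * pnorm r m u * pnorm s l v)"

definition mixed_bound ::
  "ereal \<Rightarrow> ereal \<Rightarrow> ereal \<Rightarrow> nat \<Rightarrow> nat \<Rightarrow> nat \<Rightarrow> (nat \<Rightarrow> nat \<Rightarrow> real) \<Rightarrow> real \<Rightarrow> bool" where
  "mixed_bound r s t n m l A K \<longleftrightarrow> (\<forall>X Y. (\<Sum>i<n. \<Sum>j<m. \<Sum>k<l. A j k * X i j * Y i k)
     \<le> K * mnorm r t n m X * mnorm s (conj_exp t) n l Y)"

text \<open>Here s is conjugate to the exponent of the range: \<open>bilin_bound\<close> bounds the
  norm of the matrix as an operator, and \<open>mixed_bound\<close> is the same form tested on n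
  vectors at once. The constant K stands before the dimensions, since only a uniform bound survives
  approximation.\<close>

definition bilin_regular :: "ereal \<Rightarrow> ereal \<Rightarrow> ereal \<Rightarrow> bool" where
  "bilin_regular r s t \<longleftrightarrow> (\<exists>K\<ge>0. \<forall>n\<ge>1. \<forall>m\<ge>1. \<forall>l\<ge>1. \<forall>A. \<forall>C\<ge>0.
     bilin_bound r s m l A C \<longrightarrow> mixed_bound r s t n m l A (K * C))"

lemma bilin_bound_transpose:
  assumes "bilin_bound r s m l A C"
  shows "bilin_bound s r l m (\<lambda>k j. A j k) C"
  unfolding bilin_bound_def
proof (intro allI)
  fix u v
  have "(\<Sum>j<l. \<Sum>k<m. A k j * u j * v k) = (\<Sum>k<m. \<Sum>j<l. A k j * v k * u j)"
    by (subst sum.swap) (simp add: mult_ac)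
  also have "\<dots> \<le> C * pnorm r m v * pnorm s l u" using assms by (simp add: bilin_bound_def)
  finally show "(\<Sum>j<l. \<Sum>k<m. A k j * u j * v k) \<le> C * pnorm s l u * pnorm r m v" by (simp add: mult_ac)
qed

text \<open>The two matrices of vectors exchange roles. The one that carried
  \<open>conj_exp t\<close> becomes the argument, and biconjugation restores t for the
  other.\<close>

lemma bilin_regular_transpose:
  assumes "bilin_regular r s t" "1 \<le> t"
  shows "bilin_regular s r (conj_exp t)"
proof -
  from assms(1) obtain K where K: "K \<ge> 0" "\<And>n m l A C. n \<ge> 1 \<Longrightarrow> m \<ge> 1 \<Longrightarrow> l \<ge> 1 \<Longrightarrow> C \<ge> 0 \<Longrightarrow>
     bilin_bound r s m l A C \<Longrightarrow> mixed_bound r s t n m l A (K * C)"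
    unfolding bilin_regular_def by metis
  have "mixed_bound s r (conj_exp t) n m l A (K * C)"
    if "n \<ge> 1" "m \<ge> 1" "l \<ge> 1" "C \<ge> 0" "bilin_bound s r m l A C" for n m l A C
    unfolding mixed_bound_def
  proof (intro allI)
    fix X Y
    have "(\<Sum>i<n. \<Sum>j<m. \<Sum>k<l. A j k * X i j * Y i k) = (\<Sum>i<n. \<Sum>k<l. \<Sum>j<m. A j k * Y i k * X i j)"
      by (rule sum.cong[OF refl], subst sum.swap) (simp add: mult_ac)
    also have "\<dots> \<le> K * C * mnorm r t n l Y * mnorm s (conj_exp t) n m X"
      using K(2)[OF that(1,3,2,4) bilin_bound_transpose[OF that(5)]] by (simp add: mixed_bound_def)
    finally show "(\<Sum>i<n. \<Sum>j<m. \<Sum>k<l. A j k * X i j * Y i k)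
      \<le> K * C * mnorm s (conj_exp t) n m X * mnorm r (conj_exp (conj_exp t)) n l Y"
      using assms(2) by (simp add: conj_exp_conj_exp mult_ac)
  qed
  then show ?thesis using K(1) unfolding bilin_regular_def by blast
qed

lemma bilin_boundI:
  assumes "1 \<le> r2" "1 \<le> m" "1 \<le> l"
    and "\<And>u. pnorm r2 l (\<lambda>k. \<Sum>j<m. A j k * u j) \<le> C * pnorm r1 m u"
  shows "bilin_bound r1 (conj_exp r2) m l A C"
  unfolding bilin_bound_def
proof (intro allI)
  fix u v
  have "(\<Sum>j<m. \<Sum>k<l. A j k * u j * v k) = (\<Sum>k<l. (\<Sum>j<m. A j k * u j) * v k)"
    by (subst sum.swap) (simp add: sum_distrib_right)
  also have "\<dots> \<le> pnorm r2 l (\<lambda>k. \<Sum>j<m. A j k * u j) * pnorm (conj_exp r2) l v"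
    using assms by (intro pnorm_Holder)
  also have "\<dots> \<le> C * pnorm r1 m u * pnorm (conj_exp r2) l v"
    using assms by (intro mult_right_mono pnorm_nonneg) auto
  finally show "(\<Sum>j<m. \<Sum>k<l. A j k * u j * v k) \<le> C * pnorm r1 m u * pnorm (conj_exp r2) l v" .
qed

text \<open>Converse of the Hoelder step: testing against a norming vector of the image loses
  nothing, hence the same C in both directions.\<close>

lemma bilin_boundD:
  assumes "1 \<le> r1" "1 \<le> r2" "1 \<le> m" "1 \<le> l" "0 \<le> C" "bilin_bound r1 (conj_exp r2) m l A C"
  shows "pnorm r2 l (\<lambda>k. \<Sum>j<m. A j k * u j) \<le> C * pnorm r1 m u"
proof -
  obtain v where v: "(\<Sum>k<l. (\<Sum>j<m. A j k * u j) * v k) = pnorm r2 l (\<lambda>k. \<Sum>j<m. A j k * u j)"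
    "pnorm (conj_exp r2) l v \<le> 1"
    by (rule pnorm_norming[OF assms(2,4), of "\<lambda>k. \<Sum>j<m. A j k * u j"])
  have "pnorm r2 l (\<lambda>k. \<Sum>j<m. A j k * u j) = (\<Sum>j<m. \<Sum>k<l. A j k * u j * v k)"
    unfolding v(1)[symmetric] by (subst sum.swap) (simp add: sum_distrib_right)
  also have "\<dots> \<le> C * pnorm r1 m u * pnorm (conj_exp r2) l v"
    using assms(6) by (simp add: bilin_bound_def)
  also have "\<dots> \<le> C * pnorm r1 m u"
    by (intro mult_left_le mult_nonneg_nonneg v(2) assms(5) pnorm_nonneg assms(1,3))
  finally show ?thesis .
qed

lemma mixed_boundI:
  assumes "1 \<le> r2" "1 \<le> t" "1 \<le> n" "1 \<le> m" "1 \<le> l"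
    and "\<And>X. mnorm r2 t n l (\<lambda>i k. \<Sum>j<m. A j k * X i j) \<le> K * mnorm r1 t n m X"
  shows "mixed_bound r1 (conj_exp r2) t n m l A K"
  unfolding mixed_bound_def
proof (intro allI)
  fix X Y
  have "(\<Sum>i<n. \<Sum>j<m. \<Sum>k<l. A j k * X i j * Y i k) = (\<Sum>i<n. \<Sum>k<l. (\<Sum>j<m. A j k * X i j) * Y i k)"
    by (rule sum.cong[OF refl], subst sum.swap) (simp add: sum_distrib_right)
  also have "\<dots> \<le> mnorm r2 t n l (\<lambda>i k. \<Sum>j<m. A j k * X i j) * mnorm (conj_exp r2) (conj_exp t) n l Y"
    using assms by (intro mnorm_Holder)
  also have "\<dots> \<le> K * mnorm r1 t n m X * mnorm (conj_exp r2) (conj_exp t) n l Y"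
    using assms by (intro mult_right_mono mnorm_nonneg) auto
  finally show "(\<Sum>i<n. \<Sum>j<m. \<Sum>k<l. A j k * X i j * Y i k)
     \<le> K * mnorm r1 t n m X * mnorm (conj_exp r2) (conj_exp t) n l Y" .
qed

lemma mixed_boundD:
  assumes "1 \<le> r1" "1 \<le> r2" "1 \<le> t" "1 \<le> n" "1 \<le> m" "1 \<le> l" "0 \<le> K"
    and "mixed_bound r1 (conj_exp r2) t n m l A K"
  shows "mnorm r2 t n l (\<lambda>i k. \<Sum>j<m. A j k * X i j) \<le> K * mnorm r1 t n m X"
proof -
  obtain Y where Y: "(\<Sum>i<n. \<Sum>k<l. (\<Sum>j<m. A j k * X i j) * Y i k) = mnorm r2 t n l (\<lambda>i k. \<Sum>j<m. A j k * X i j)"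
    "mnorm (conj_exp r2) (conj_exp t) n l Y \<le> 1"
    by (rule mnorm_norming[OF assms(2,3,4,6), of "\<lambda>i k. \<Sum>j<m. A j k * X i j"])
  have "mnorm r2 t n l (\<lambda>i k. \<Sum>j<m. A j k * X i j) = (\<Sum>i<n. \<Sum>j<m. \<Sum>k<l. A j k * X i j * Y i k)"
    unfolding Y(1)[symmetric] by (rule sum.cong[OF refl], subst sum.swap) (simp add: sum_distrib_right)
  also have "\<dots> \<le> K * mnorm r1 t n m X * mnorm (conj_exp r2) (conj_exp t) n l Y"
    using assms(8) by (simp add: mixed_bound_def)
  also have "\<dots> \<le> K * mnorm r1 t n m X"
    by (intro mult_left_le mult_nonneg_nonneg Y(2) assms(7) mnorm_nonneg assms(1,5))
  finally show ?thesis .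
qed

text \<open>Here hypothesis and claim speak of images of vectors. Arguments row by row or column by
  column are carried out in this form, transposition and Grothendieck's inequality in the bilinear
  one.\<close>

lemma bilin_regularI:
  assumes "1 \<le> r1" "1 \<le> r2" "1 \<le> t" "0 \<le> K"
    and "\<And>n m l A C X. 1 \<le> n \<Longrightarrow> 1 \<le> m \<Longrightarrow> 1 \<le> l \<Longrightarrow> 0 \<le> C \<Longrightarrow>
      (\<And>u. pnorm r2 l (\<lambda>k. \<Sum>j<m. A j k * u j) \<le> C * pnorm r1 m u) \<Longrightarrow>
      mnorm r2 t n l (\<lambda>i k. \<Sum>j<m. A j k * X i j) \<le> K * C * mnorm r1 t n m X"
  shows "bilin_regular r1 (conj_exp r2) t"
  unfolding bilin_regular_def
proof (intro exI[of _ K] conjI allI impI)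
  fix n m l :: nat and A :: "nat \<Rightarrow> nat \<Rightarrow> real" and C :: real
  assume *: "1 \<le> n" "1 \<le> m" "1 \<le> l" "0 \<le> C" "bilin_bound r1 (conj_exp r2) m l A C"
  show "mixed_bound r1 (conj_exp r2) t n m l A (K * C)"
    by (intro mixed_boundI assms * bilin_boundD)
qed fact

lemma bilin_regularE:
  assumes "bilin_regular r1 (conj_exp r2) t" "1 \<le> r1" "1 \<le> r2" "1 \<le> t"
  obtains K where "0 \<le> K" "\<And>n m l A C X. 1 \<le> n \<Longrightarrow> 1 \<le> m \<Longrightarrow> 1 \<le> l \<Longrightarrow> 0 \<le> C \<Longrightarrow>
      (\<And>u. pnorm r2 l (\<lambda>k. \<Sum>j<m. A j k * u j) \<le> C * pnorm r1 m u) \<Longrightarrow>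
      mnorm r2 t n l (\<lambda>i k. \<Sum>j<m. A j k * X i j) \<le> K * C * mnorm r1 t n m X"
proof -
  from assms(1) obtain K where K: "K \<ge> 0" "\<And>n m l A C. n \<ge> 1 \<Longrightarrow> m \<ge> 1 \<Longrightarrow> l \<ge> 1 \<Longrightarrow> C \<ge> 0 \<Longrightarrow>
     bilin_bound r1 (conj_exp r2) m l A C \<Longrightarrow> mixed_bound r1 (conj_exp r2) t n m l A (K * C)"
    unfolding bilin_regular_def by metis
  show ?thesis
  proof (rule that[OF K(1)])
    fix n m l :: nat and A :: "nat \<Rightarrow> nat \<Rightarrow> real" and C :: real and X
    assume *: "1 \<le> n" "1 \<le> m" "1 \<le> l" "0 \<le> C" "\<And>u. pnorm r2 l (\<lambda>k. \<Sum>j<m. A j k * u j) \<le> C * pnorm r1 m u"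
    show "mnorm r2 t n l (\<lambda>i k. \<Sum>j<m. A j k * X i j) \<le> K * C * mnorm r1 t n m X"
      using K(1) * by (intro mixed_boundD assms K(2) bilin_boundI) auto
  qed
qed

subsection \<open>Equal exponents\<close>

text \<open>For t = r the mixed norm can be computed in either order, so the bound for A applies to
  each vector separately and no constant is lost.\<close>

lemma bilin_regular_diagonal:
  assumes "1 \<le> r"
  shows "bilin_regular r (conj_exp r) r"
proof (rule bilin_regularI[of _ _ _ 1])
  fix n m l A C X
  assume *: "1 \<le> (n::nat)" "1 \<le> (m::nat)" "1 \<le> (l::nat)" "0 \<le> (C::real)"
    and bd: "\<And>u. pnorm r l (\<lambda>k. \<Sum>j<m. A j k * u j) \<le> C * pnorm r m u"
  \<comment> \<open>Fubini for finite sums. For \<infinity> one inequality suffices, applied to X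
    and to its transpose.\<close>
  have swap: "mnorm r r n m X = pnorm r n (\<lambda>i. pnorm r m (X i))" if "1 \<le> m" "1 \<le> n" for n m X
    using \<open>1 \<le> r\<close>
  proof (cases rule: exponent_cases)
    case inf
    have le: "mnorm r r n m X \<le> pnorm r n (\<lambda>i. pnorm r m (X i))" if "1 \<le> m" "1 \<le> n" for n m and X :: "nat \<Rightarrow> nat \<Rightarrow> real"
    proof -
      have ne: "{..<m} \<noteq> {}" "{..<n} \<noteq> {}" using that by (auto simp: lessThan_empty_iff)
      have "\<bar>X i j\<bar> \<le> pnorm \<infinity> n (\<lambda>i. pnorm \<infinity> m (X i))" if "i < n" "j < m" for i j
        using abs_le_pnorm[of \<infinity> j m "X i"] abs_le_pnorm[of \<infinity> i n "\<lambda>i. pnorm \<infinity> m (X i)"] that by auto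
      then have "\<bar>pnorm \<infinity> n (\<lambda>i. X i j)\<bar> \<le> pnorm \<infinity> n (\<lambda>i. pnorm \<infinity> m (X i))" if "j < m" for j
        using that ne pnorm_nonneg[of \<infinity> n "\<lambda>i. X i j"] \<open>1 \<le> n\<close> unfolding pnorm_PInf[of n "\<lambda>i. X i j"]
        by (subst abs_of_nonneg) (auto simp: Max_le_iff pnorm_PInf)
      then show ?thesis unfolding inf mnorm_def using ne
        by (subst pnorm_PInf[of m]) (auto simp: Max_le_iff)
    qed
    show ?thesis using le[OF that, of X] le[OF that(2,1), of "\<lambda>i j. X j i"] by (simp add: mnorm_def)
  next
    case (fin s)
    have "(\<Sum>j<m. \<bar>pnorm r n (\<lambda>i. X i j)\<bar> powr s) = (\<Sum>i<n. \<bar>pnorm r m (X i)\<bar> powr s)"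
      using that pnorm_ereal_powr[of s] fin pnorm_nonneg[OF assms(1)] by (simp add: sum.swap[of _ "{..<n}"])
    then show ?thesis by (simp add: fin mnorm_def pnorm_ereal)
  qed
  have "mnorm r r n l (\<lambda>i k. \<Sum>j<m. A j k * X i j) = pnorm r n (\<lambda>i. pnorm r l (\<lambda>k. \<Sum>j<m. A j k * X i j))"
    by (rule swap[OF *(3,1)])
  also have "\<dots> \<le> pnorm r n (\<lambda>i. C * pnorm r m (X i))"
    using bd pnorm_nonneg[OF assms] * by (intro pnorm_mono assms) (simp_all add: abs_mult)
  also have "\<dots> = 1 * C * mnorm r r n m X" using * by (simp add: pnorm_scale assms swap)
  finally show "mnorm r r n l (\<lambda>i k. \<Sum>j<m. A j k * X i j) \<le> 1 * C * mnorm r r n m X" .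
qed (use assms in auto)

text \<open>An operator on \<open>L\<^sub>1\<close> has a modulus with the same norm: only the columns matter.\<close>

lemma bilin_regular_one:
  assumes "1 \<le> t"
  shows "bilin_regular 1 \<infinity> t"
proof -
  have "bilin_regular 1 (conj_exp 1) t"
  proof (rule bilin_regularI[of _ _ _ 1])
    fix n m l A C X
    assume *: "1 \<le> (n::nat)" "1 \<le> (m::nat)" "1 \<le> (l::nat)" "0 \<le> (C::real)"
      and bd: "\<And>u. pnorm 1 l (\<lambda>k. \<Sum>j<m. A j k * u j) \<le> C * pnorm 1 m u"
    \<comment> \<open>Testing the bound on the j-th unit vector shows that its image has l_1 norm at
      most C.\<close>
    have col: "(\<Sum>k<l. \<bar>A j k\<bar>) \<le> C" if "j < m" for j
    proof -
      have "(\<Sum>i<m. A i k * (if i = j then 1 else 0)) = A j k" for k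
        using that by (simp add: if_distrib[of "\<lambda>x. _ * x"] cong: if_cong)
      then show ?thesis using bd[of "\<lambda>i. if i = j then 1 else 0"] pnorm_unit[of 1 j m 1] that
        by (simp add: pnorm_one)
    qed
    have nn: "0 \<le> pnorm t n f" for f using assms * by (intro pnorm_nonneg)
    have "mnorm 1 t n l (\<lambda>i k. \<Sum>j<m. A j k * X i j) = (\<Sum>k<l. pnorm t n (\<lambda>i. \<Sum>j<m. A j k * X i j))"
      using nn by (simp add: mnorm_def pnorm_one)
    also have "\<dots> \<le> (\<Sum>k<l. \<Sum>j<m. pnorm t n (\<lambda>i. A j k * X i j))"
      using assms * by (intro sum_mono pnorm_sum) auto
    also have "\<dots> = (\<Sum>j<m. (\<Sum>k<l. \<bar>A j k\<bar>) * pnorm t n (\<lambda>i. X i j))"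
      using assms * by (subst sum.swap) (simp add: pnorm_scale sum_distrib_right)
    also have "\<dots> \<le> (\<Sum>j<m. C * pnorm t n (\<lambda>i. X i j))"
      using col nn by (intro sum_mono mult_right_mono) auto
    also have "\<dots> = 1 * C * mnorm 1 t n m X" using nn by (simp add: mnorm_def pnorm_one sum_distrib_left)
    finally show "mnorm 1 t n l (\<lambda>i k. \<Sum>j<m. A j k * X i j) \<le> 1 * C * mnorm 1 t n m X" .
  qed (use assms in auto)
  then show ?thesis by simp
qed

lemma bilin_regular_PInf:
  assumes "1 \<le> t"
  shows "bilin_regular \<infinity> 1 t"
  using bilin_regular_transpose[OF bilin_regular_one[OF one_le_conj_exp[OF assms]] one_le_conj_exp[OF assms]]
  by (simp add: conj_exp_conj_exp assms)

section \<open>Grothendieck's inequality\<close>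

text \<open>A sequence of n signs is encoded by the set A of positions with sign +, so an
  expectation is a sum over \<open>Pow {..<n}\<close> divided by 2^n.\<close>

definition rademacher_sum :: "nat \<Rightarrow> nat set \<Rightarrow> (nat \<Rightarrow> real) \<Rightarrow> real" where
  "rademacher_sum n A x = (\<Sum>i<n. (if i \<in> A then x i else - x i))"

text \<open>Conditioning on the last sign: each choice for the first n positions has two
  continuations.\<close>

lemma sum_Pow_lessThan_Suc:
  "(\<Sum>A\<in>Pow {..<Suc n}. f A) = (\<Sum>A\<in>Pow {..<n}. f A + f (insert n A))"
proof -
  have "inj_on (insert n) (Pow {..<n})" by (auto simp: inj_on_def)
  then show ?thesis
    by (simp add: lessThan_Suc Pow_insert sum.distrib)
      (subst sum.union_disjoint, auto simp: sum.reindex)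
qed

lemma rademacher_sum_Suc:
  assumes "A \<subseteq> {..<n}"
  shows "rademacher_sum (Suc n) A x = rademacher_sum n A x - x n"
    "rademacher_sum (Suc n) (insert n A) x = rademacher_sum n A x + x n"
proof -
  have "n \<notin> A" using assms by auto
  then show "rademacher_sum (Suc n) A x = rademacher_sum n A x - x n" by (simp add: rademacher_sum_def)
  show "rademacher_sum (Suc n) (insert n A) x = rademacher_sum n A x + x n"
    by (auto simp: rademacher_sum_def intro!: sum.cong)
qed

lemma rademacher_sum_orthogonal:
  "(\<Sum>A\<in>Pow {..<n}. rademacher_sum n A x * rademacher_sum n A y) = 2 ^ n * (\<Sum>i<n. x i * y i)"
proof (induction n)
  case (Suc n)
  have "(\<Sum>A\<in>Pow {..<Suc n}. rademacher_sum (Suc n) A x * rademacher_sum (Suc n) A y) =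
      (\<Sum>A\<in>Pow {..<n}. 2 * (rademacher_sum n A x * rademacher_sum n A y) + 2 * (x n * y n))"
    unfolding sum_Pow_lessThan_Suc
    by (intro sum.cong) (auto simp: rademacher_sum_Suc algebra_simps)
  also have "\<dots> = 2 * (\<Sum>A\<in>Pow {..<n}. rademacher_sum n A x * rademacher_sum n A y) + 2 ^ n * (2 * (x n * y n))"
    by (simp add: sum.distrib sum_distrib_left card_Pow)
  finally show ?case unfolding Suc by (simp add: algebra_simps)
qed (simp add: rademacher_sum_def)

text \<open>Averaging over the last sign removes the odd powers in (R + c)^4. The mixed term
  contributes 6 c^2 S, exactly the cross term of 3 (S + c^2)^2; this fixes the constant 3, the
  fourth moment of a Gaussian.\<close>

lemma rademacher_sum_fourth_moment:
  "(\<Sum>A\<in>Pow {..<n}. rademacher_sum n A x ^ 4) \<le> 3 * 2 ^ n * (\<Sum>i<n. (x i)\<^sup>2)\<^sup>2"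
proof (induction n)
  case (Suc n)
  let ?S = "\<Sum>i<n. (x i)\<^sup>2"
  have id: "(R - c) ^ 4 + (R + c) ^ 4 = 2 * R ^ 4 + 12 * c\<^sup>2 * (R * R) + 2 * c ^ 4" for R c :: real by algebra
  have "(\<Sum>A\<in>Pow {..<Suc n}. rademacher_sum (Suc n) A x ^ 4) =
      (\<Sum>A\<in>Pow {..<n}. 2 * rademacher_sum n A x ^ 4 + 12 * (x n)\<^sup>2 * (rademacher_sum n A x * rademacher_sum n A x)
        + 2 * x n ^ 4)"
    unfolding sum_Pow_lessThan_Suc by (intro sum.cong) (auto simp: rademacher_sum_Suc id)
  also have "\<dots> = 2 * (\<Sum>A\<in>Pow {..<n}. rademacher_sum n A x ^ 4)
      + 12 * (x n)\<^sup>2 * (\<Sum>A\<in>Pow {..<n}. rademacher_sum n A x * rademacher_sum n A x) + 2 ^ n * (2 * x n ^ 4)"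
    by (simp add: sum.distrib sum_distrib_left card_Pow)
  also have "\<dots> = 2 * (\<Sum>A\<in>Pow {..<n}. rademacher_sum n A x ^ 4)
      + 12 * (x n)\<^sup>2 * (2 ^ n * ?S) + 2 ^ n * (2 * x n ^ 4)"
    unfolding rademacher_sum_orthogonal by (simp add: power2_eq_square)
  also have "\<dots> \<le> 2 * (3 * 2 ^ n * ?S\<^sup>2) + 12 * (x n)\<^sup>2 * (2 ^ n * ?S) + 2 ^ n * (2 * x n ^ 4)"
    using Suc by simp
  also have "\<dots> = 2 ^ Suc n * (3 * ?S\<^sup>2 + 6 * (x n)\<^sup>2 * ?S + x n ^ 4)" by (simp add: algebra_simps)
  also have "\<dots> \<le> 2 ^ Suc n * (3 * (?S + (x n)\<^sup>2)\<^sup>2)"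
  proof (intro mult_left_mono)
    have "3 * (?S + (x n)\<^sup>2)\<^sup>2 = 3 * ?S\<^sup>2 + 6 * (x n)\<^sup>2 * ?S + 3 * x n ^ 4" by algebra
    moreover have "0 \<le> x n ^ 4" by simp
    ultimately show "3 * ?S\<^sup>2 + 6 * (x n)\<^sup>2 * ?S + x n ^ 4 \<le> 3 * (?S + (x n)\<^sup>2)\<^sup>2" by linarith
  qed simp
  finally show ?case by (simp add: algebra_simps)
qed (simp add: rademacher_sum_def)

definition matrix_form ::
  "nat \<Rightarrow> nat \<Rightarrow> nat \<Rightarrow> (nat \<Rightarrow> nat \<Rightarrow> real) \<Rightarrow> (nat \<Rightarrow> nat \<Rightarrow> real) \<Rightarrow> (nat \<Rightarrow> nat \<Rightarrow> real) \<Rightarrow> real" where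
  "matrix_form n m l A X Y = (\<Sum>i<n. \<Sum>j<m. \<Sum>k<l. A j k * X i j * Y i k)"

lemma matrix_form_add_left:
  "matrix_form n m l A (\<lambda>i j. X i j + X' i j) Y = matrix_form n m l A X Y + matrix_form n m l A X' Y"
  by (simp add: matrix_form_def algebra_simps sum.distrib)

lemma matrix_form_add_right:
  "matrix_form n m l A X (\<lambda>i j. Y i j + Y' i j) = matrix_form n m l A X Y + matrix_form n m l A X Y'"
  by (simp add: matrix_form_def algebra_simps sum.distrib)

text \<open>The form sees only inner products of columns of X with columns of Y. Other vectors with
  proportional inner products may therefore replace the given ones.\<close>

lemma matrix_form_eq_sum_inner:
  "matrix_form n m l A X Y = (\<Sum>j<m. \<Sum>k<l. A j k * (\<Sum>i<n. X i j * Y i k))"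
proof -
  have "matrix_form n m l A X Y = (\<Sum>j<m. \<Sum>i<n. \<Sum>k<l. A j k * X i j * Y i k)"
    unfolding matrix_form_def by (rule sum.swap)
  also have "\<dots> = (\<Sum>j<m. \<Sum>k<l. \<Sum>i<n. A j k * X i j * Y i k)"
    by (rule sum.cong[OF refl], rule sum.swap)
  finally show ?thesis by (simp add: sum_distrib_left mult.assoc)
qed

text \<open>With unit vectors replaced by Rademacher sums, which have bounded fourth moments, the
  truncation at height 2 is a bounded sequence of scalars, and the remainders have small norm in
  \<open>L\<^sub>2\<close>; hence the best constant \<open>S\<close> over all dimensions satisfies \<open>S \<le> 4 C + S / 2\<close>.\<close>

theorem Grothendieck_inequality:
  assumes bd: "\<And>u v. (\<And>j. j < m \<Longrightarrow> \<bar>u j\<bar> \<le> 1) \<Longrightarrow> (\<And>k. k < l \<Longrightarrow> \<bar>v k\<bar> \<le> 1) \<Longrightarrow>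
      (\<Sum>j<m. \<Sum>k<l. A j k * u j * v k) \<le> (C::real)"
    and X: "\<And>j. j < m \<Longrightarrow> (\<Sum>i<n. (X i j)\<^sup>2) \<le> 1" and Y: "\<And>k. k < l \<Longrightarrow> (\<Sum>i<n. (Y i k)\<^sup>2) \<le> 1"
  shows "matrix_form n m l A X Y \<le> 8 * C"
proof -
  \<comment> \<open>The dimension n is not fixed in V, because the truncated Rademacher sums live in
    dimension 2^n.\<close>
  define V where "V = {matrix_form n m l A X Y | n X Y.
     (\<forall>j<m. (\<Sum>i<n. (X i j)\<^sup>2) \<le> 1) \<and> (\<forall>k<l. (\<Sum>i<n. (Y i k)\<^sup>2) \<le> 1)}"
  define S where "S = Sup V"
  have C: "0 \<le> C" using bd[of "\<lambda>_. 0" "\<lambda>_. 0"] by simp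
  \<comment> \<open>By Cauchy-Schwarz the sum of all |A j k| is a bound. A finite S is what allows S
    / 2 to be absorbed at the end.\<close>
  have bdd: "bdd_above V"
  proof (rule bdd_aboveI)
    fix z assume "z \<in> V"
    then obtain n X Y where z: "z = matrix_form n m l A X Y" "\<And>j. j < m \<Longrightarrow> (\<Sum>i<n. (X i j)\<^sup>2) \<le> 1"
      "\<And>k. k < l \<Longrightarrow> (\<Sum>i<n. (Y i k)\<^sup>2) \<le> 1" by (auto simp: V_def)
    have "A j k * (\<Sum>i<n. X i j * Y i k) \<le> \<bar>A j k\<bar>" if "j < m" "k < l" for j k
    proof -
      have "(\<Sum>i<n. X i j * Y i k)\<^sup>2 \<le> (\<Sum>i<n. (X i j)\<^sup>2) * (\<Sum>i<n. (Y i k)\<^sup>2)"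
        by (rule Cauchy_Schwarz_ineq_sum)
      also have "\<dots> \<le> 1" using z that by (intro mult_le_one sum_nonneg) auto
      finally have "\<bar>\<Sum>i<n. X i j * Y i k\<bar> \<le> 1" by (simp add: abs_square_le_1)
      then have "\<bar>A j k\<bar> * \<bar>\<Sum>i<n. X i j * Y i k\<bar> \<le> \<bar>A j k\<bar>" by (simp add: mult_left_le)
      then show ?thesis by (simp flip: abs_mult)
    qed
    then show "z \<le> (\<Sum>j<m. \<Sum>k<l. \<bar>A j k\<bar>)"
      unfolding z matrix_form_eq_sum_inner by (intro sum_mono) auto
  qed
  have VI: "matrix_form n m l A X Y \<in> V"
    if "\<And>j. j < m \<Longrightarrow> (\<Sum>i<n. (X i j)\<^sup>2) \<le> 1" "\<And>k. k < l \<Longrightarrow> (\<Sum>i<n. (Y i k)\<^sup>2) \<le> 1" for n X Y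
    using that unfolding V_def by blast
  \<comment> \<open>Homogeneity: vectors of length at most a and b give at most a b S. The
    remainders of the truncation enter through this.\<close>
  have le_S: "matrix_form n m l A X Y \<le> a * b * S"
    if "\<And>j. j < m \<Longrightarrow> (\<Sum>i<n. (X i j)\<^sup>2) \<le> a\<^sup>2" "\<And>k. k < l \<Longrightarrow> (\<Sum>i<n. (Y i k)\<^sup>2) \<le> b\<^sup>2" "0 < a" "0 < b"
    for n X Y and a b :: real
  proof -
    have "matrix_form n m l A (\<lambda>i j. X i j / a) (\<lambda>i k. Y i k / b) \<in> V"
      using that by (intro VI) (auto simp: power_divide simp flip: sum_divide_distrib)
    then have "matrix_form n m l A (\<lambda>i j. X i j / a) (\<lambda>i k. Y i k / b) \<le> S"
      unfolding S_def using bdd by (rule cSup_upper)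
    also have "matrix_form n m l A (\<lambda>i j. X i j / a) (\<lambda>i k. Y i k / b) = matrix_form n m l A X Y / (a * b)"
      by (simp add: matrix_form_def sum_divide_distrib)
    finally show ?thesis using that by (simp add: pos_divide_le_eq mult.commute)
  qed
  have main: "matrix_form n m l A X Y \<le> 4 * C + S / 2"
    if XY: "\<And>j. j < m \<Longrightarrow> (\<Sum>i<n. (X i j)\<^sup>2) \<le> 1" "\<And>k. k < l \<Longrightarrow> (\<Sum>i<n. (Y i k)\<^sup>2) \<le> 1"
    for n X Y
  proof -
    \<comment> \<open>Numbering the sign patterns turns Rademacher sums into vectors with 2^n
      coordinates.\<close>
    obtain h where h: "bij_betw h {..<2 ^ n :: nat} (Pow {..<n})"
      using ex_bij_betw_nat_finite[of "Pow {..<n}"] by (auto simp: card_Pow atLeast0LessThan)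
    have reindex: "(\<Sum>p<2 ^ n. f (h p)) = (\<Sum>A\<in>Pow {..<n}. f A)" for f :: "nat set \<Rightarrow> real"
      by (rule sum.reindex_bij_betw[OF h])
    define R where "R Z p j = rademacher_sum n (h p) (\<lambda>i. Z i j)" for Z :: "nat \<Rightarrow> nat \<Rightarrow> real" and p j
    define lo where "lo x = max (- 2) (min 2 x)" for x :: real
    define hi where "hi x = x - lo x" for x :: real
    have lo: "\<bar>lo x\<bar> \<le> 2" "(lo x)\<^sup>2 \<le> x\<^sup>2" for x
      by (auto simp: lo_def min_def max_def abs_le_square_iff[symmetric])
    \<comment> \<open>From (|x| - 4)^2 \<ge> 0 follows |x| - 2 \<le> x^2 / 8, which bounds the
      remainder of the truncation. By the fourth moment its mean square is at most 3 / 64 \<le> 1 /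
      16, so relative to sqrt (2^n) its norm is at most 1 / 4.\<close>
    have hi: "(hi x)\<^sup>2 \<le> x ^ 4 / 64" for x
    proof -
      have "0 \<le> (x - 4)\<^sup>2" "0 \<le> (x + 4)\<^sup>2" by simp_all
      then have "\<bar>hi x\<bar> \<le> \<bar>x\<^sup>2 / 8\<bar>"
        by (auto simp: hi_def lo_def min_def max_def power2_eq_square algebra_simps)
      then have "(hi x)\<^sup>2 \<le> (x\<^sup>2 / 8)\<^sup>2" by (simp only: abs_le_square_iff)
      then show ?thesis by (simp add: power_divide flip: power_mult)
    qed
    have inner: "(\<Sum>p<2 ^ n. R X p j * R Y p k) = 2 ^ n * (\<Sum>i<n. X i j * Y i k)" for X Y j k
      unfolding R_def by (subst reindex) (rule rademacher_sum_orthogonal)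
    have sq: "(\<Sum>p<2 ^ n. (R Z p j)\<^sup>2) \<le> (sqrt (2 ^ n))\<^sup>2"
      and lo_sq: "(\<Sum>p<2 ^ n. (lo (R Z p j))\<^sup>2) \<le> (sqrt (2 ^ n))\<^sup>2"
      and hi_sq: "(\<Sum>p<2 ^ n. (hi (R Z p j))\<^sup>2) \<le> (sqrt (2 ^ n) / 4)\<^sup>2"
      if Z: "(\<Sum>i<n. (Z i j)\<^sup>2) \<le> 1" for Z j
    proof -
      show 1: "(\<Sum>p<2 ^ n. (R Z p j)\<^sup>2) \<le> (sqrt (2 ^ n))\<^sup>2"
        using inner[of Z j Z j] Z by (simp add: power2_eq_square)
      have "(\<Sum>p<2 ^ n. (lo (R Z p j))\<^sup>2) \<le> (\<Sum>p<2 ^ n. (R Z p j)\<^sup>2)" by (intro sum_mono lo)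
      with 1 show "(\<Sum>p<2 ^ n. (lo (R Z p j))\<^sup>2) \<le> (sqrt (2 ^ n))\<^sup>2" by linarith
      have "(\<Sum>p<2 ^ n. (hi (R Z p j))\<^sup>2) \<le> (\<Sum>p<2 ^ n. R Z p j ^ 4 / 64)" by (intro sum_mono hi)
      also have "\<dots> = (\<Sum>A\<in>Pow {..<n}. rademacher_sum n A (\<lambda>i. Z i j) ^ 4) / 64"
        unfolding R_def by (subst reindex) (simp add: sum_divide_distrib)
      also have "\<dots> \<le> 3 * 2 ^ n * (\<Sum>i<n. (Z i j)\<^sup>2)\<^sup>2 / 64"
        by (intro divide_right_mono rademacher_sum_fourth_moment) auto
      also have "\<dots> \<le> 3 * 2 ^ n * 1 / 64"
        using Z by (intro divide_right_mono mult_left_mono power_le_one sum_nonneg) auto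
      also have "\<dots> \<le> (sqrt (2 ^ n) / 4)\<^sup>2" by (simp add: power_divide)
      finally show "(\<Sum>p<2 ^ n. (hi (R Z p j))\<^sup>2) \<le> (sqrt (2 ^ n) / 4)\<^sup>2" .
    qed
    let ?F = "matrix_form (2 ^ n) m l A"
    let ?xl = "\<lambda>p j. lo (R X p j)" and ?xh = "\<lambda>p j. hi (R X p j)"
    let ?yl = "\<lambda>p j. lo (R Y p j)" and ?yh = "\<lambda>p j. hi (R Y p j)"
    have "2 ^ n * matrix_form n m l A X Y = ?F (R X) (R Y)"
      by (simp add: matrix_form_eq_sum_inner inner sum_distrib_left mult_ac)
    \<comment> \<open>The remainder of X is paired with the whole of Y, so there are only two error
      terms; relative to 2^n each is at most S / 4.\<close>
    also have "\<dots> = ?F ?xl ?yl + ?F ?xl ?yh + ?F ?xh (R Y)"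
      by (subst matrix_form_add_right[symmetric], simp add: hi_def)
        (subst matrix_form_add_left[symmetric], simp)
    \<comment> \<open>For a fixed sign pattern these are scalars bounded by 2; halving both costs
      the factor 4.\<close>
    also have "?F ?xl ?yl \<le> (\<Sum>p<2 ^ n::nat. 4 * C)"
      unfolding matrix_form_def
    proof (intro sum_mono)
      fix p
      have "(\<Sum>j<m. \<Sum>k<l. A j k * ?xl p j * ?yl p k) = 4 * (\<Sum>j<m. \<Sum>k<l. A j k * (?xl p j / 2) * (?yl p k / 2))"
        by (simp add: sum_distrib_left)
      also have "\<dots> \<le> 4 * C" using lo(1) by (intro mult_left_mono bd) auto
      finally show "(\<Sum>j<m. \<Sum>k<l. A j k * ?xl p j * ?yl p k) \<le> 4 * C" .
    qed
    also have "?F ?xl ?yh \<le> sqrt (2 ^ n) * (sqrt (2 ^ n) / 4) * S"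
      by (rule le_S, (intro lo_sq XY; assumption), (intro hi_sq XY; assumption)) auto
    also have "?F ?xh (R Y) \<le> sqrt (2 ^ n) / 4 * sqrt (2 ^ n) * S"
      by (rule le_S, (intro hi_sq XY; assumption), (intro sq XY; assumption)) auto
    finally have "2 ^ n * matrix_form n m l A X Y \<le> 2 ^ n * (4 * C + S / 2)" by (simp add: algebra_simps)
    then show ?thesis by simp
  qed
  \<comment> \<open>V must be nonempty for its supremum to be a least upper bound; dimension 0
    provides an element.\<close>
  have "0 \<in> V" unfolding V_def
    by (auto simp: matrix_form_def intro!: exI[of _ "\<lambda>_ _. 0"] exI[of _ "0::nat"])
  then have "S \<le> 4 * C + S / 2"
    unfolding S_def[symmetric] by (subst (1) S_def, intro cSup_least) (auto simp: V_def intro!: main)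
  moreover have "matrix_form n m l A X Y \<le> 4 * C + S / 2" using X Y by (rule main)
  ultimately show ?thesis by simp
qed

text \<open>Multiplication by \<open>w\<close> maps \<open>\<ell>\<^sub>\<infinity>\<close> to \<open>\<ell>\<^sub>r\<close> with norm \<open>\<parallel>w\<parallel>\<^sub>r\<close>; this reduces
  arbitrary exponents to the pair \<open>(\<infinity>, 1)\<close> of Grothendieck's inequality.\<close>

lemma bilin_regular_two:
  assumes "1 \<le> r" "1 \<le> s"
  shows "bilin_regular r s 2"
  unfolding bilin_regular_def
proof (intro exI[of _ 8] conjI allI impI)
  fix n m l :: nat and A :: "nat \<Rightarrow> nat \<Rightarrow> real" and C :: real
  assume *: "1 \<le> n" "1 \<le> m" "1 \<le> l" "0 \<le> C" and bd: "bilin_bound r s m l A C"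
  show "mixed_bound r s 2 n m l A (8 * C)"
    unfolding mixed_bound_def conj_exp_simps
  proof (intro allI)
    fix X Y
    define w where "w j = pnorm 2 n (\<lambda>i. X i j)" for j :: nat
    define z where "z k = pnorm 2 n (\<lambda>i. Y i k)" for k :: nat
    have nn: "0 \<le> w j" "0 \<le> z j" for j unfolding w_def z_def using * by (auto intro!: pnorm_nonneg)
    have sq: "(w j)\<^sup>2 = (\<Sum>i<n. (X i j)\<^sup>2)" "(z j)\<^sup>2 = (\<Sum>i<n. (Y i j)\<^sup>2)" for j
      unfolding w_def z_def pnorm_two by (simp_all add: sum_nonneg)
    \<comment> \<open>If \<open>w j = 0\<close> then the whole column of X vanishes, so division by
      zero, which yields 0, does no harm.\<close>
    have wX: "w j * (X i j / w j) = X i j" if "i < n" for i j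
      using abs_le_pnorm[of 2 i n "\<lambda>i. X i j", folded w_def] that by auto
    have zY: "z j * (Y i j / z j) = Y i j" if "i < n" for i j
      using abs_le_pnorm[of 2 i n "\<lambda>i. Y i j", folded z_def] that by auto
    have "(\<Sum>i<n. \<Sum>j<m. \<Sum>k<l. A j k * X i j * Y i k)
        = matrix_form n m l (\<lambda>j k. A j k * w j * z k) (\<lambda>i j. X i j / w j) (\<lambda>i k. Y i k / z k)"
      unfolding matrix_form_def
    proof (intro sum.cong refl)
      fix i j k assume "i \<in> {..<n}"
      then have "A j k * X i j * Y i k = A j k * (w j * (X i j / w j)) * (z k * (Y i k / z k))"
        by (simp only: wX zY lessThan_iff)
      then show "A j k * X i j * Y i k = A j k * w j * z k * (X i j / w j) * (Y i k / z k)"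
        by (simp only: mult_ac)
    qed
    also have "\<dots> \<le> 8 * (C * pnorm r m w * pnorm s l z)"
    proof (rule Grothendieck_inequality)
      fix u v :: "nat \<Rightarrow> real"
      assume uv: "\<And>j. j < m \<Longrightarrow> \<bar>u j\<bar> \<le> 1" "\<And>k. k < l \<Longrightarrow> \<bar>v k\<bar> \<le> 1"
      have "(\<Sum>j<m. \<Sum>k<l. A j k * w j * z k * u j * v k) = (\<Sum>j<m. \<Sum>k<l. A j k * (w j * u j) * (z k * v k))"
        by (simp add: mult_ac)
      also have "\<dots> \<le> C * pnorm r m (\<lambda>j. w j * u j) * pnorm s l (\<lambda>k. z k * v k)"
        using bd by (simp add: bilin_bound_def)
      also have "\<dots> \<le> C * pnorm r m w * pnorm s l z"
        using uv assms * by (intro mult_mono mult_left_mono pnorm_mono mult_nonneg_nonneg pnorm_nonneg)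
          (auto simp: abs_mult mult_left_le)
      finally show "(\<Sum>j<m. \<Sum>k<l. A j k * w j * z k * u j * v k) \<le> C * pnorm r m w * pnorm s l z" .
    next
      fix j
      have "(\<Sum>i<n. (X i j / w j)\<^sup>2) = (\<Sum>i<n. (X i j)\<^sup>2) / (w j)\<^sup>2"
        by (simp add: power_divide sum_divide_distrib)
      \<comment> \<open>The quotient is 1, or 0 when \<open>w j\<close> vanishes.\<close>
      also have "\<dots> \<le> 1" by (simp add: sq)
      finally show "(\<Sum>i<n. (X i j / w j)\<^sup>2) \<le> 1" .
    next
      fix j
      have "(\<Sum>i<n. (Y i j / z j)\<^sup>2) = (\<Sum>i<n. (Y i j)\<^sup>2) / (z j)\<^sup>2"
        by (simp add: power_divide sum_divide_distrib)
      also have "\<dots> \<le> 1" by (simp add: sq)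
      finally show "(\<Sum>i<n. (Y i j / z j)\<^sup>2) \<le> 1" .
    qed
    finally show "(\<Sum>i<n. \<Sum>j<m. \<Sum>k<l. A j k * X i j * Y i k) \<le> 8 * C * mnorm r 2 n m X * mnorm s 2 n l Y"
      by (simp add: mnorm_def w_def[abs_def] z_def[abs_def] mult_ac)
  qed
qed simp

section \<open>Positive random variables with a regularly varying tail\<close>

text \<open>Subadditivity of a concave power, read off from the comparison of the sequence norms
  with exponents 1 and 1 / \<rho>.\<close>

lemma powr_sum_le_sum_powr:
  fixes x :: "nat \<Rightarrow> real"
  assumes "0 < \<rho>" "\<rho> \<le> 1" "1 \<le> n" "\<And>i. i < n \<Longrightarrow> 0 \<le> x i"
  shows "(\<Sum>i<n. x i) powr \<rho> \<le> (\<Sum>i<n. x i powr \<rho>)"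
proof -
  have "pnorm (ereal (1 / \<rho>)) n (\<lambda>i. x i powr \<rho>) \<le> pnorm 1 n (\<lambda>i. x i powr \<rho>)"
    using assms by (intro pnorm_antimono_exponent) auto
  moreover have "(\<Sum>i<n. \<bar>x i powr \<rho>\<bar> powr (1 / \<rho>)) = (\<Sum>i<n. x i)"
    using assms by (intro sum.cong) (auto simp: powr_powr)
  ultimately show ?thesis by (simp add: pnorm_ereal pnorm_one)
qed

text \<open>Designed for variables \<open>y i\<close> with tail exponent between \<rho> and 1, which
  have no mean: small values are kept, large ones are raised to the power \<rho>, and each term then
  has a finite mean. Using \<open>y i powr \<rho>\<close> throughout would produce sums of
  b_i^\<rho> instead of b_i^\<alpha>.\<close>

lemma powr_sum_le_truncated:
  fixes y :: "nat \<Rightarrow> real"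
  assumes "0 < \<rho>" "\<rho> \<le> 1" "\<And>i. i < n \<Longrightarrow> 0 \<le> y i"
  shows "(\<Sum>i<n. y i) powr \<rho> \<le> 1 + (\<Sum>i<n. if y i \<le> 1 then y i else y i powr \<rho>)"
proof -
  let ?s = "\<lambda>i. if y i \<le> 1 then y i else 0" and ?g = "\<lambda>i. if y i \<le> 1 then 0 else y i"
  \<comment> \<open>The small terms are lumped into one entry at index 0, so that subadditivity over
    n + 1 entries charges them only once.\<close>
  define f where "f i = (case i of 0 \<Rightarrow> \<Sum>i<n. ?s i | Suc i \<Rightarrow> ?g i)" for i
  have s: "0 \<le> (\<Sum>i<n. ?s i)" using assms by (intro sum_nonneg) auto
  have "(\<Sum>i<n. y i) = (\<Sum>i<Suc n. f i)"
    unfolding sum.lessThan_Suc_shift by (simp add: f_def flip: sum.distrib) (intro sum.cong, auto)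
  also have "\<dots> powr \<rho> \<le> (\<Sum>i<Suc n. f i powr \<rho>)"
    using assms s by (intro powr_sum_le_sum_powr) (auto simp: f_def split: nat.splits)
  also have "\<dots> = (\<Sum>i<n. ?s i) powr \<rho> + (\<Sum>i<n. ?g i powr \<rho>)"
    unfolding sum.lessThan_Suc_shift by (simp add: f_def)
  also have "(\<Sum>i<n. ?s i) powr \<rho> \<le> 1 + (\<Sum>i<n. ?s i)"
  proof (cases "(\<Sum>i<n. ?s i) \<le> 1")
    case True
    then have "(\<Sum>i<n. ?s i) powr \<rho> \<le> 1" using assms s by (intro powr_le1) auto
    then show ?thesis using s by linarith
  next
    case False
    then have "(\<Sum>i<n. ?s i) powr \<rho> \<le> (\<Sum>i<n. ?s i) powr 1" using assms by (intro powr_mono) auto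
    then show ?thesis using s by simp
  qed
  also have "1 + (\<Sum>i<n. ?s i) + (\<Sum>i<n. ?g i powr \<rho>) = 1 + (\<Sum>i<n. if y i \<le> 1 then y i else y i powr \<rho>)"
    by (simp flip: sum.distrib) (intro sum.cong, auto)
  finally show ?thesis by simp
qed

section \<open>Weighted sums of independent negative powers of uniform variables\<close>

abbreviation unit_uniform :: "real measure" where
  "unit_uniform \<equiv> restrict_space lborel {0<..<1}"

abbreviation unit_product :: "nat \<Rightarrow> (nat \<Rightarrow> real) measure" where
  "unit_product n \<equiv> Pi\<^sub>M {..<n} (\<lambda>_. unit_uniform)"

lemma space_unit_uniform: "space unit_uniform = {0<..<1}"
  by (simp add: space_restrict_space)

lemma prob_space_unit_uniform: "prob_space unit_uniform"
  by (rule prob_spaceI) (simp add: space_restrict_space emeasure_restrict_space)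

interpretation unit_product: product_prob_space "\<lambda>_. unit_uniform" "{..<n}" for n :: nat
  by (intro product_prob_space.intro product_sigma_finite.intro product_prob_space_axioms.intro
      prob_space_unit_uniform prob_space_imp_sigma_finite)

lemma measurable_unit_uniform_powr [measurable]: "(\<lambda>u. u powr c) \<in> borel_measurable unit_uniform"
  by (intro measurable_restrict_space1) simp

text \<open>Here \<open>u powr (- 1 / \<alpha>)\<close> has tail \<open>\<lambda> powr (- \<alpha>)\<close>, and the truncated moments behave like
  those of a positive \<open>\<alpha>\<close>-stable variable.\<close>

lemma nn_integral_truncated_power:
  assumes "0 < \<rho>" "\<rho> < \<alpha>" "\<alpha> < 1" "0 \<le> b"
  defines "y \<equiv> \<lambda>u. b * u powr (- 1 / \<alpha>)"
  shows "(\<integral>\<^sup>+u. ennreal (if y u \<le> 1 then y u else y u powr \<rho>) \<partial>unit_uniform)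
    \<le> ennreal ((\<alpha> / (1 - \<alpha>) + \<alpha> / (\<alpha> - \<rho>)) * b powr \<alpha>)"
proof (cases "b = 0")
  case False
  then have b: "b > 0" using assms by simp
  \<comment> \<open>The truncation threshold: for u in the unit interval, \<open>y u \<le> 1\<close>
    holds exactly when \<open>a \<le> u\<close>.\<close>
  define a where "a = b powr \<alpha>"
  have a: "a > 0" using b by (simp add: a_def)
  have ab: "a powr (1 / \<alpha>) = b" using assms b by (simp add: a_def powr_powr)
  \<comment> \<open>The integrals over [a, \<infinity>) and [0, a] in closed form. These ranges may
    leave the unit interval, which only enlarges the bound.\<close>
  define I1 where "I1 = b * (- (a powr (- 1 / \<alpha> + 1)) / (- 1 / \<alpha> + 1))"
  define I2 where "I2 = b powr \<rho> * (a powr (- \<rho> / \<alpha> + 1) / (- \<rho> / \<alpha> + 1))"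
  have "I1 = \<alpha> / (1 - \<alpha>) * b powr \<alpha>"
  proof -
    have "\<alpha> * (- 1 / \<alpha> + 1) = \<alpha> - 1" using assms by (simp add: right_diff_distrib)
    then have "b * a powr (- 1 / \<alpha> + 1) = b powr 1 * b powr (\<alpha> - 1)"
      using b by (simp only: a_def powr_powr) simp
    also have "\<dots> = b powr \<alpha>" by (simp only: powr_add[symmetric]) simp
    finally have "I1 = - (b powr \<alpha> / (- 1 / \<alpha> + 1))" by (simp add: I1_def)
    also have "- 1 / \<alpha> + 1 = - ((1 - \<alpha>) / \<alpha>)" using assms by (simp add: field_simps)
    finally show ?thesis by (simp only: minus_divide_right[symmetric] minus_minus) simp
  qed
  moreover have "I2 = \<alpha> / (\<alpha> - \<rho>) * b powr \<alpha>"
  proof -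
    have "\<alpha> * (- \<rho> / \<alpha> + 1) = \<alpha> - \<rho>" using assms by (simp add: right_diff_distrib)
    then have "b powr \<rho> * a powr (- \<rho> / \<alpha> + 1) = b powr \<rho> * b powr (\<alpha> - \<rho>)"
      by (simp only: a_def powr_powr)
    also have "\<dots> = b powr \<alpha>" by (simp flip: powr_add)
    finally have "I2 = b powr \<alpha> / (- \<rho> / \<alpha> + 1)" by (simp add: I2_def)
    also have "- \<rho> / \<alpha> + 1 = (\<alpha> - \<rho>) / \<alpha>" using assms by (simp add: field_simps)
    finally show ?thesis by simp
  qed
  ultimately have I: "I1 + I2 = (\<alpha> / (1 - \<alpha>) + \<alpha> / (\<alpha> - \<rho>)) * b powr \<alpha>" "0 \<le> I1" "0 \<le> I2"
    using assms by (auto simp: algebra_simps)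
  \<comment> \<open>Convergence: \<open>\<alpha> < 1\<close> is used at infinity and
    \<open>\<rho> < \<alpha>\<close> at 0.\<close>
  have e: "- 1 / \<alpha> < - 1" "- \<rho> / \<alpha> > - 1" using assms by (auto simp: field_simps)
  have "((\<lambda>u. b * u powr (- 1 / \<alpha>)) has_integral I1) {a..}"
    unfolding I1_def by (intro has_integral_mult_right has_integral_powr_to_inf e a)
  then have i1: "(\<integral>\<^sup>+u. ennreal (b * u powr (- 1 / \<alpha>)) * indicator {a..} u \<partial>lborel) = ennreal I1"
    by (intro nn_integral_has_integral_lebesgue') (use b in auto)
  have "((\<lambda>u. b powr \<rho> * u powr (- \<rho> / \<alpha>)) has_integral I2) {0..a}"
    unfolding I2_def using a by (intro has_integral_mult_right has_integral_powr_from_0 e) auto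
  then have i2: "(\<integral>\<^sup>+u. ennreal (b powr \<rho> * u powr (- \<rho> / \<alpha>)) * indicator {0..a} u \<partial>lborel) = ennreal I2"
    by (intro nn_integral_has_integral_lebesgue') (use b in auto)
  have "(\<integral>\<^sup>+u. ennreal (if y u \<le> 1 then y u else y u powr \<rho>) \<partial>unit_uniform)
     = (\<integral>\<^sup>+u. ennreal (if y u \<le> 1 then y u else y u powr \<rho>) * indicator {0<..<1} u \<partial>lborel)"
    by (simp add: nn_integral_restrict_space)
  also have "\<dots> \<le> (\<integral>\<^sup>+u. ennreal (b * u powr (- 1 / \<alpha>)) * indicator {a..} u
      + ennreal (b powr \<rho> * u powr (- \<rho> / \<alpha>)) * indicator {0..a} u \<partial>lborel)"
  proof (rule nn_integral_mono)
    fix u :: real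
    show "ennreal (if y u \<le> 1 then y u else y u powr \<rho>) * indicator {0<..<1} u
      \<le> ennreal (b * u powr (- 1 / \<alpha>)) * indicator {a..} u
      + ennreal (b powr \<rho> * u powr (- \<rho> / \<alpha>)) * indicator {0..a} u"
    proof (cases "u \<in> {0<..<1}")
      case True
      have y: "y u = b / u powr (1 / \<alpha>)" by (simp add: y_def powr_minus_divide)
      have iff: "y u \<le> 1 \<longleftrightarrow> a \<le> u"
      proof -
        have "y u \<le> 1 \<longleftrightarrow> a powr (1 / \<alpha>) \<le> u powr (1 / \<alpha>)" using True by (simp add: y ab divide_le_eq)
        also have "\<dots> \<longleftrightarrow> a \<le> u"
          using powr_mono2[of "1 / \<alpha>" a u] powr_less_mono2[of "1 / \<alpha>" u a] True assms a
          by (cases "a \<le> u") auto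
        finally show ?thesis .
      qed
      show ?thesis
      proof (cases "a \<le> u")
        case True
        then show ?thesis using iff by (simp add: y_def indicator_def)
      next
        case False
        have "y u powr \<rho> = b powr \<rho> * u powr (- \<rho> / \<alpha>)" using b by (simp add: y_def powr_mult powr_powr)
        then show ?thesis using False iff True by (simp add: indicator_def)
      qed
    qed simp
  qed
  also have "\<dots> = ennreal I1 + ennreal I2"
    unfolding i1[symmetric] i2[symmetric] by (rule nn_integral_add) measurable
  finally show ?thesis using I by (simp flip: ennreal_plus)
qed (simp add: y_def)

lemma measurable_unit_product_component:
  assumes "i < n" "f \<in> measurable unit_uniform L"
  shows "(\<lambda>\<omega>. f (\<omega> i)) \<in> measurable (unit_product n) L"
  by (rule measurable_compose[OF _ assms(2)], rule measurable_component_singleton) (use assms in simp)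

lemma nn_integral_unit_product_component:
  assumes "i < n" "f \<in> borel_measurable unit_uniform"
  shows "(\<integral>\<^sup>+\<omega>. f (\<omega> i) \<partial>unit_product n) = (\<integral>\<^sup>+u. f u \<partial>unit_uniform)"
proof -
  have "(\<integral>\<^sup>+u. f u \<partial>distr (unit_product n) unit_uniform (\<lambda>\<omega>. \<omega> i)) = (\<integral>\<^sup>+\<omega>. f (\<omega> i) \<partial>unit_product n)"
    using assms by (intro nn_integral_distr) auto
  then show ?thesis using unit_product.PiM_component[of i n] assms by simp
qed

text \<open>For positive \<alpha>-stable summands the sum would be distributed as a single one times
  (sum of b_i^\<alpha>)^(1/\<alpha>). Here moments of order below \<alpha> behave this way up to
  constants.\<close>

definition tail_sum :: "real \<Rightarrow> nat \<Rightarrow> (nat \<Rightarrow> real) \<Rightarrow> (nat \<Rightarrow> real) \<Rightarrow> real" where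
  "tail_sum \<alpha> n b \<omega> = (\<Sum>i<n. b i * \<omega> i powr (- 1 / \<alpha>))"

lemma tail_sum_measurable [measurable]: "tail_sum \<alpha> n b \<in> borel_measurable (unit_product n)"
proof -
  have [measurable]: "(\<lambda>\<omega>. \<omega> i powr c) \<in> borel_measurable (unit_product n)" if "i < n" for i c
    using that by (rule measurable_unit_product_component) measurable
  show ?thesis unfolding tail_sum_def[abs_def] by measurable
qed

lemma tail_sum_nonneg: "(\<And>i. i < n \<Longrightarrow> 0 \<le> b i) \<Longrightarrow> 0 \<le> tail_sum \<alpha> n b \<omega>"
  unfolding tail_sum_def by (intro sum_nonneg) auto

lemma tail_sum_scale: "tail_sum \<alpha> n (\<lambda>i. c * b i) \<omega> = c * tail_sum \<alpha> n b \<omega>"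
  by (simp add: tail_sum_def sum_distrib_left mult.assoc)

text \<open>After normalisation the truncation height 1 is the right scale: the truncated moments
  add up to a constant times the sum of the \<open>b i powr \<alpha>\<close>, which is 1. This is
  linearity of the integral; independence enters in the lower bound.\<close>

lemma tail_sum_upper_normalized:
  assumes "0 < \<rho>" "\<rho> < \<alpha>" "\<alpha> < 1" "\<And>i. i < n \<Longrightarrow> 0 \<le> b i" "(\<Sum>i<n. b i powr \<alpha>) = 1"
  defines "C \<equiv> 1 + (\<alpha> / (1 - \<alpha>) + \<alpha> / (\<alpha> - \<rho>))"
  shows "integrable (unit_product n) (\<lambda>\<omega>. tail_sum \<alpha> n b \<omega> powr \<rho>)"
    "(\<integral>\<omega>. tail_sum \<alpha> n b \<omega> powr \<rho> \<partial>unit_product n) \<le> C"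
proof -
  let ?K = "\<alpha> / (1 - \<alpha>) + \<alpha> / (\<alpha> - \<rho>)"
  let ?y = "\<lambda>i u. b i * u powr (- 1 / \<alpha>)"
  let ?t = "\<lambda>i u. if ?y i u \<le> 1 then ?y i u else ?y i u powr \<rho>"
  have K: "0 \<le> ?K" using assms by simp
  have tm: "(\<lambda>u. ennreal (?t i u)) \<in> borel_measurable unit_uniform" for i by measurable
  have tm': "(\<lambda>\<omega>. ennreal (?t i (\<omega> i))) \<in> borel_measurable (unit_product n)" if "i < n" for i
    using that tm by (rule measurable_unit_product_component)
  have "(\<integral>\<^sup>+\<omega>. ennreal (tail_sum \<alpha> n b \<omega> powr \<rho>) \<partial>unit_product n)
     \<le> (\<integral>\<^sup>+\<omega>. 1 + (\<Sum>i<n. ennreal (?t i (\<omega> i))) \<partial>unit_product n)"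
  proof (rule nn_integral_mono)
    fix \<omega>
    have "tail_sum \<alpha> n b \<omega> powr \<rho> \<le> 1 + (\<Sum>i<n. ?t i (\<omega> i))"
      unfolding tail_sum_def using assms by (intro powr_sum_le_truncated) auto
    then have "ennreal (tail_sum \<alpha> n b \<omega> powr \<rho>) \<le> ennreal (1 + (\<Sum>i<n. ?t i (\<omega> i)))" by (rule ennreal_leI)
    also have "\<dots> = 1 + (\<Sum>i<n. ennreal (?t i (\<omega> i)))"
      using assms by (subst sum_ennreal) (auto intro!: ennreal_plus[THEN trans] sum_nonneg)
    finally show "ennreal (tail_sum \<alpha> n b \<omega> powr \<rho>) \<le> 1 + (\<Sum>i<n. ennreal (?t i (\<omega> i)))" .
  qed
  also have "\<dots> = 1 + (\<Sum>i<n. (\<integral>\<^sup>+\<omega>. ennreal (?t i (\<omega> i)) \<partial>unit_product n))"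
    using tm' by (subst nn_integral_add) (auto simp: nn_integral_sum unit_product.emeasure_space_1)
  also have "\<dots> = 1 + (\<Sum>i<n. (\<integral>\<^sup>+u. ennreal (?t i u) \<partial>unit_uniform))"
    by (intro arg_cong2[of _ _ _ _ "(+)"] refl sum.cong)
      (rule nn_integral_unit_product_component[OF _ tm], simp)
  also have "\<dots> \<le> 1 + (\<Sum>i<n. ennreal (?K * b i powr \<alpha>))"
    using assms by (intro add_left_mono sum_mono nn_integral_truncated_power) auto
  also have "\<dots> = ennreal C"
    using K assms by (subst sum_ennreal) (simp_all add: C_def ennreal_plus flip: sum_distrib_left)
  finally have le: "(\<integral>\<^sup>+\<omega>. ennreal (tail_sum \<alpha> n b \<omega> powr \<rho>) \<partial>unit_product n) \<le> ennreal C" .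
  show int: "integrable (unit_product n) (\<lambda>\<omega>. tail_sum \<alpha> n b \<omega> powr \<rho>)"
    by (rule integrableI_bounded) (use le in \<open>auto intro: le_less_trans\<close>)
  have "ennreal (\<integral>\<omega>. tail_sum \<alpha> n b \<omega> powr \<rho> \<partial>unit_product n) \<le> ennreal C"
    using le by (subst nn_integral_eq_integral[OF int, symmetric]) auto
  moreover have "0 \<le> C" using K unfolding C_def by linarith
  ultimately show "(\<integral>\<omega>. tail_sum \<alpha> n b \<omega> powr \<rho> \<partial>unit_product n) \<le> C"
    by (simp only: ennreal_le_iff)
qed

text \<open>The sum is at least 1 as soon as one term is. By independence all terms stay below 1
  with probability at most the product of the 1 - b_i^\<alpha>, which is at most exp (- 1) and hence
  at most 1 / 2.\<close>

lemma tail_sum_lower_normalized: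
  assumes "0 < \<rho>" "\<rho> < \<alpha>" "\<alpha> < 1" "\<And>i. i < n \<Longrightarrow> 0 \<le> b i" "(\<Sum>i<n. b i powr \<alpha>) = 1"
  shows "1 / 2 \<le> (\<integral>\<omega>. tail_sum \<alpha> n b \<omega> powr \<rho> \<partial>unit_product n)"
proof -
  let ?P = "unit_product n"
  let ?J = "\<lambda>i. {u \<in> space unit_uniform. b i * u powr (- 1 / \<alpha>) < 1}"
  let ?E = "{\<omega> \<in> space ?P. \<forall>i\<in>{..<n}. \<omega> i \<in> ?J i}"
  have b1: "b i powr \<alpha> \<le> 1" if "i < n" for i
    using member_le_sum[of i "{..<n}" "\<lambda>i. b i powr \<alpha>"] that assms by simp
  have J: "?J i \<in> sets unit_uniform" for i by measurable
  have em: "emeasure unit_uniform (?J i) \<le> ennreal (1 - b i powr \<alpha>)" if i: "i < n" for i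
  proof -
    have "?J i \<subseteq> {b i powr \<alpha> <..< 1}"
    proof
      fix u assume u: "u \<in> ?J i"
      then have "b i < u powr (1 / \<alpha>)" "0 < u" "u < 1"
        by (auto simp: space_unit_uniform powr_minus_divide divide_less_eq)
      then have "b i powr \<alpha> < (u powr (1 / \<alpha>)) powr \<alpha>"
        using assms i by (intro powr_less_mono2) auto
      also have "\<dots> = u" using assms \<open>0 < u\<close> by (simp add: powr_powr)
      finally show "u \<in> {b i powr \<alpha> <..< 1}" using \<open>u < 1\<close> by simp
    qed
    moreover have sub: "{b i powr \<alpha> <..< 1} \<subseteq> {0<..<1}"
      using powr_ge_zero[of "b i" \<alpha>] by (auto simp del: powr_ge_zero)
    moreover have "{b i powr \<alpha> <..< 1} \<in> sets unit_uniform"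
      using sub by (simp add: sets_restrict_space_iff)
    ultimately have "emeasure unit_uniform (?J i) \<le> emeasure unit_uniform {b i powr \<alpha> <..< 1}"
      by (intro emeasure_mono)
    also have "\<dots> = emeasure lborel {b i powr \<alpha> <..< 1}"
      by (rule emeasure_restrict_space) (use sub in auto)
    finally have "emeasure unit_uniform (?J i) \<le> emeasure lborel {b i powr \<alpha> <..< 1}" .
    then show ?thesis using b1[OF i] by simp
  qed
  have "emeasure ?P ?E = (\<Prod>i<n. emeasure unit_uniform (?J i))"
    using J by (intro unit_product.emeasure_PiM_Collect) auto
  also have "\<dots> \<le> (\<Prod>i<n. ennreal (1 - b i powr \<alpha>))"
    using em by (intro prod_mono_ennreal) auto
  also have "\<dots> = ennreal (\<Prod>i<n. 1 - b i powr \<alpha>)" using b1 by (intro prod_ennreal) auto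
  also have "\<dots> \<le> ennreal (1 / 2)"
  proof (rule ennreal_leI)
    have "(\<Prod>i<n. 1 - b i powr \<alpha>) \<le> (\<Prod>i<n. exp (- (b i powr \<alpha>)))"
      using b1 exp_ge_add_one_self[of "- (b _ powr \<alpha>)"] by (intro prod_mono) auto
    also have "\<dots> = exp (- 1)" using assms by (simp add: exp_sum[symmetric] sum_negf)
    also have "\<dots> \<le> 1 / 2" using exp_ge_add_one_self[of 1] by (simp add: exp_minus field_simps)
    finally show "(\<Prod>i<n. 1 - b i powr \<alpha>) \<le> 1 / 2" .
  qed
  finally have "measure ?P ?E \<le> 1 / 2"
    unfolding measure_def by (intro enn2real_leI; assumption?) simp
  moreover have E: "?E \<in> sets ?P"
  proof -
    have "{\<omega> \<in> space ?P. \<omega> i \<in> ?J i} \<in> sets ?P" if "i < n" for i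
    proof -
      have "(\<lambda>\<omega>. \<omega> i) -` ?J i \<inter> space ?P \<in> sets ?P"
        using that J[of i] by (intro measurable_sets[OF measurable_component_singleton]) auto
      moreover have "{\<omega> \<in> space ?P. \<omega> i \<in> ?J i} = (\<lambda>\<omega>. \<omega> i) -` ?J i \<inter> space ?P" by blast
      ultimately show ?thesis by (simp only:)
    qed
    then show ?thesis by (intro sets.sets_Collect_finite_All) auto
  qed
  ultimately have "1 / 2 \<le> measure ?P (space ?P - ?E)"
    using unit_product.prob_compl[of ?E n] by simp
  also have "\<dots> = (\<integral>\<omega>. indicator (space ?P - ?E) \<omega> \<partial>?P)"
    by (simp add: Int_absorb2)
  also have "\<dots> \<le> (\<integral>\<omega>. tail_sum \<alpha> n b \<omega> powr \<rho> \<partial>?P)"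
  proof (intro integral_mono tail_sum_upper_normalized assms)
    show "integrable ?P (indicator (space ?P - ?E) :: _ \<Rightarrow> real)"
      using E by (intro integrable_real_indicator) (auto simp: unit_product.emeasure_eq_measure)
    fix \<omega> assume \<omega>: "\<omega> \<in> space ?P"
    show "indicator (space ?P - ?E) \<omega> \<le> tail_sum \<alpha> n b \<omega> powr \<rho>"
    proof (cases "\<omega> \<in> ?E")
      case False
      then obtain i where i: "i < n" "\<omega> i \<notin> ?J i" using \<omega> by auto
      have "\<omega> i \<in> space unit_uniform"
        using PiE_mem[of \<omega> "{..<n}" "\<lambda>_. space unit_uniform" i] \<omega> i(1) by (simp only: space_PiM lessThan_iff)
      then have "1 \<le> b i * \<omega> i powr (- 1 / \<alpha>)" using i(2) by (simp only: mem_Collect_eq simp_thms not_less)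
      also have "\<dots> \<le> tail_sum \<alpha> n b \<omega>"
        unfolding tail_sum_def using i assms by (intro member_le_sum) auto
      finally have "1 \<le> tail_sum \<alpha> n b \<omega> powr \<rho>" using assms by (intro ge_one_powr_ge_zero) auto
      then show ?thesis by (simp add: indicator_def)
    qed (simp add: indicator_def)
  qed
  finally show ?thesis .
qed

text \<open>Both bounds are homogeneous, so the coefficients are divided by S^(1/\<alpha>); if S = 0
  all of them vanish. The constants depend on neither n nor b.\<close>

lemma tail_sum_moments:
  assumes "0 < \<rho>" "\<rho> < \<alpha>" "\<alpha> < 1" "\<And>i. i < n \<Longrightarrow> 0 \<le> b i"
  defines "S \<equiv> \<Sum>i<n. b i powr \<alpha>"
  shows "integrable (unit_product n) (\<lambda>\<omega>. tail_sum \<alpha> n b \<omega> powr \<rho>)"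
    "(\<integral>\<omega>. tail_sum \<alpha> n b \<omega> powr \<rho> \<partial>unit_product n)
       \<le> (1 + (\<alpha> / (1 - \<alpha>) + \<alpha> / (\<alpha> - \<rho>))) * S powr (\<rho> / \<alpha>)"
    "1 / 2 * S powr (\<rho> / \<alpha>) \<le> (\<integral>\<omega>. tail_sum \<alpha> n b \<omega> powr \<rho> \<partial>unit_product n)"
proof -
  have S0: "0 \<le> S" by (simp add: S_def sum_nonneg)
  define c where "c = S powr (1 / \<alpha>)"
  let ?b = "\<lambda>i. b i / c"
  consider "S = 0" | "S > 0" using S0 by linarith
  then have "integrable (unit_product n) (\<lambda>\<omega>. tail_sum \<alpha> n b \<omega> powr \<rho>) \<and>
    (\<integral>\<omega>. tail_sum \<alpha> n b \<omega> powr \<rho> \<partial>unit_product n)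
       \<le> (1 + (\<alpha> / (1 - \<alpha>) + \<alpha> / (\<alpha> - \<rho>))) * S powr (\<rho> / \<alpha>) \<and>
    1 / 2 * S powr (\<rho> / \<alpha>) \<le> (\<integral>\<omega>. tail_sum \<alpha> n b \<omega> powr \<rho> \<partial>unit_product n)"
  proof cases
    case 1
    then have "b i = 0" if "i < n" for i
      using that sum_nonneg_eq_0_iff[of "{..<n}" "\<lambda>i. b i powr \<alpha>"] by (auto simp: S_def)
    then have "tail_sum \<alpha> n b = (\<lambda>\<omega>. 0)" by (auto simp: tail_sum_def)
    then show ?thesis using 1 by simp
  next
    case 2
    then have c: "c > 0" by (simp add: c_def)
    have "(\<Sum>i<n. ?b i powr \<alpha>) = S / c powr \<alpha>"
      using assms c by (simp add: powr_divide S_def sum_divide_distrib)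
    also have "\<dots> = 1" using 2 assms by (simp add: c_def powr_powr)
    finally have b1: "(\<Sum>i<n. ?b i powr \<alpha>) = 1" .
    have b0: "0 \<le> ?b i" if "i < n" for i using assms that c by simp
    note norm = assms(1-3) b0 b1
    have "tail_sum \<alpha> n b \<omega> = c * tail_sum \<alpha> n ?b \<omega>" for \<omega>
      using c by (simp add: tail_sum_scale[symmetric])
    moreover have "(c * x) powr \<rho> = S powr (\<rho> / \<alpha>) * x powr \<rho>" if "0 \<le> x" for x
      using c that by (simp add: powr_mult) (simp add: c_def powr_powr)
    ultimately have *: "tail_sum \<alpha> n b \<omega> powr \<rho> = S powr (\<rho> / \<alpha>) * tail_sum \<alpha> n ?b \<omega> powr \<rho>" for \<omega>
      using tail_sum_nonneg[OF b0] by simp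
    show ?thesis unfolding *
      using tail_sum_upper_normalized[OF norm]
        mult_left_mono[OF tail_sum_upper_normalized(2)[OF norm] powr_ge_zero[of S "\<rho> / \<alpha>"]]
        mult_left_mono[OF tail_sum_lower_normalized[OF norm] powr_ge_zero[of S "\<rho> / \<alpha>"]]
      by (simp add: mult.commute)
  qed
  then show "integrable (unit_product n) (\<lambda>\<omega>. tail_sum \<alpha> n b \<omega> powr \<rho>)"
    "(\<integral>\<omega>. tail_sum \<alpha> n b \<omega> powr \<rho> \<partial>unit_product n)
       \<le> (1 + (\<alpha> / (1 - \<alpha>) + \<alpha> / (\<alpha> - \<rho>))) * S powr (\<rho> / \<alpha>)"
    "1 / 2 * S powr (\<rho> / \<alpha>) \<le> (\<integral>\<omega>. tail_sum \<alpha> n b \<omega> powr \<rho> \<partial>unit_product n)"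
    by auto
qed

section \<open>From square functions to t-functions\<close>

lemma square_powr: "(x\<^sup>2) powr a = \<bar>x\<bar> powr (2 * a)" for x a :: real
proof -
  have "x\<^sup>2 = \<bar>x\<bar> powr 2" by simp
  then show ?thesis by (simp only: powr_powr)
qed

text \<open>The link between random sums and square functions: weighting the i-th entry by the
  square root of the i-th random variable puts that variable in front of its square.\<close>

lemma tail_sum_squares:
  "tail_sum \<alpha> n (\<lambda>i. (x i)\<^sup>2) \<omega> powr (1 / 2) = pnorm 2 n (\<lambda>i. sqrt (\<omega> i powr (- 1 / \<alpha>)) * x i)"
  unfolding pnorm_two tail_sum_def
  by (simp add: powr_half_sqrt sum_nonneg power_mult_distrib mult.commute)

text \<open>A \<open>(2,2)\<close>-regular operator is applied to \<open>sqrt (\<eta> i) * x i\<close>, where the \<open>\<eta> i\<close> are independent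
  positive variables with the tail of a \<open>t / 2\<close>-stable law; averaging over them turns the square
  functions into \<open>t\<close>-functions.\<close>

lemma bilin_regular_below_two:
  fixes r t :: real
  assumes r: "1 \<le> r" "r < t" "t < 2" and r2: "1 \<le> r2"
  shows "bilin_regular (ereal r) (conj_exp r2) (ereal t)"
proof -
  \<comment> \<open>Squaring halves the exponents: the coefficient x_i^2 raised to the power t / 2
    is |x_i|^t.\<close>
  define \<alpha> where "\<alpha> = t / 2"
  define \<rho> where "\<rho> = r / 2"
  define C0 where "C0 = 1 + (\<alpha> / (1 - \<alpha>) + \<alpha> / (\<alpha> - \<rho>))"
  \<comment> \<open>Two orders of moment will be used, \<rho> for the arguments and 1 / 2 for the
    images. The latter is admissible because t > r \<ge> 1.\<close>
  have \<alpha>: "0 < \<rho>" "\<rho> < \<alpha>" "\<alpha> < 1" "0 < (1 / 2 :: real)" "1 / 2 < \<alpha>"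
    using r by (auto simp: \<alpha>_def \<rho>_def)
  have C0: "0 \<le> C0" using \<alpha> unfolding C0_def by (intro add_nonneg_nonneg) auto
  have er: "1 \<le> ereal r" "1 \<le> ereal t" using r by auto
  have two: "(1::ereal) \<le> 2" by simp
  obtain K where K: "0 \<le> K" "\<And>n m l A C X. 1 \<le> n \<Longrightarrow> 1 \<le> m \<Longrightarrow> 1 \<le> l \<Longrightarrow> 0 \<le> C \<Longrightarrow>
      (\<And>u. pnorm r2 l (\<lambda>k. \<Sum>j<m. A j k * u j) \<le> C * pnorm (ereal r) m u) \<Longrightarrow>
      mnorm r2 2 n l (\<lambda>i k. \<Sum>j<m. A j k * X i j) \<le> K * C * mnorm (ereal r) 2 n m X"
    by (rule bilin_regularE[OF bilin_regular_two[OF er(1) one_le_conj_exp[OF r2]] er(1) r2 two]) blast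
  show ?thesis
  \<comment> \<open>The factor 2 inverts the lower moment bound; 1 + C0 comes from averaging the two
    terms of the bound for W below.\<close>
  proof (rule bilin_regularI[OF er(1) r2 er(2), of "2 * (K * (1 + C0))"])
    show "0 \<le> 2 * (K * (1 + C0))" using K C0 by simp
    fix n m l :: nat and A :: "nat \<Rightarrow> nat \<Rightarrow> real" and C :: real and X :: "nat \<Rightarrow> nat \<Rightarrow> real"
    assume *: "1 \<le> n" "1 \<le> m" "1 \<le> l" "0 \<le> C"
      and bd: "\<And>u. pnorm r2 l (\<lambda>k. \<Sum>j<m. A j k * u j) \<le> C * pnorm (ereal r) m u"
    define Z where "Z i k = (\<Sum>j<m. A j k * X i j)" for i k
    define D where "D = mnorm (ereal r) (ereal t) n m X"
    define P where "P j \<omega> = tail_sum \<alpha> n (\<lambda>i. (X i j)\<^sup>2) \<omega>" for j \<omega>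
    define Q where "Q k \<omega> = tail_sum \<alpha> n (\<lambda>i. (Z i k)\<^sup>2) \<omega>" for k \<omega>
    let ?U = "unit_product n"
    have D0: "0 \<le> D" unfolding D_def using er * by (intro mnorm_nonneg)
    have S: "(\<Sum>i<n. (x i)\<^sup>2 powr \<alpha>) powr (c / 2 / \<alpha>) = pnorm (ereal t) n x powr c" for x :: "nat \<Rightarrow> real" and c
      using r by (simp add: square_powr \<alpha>_def pnorm_ereal powr_powr sum_nonneg)
    have P_int: "integrable ?U (\<lambda>\<omega>. P j \<omega> powr \<rho>)"
      and P_le: "(\<integral>\<omega>. P j \<omega> powr \<rho> \<partial>?U) \<le> C0 * pnorm (ereal t) n (\<lambda>i. X i j) powr r" for j
      using tail_sum_moments(1,2)[OF \<alpha>(1-3), of n "\<lambda>i. (X i j)\<^sup>2"] S[of "\<lambda>i. X i j" r]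
      by (auto simp: P_def C0_def \<rho>_def)
    have Q_int: "integrable ?U (\<lambda>\<omega>. Q k \<omega> powr (1 / 2))"
      and Q_ge: "pnorm (ereal t) n (\<lambda>i. Z i k) \<le> 2 * (\<integral>\<omega>. Q k \<omega> powr (1 / 2) \<partial>?U)" for k
      using tail_sum_moments(1,3)[OF \<alpha>(4,5,3), of n "\<lambda>i. (Z i k)\<^sup>2"] S[of "\<lambda>i. Z i k" 1]
        pnorm_nonneg[OF er(2) *(1), of "\<lambda>i. Z i k"]
      by (auto simp: Q_def)
    show "mnorm r2 (ereal t) n l (\<lambda>i k. \<Sum>j<m. A j k * X i j)
        \<le> 2 * (K * (1 + C0)) * C * mnorm (ereal r) (ereal t) n m X"
    proof (cases "D = 0")
      case True
      then have "\<forall>j<m. \<forall>i<n. X i j = 0"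
        using pnorm_eq_0_iff[OF er(1) *(2)] pnorm_eq_0_iff[OF er(2) *(1)] unfolding D_def mnorm_def by metis
      then have "mnorm r2 (ereal t) n l (\<lambda>i k. \<Sum>j<m. A j k * X i j) = mnorm r2 (ereal t) n l (\<lambda>i k. 0)"
        unfolding mnorm_def by (intro pnorm_cong arg_cong[where f=abs]) auto
      also have "\<dots> = 0" unfolding mnorm_def using er r2 * by (simp add: pnorm_zero)
      finally show ?thesis using True by (simp add: D_def)
    next
      case False
      then have D: "D > 0" using D0 by simp
      \<comment> \<open>The outer norm is replaced by a linear functional, which commutes with the
        integral over \<omega>. Its coefficients are then made nonnegative so that the lower moment
        bounds can be inserted.\<close>
      obtain v0 where v0: "(\<Sum>k<l. pnorm (ereal t) n (\<lambda>i. Z i k) * v0 k) = mnorm r2 (ereal t) n l Z"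
        "pnorm (conj_exp r2) l v0 \<le> 1"
        unfolding mnorm_def by (rule pnorm_norming[OF r2 *(3)])
      define v where "v k = \<bar>v0 k\<bar>" for k
      have v: "0 \<le> v k" "pnorm (conj_exp r2) l v \<le> 1" for k
        using v0(2) pnorm_cong[of l v v0] by (auto simp: v_def)
      have pointwise: "(\<Sum>k<l. Q k \<omega> powr (1 / 2) * v k) \<le> K * C * (D + D powr (1 - r) * (\<Sum>j<m. P j \<omega> powr \<rho>))" for \<omega>
      proof -
        let ?X = "\<lambda>i j. sqrt (\<omega> i powr (- 1 / \<alpha>)) * X i j"
        define W where "W = mnorm (ereal r) 2 n m ?X"
        have W0: "0 \<le> W" unfolding W_def using er * by (intro mnorm_nonneg)
        have "(\<Sum>j<m. A j k * ?X i j) = sqrt (\<omega> i powr (- 1 / \<alpha>)) * Z i k" for i k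
          by (simp add: Z_def sum_distrib_left mult_ac)
        then have Q: "Q k \<omega> powr (1 / 2) = pnorm 2 n (\<lambda>i. \<Sum>j<m. A j k * ?X i j)" for k
          unfolding Q_def tail_sum_squares by (simp only:)
        have "(\<Sum>k<l. Q k \<omega> powr (1 / 2) * v k)
            \<le> pnorm r2 l (\<lambda>k. Q k \<omega> powr (1 / 2)) * pnorm (conj_exp r2) l v"
          using r2 * by (intro pnorm_Holder)
        also have "\<dots> \<le> pnorm r2 l (\<lambda>k. Q k \<omega> powr (1 / 2))"
          by (intro mult_left_le v(2) pnorm_nonneg r2 *)
        also have "\<dots> = mnorm r2 2 n l (\<lambda>i k. \<Sum>j<m. A j k * ?X i j)"
          unfolding Q mnorm_def ..
        also have "\<dots> \<le> K * C * W" unfolding W_def by (intro K(2) * bd)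
        \<comment> \<open>The moment bounds control the mean of W^r, not of W. If W > D then (W /
          D)^(r - 1) \<ge> 1, so W is bounded linearly in W^r; this takes the place of Jensen's
          inequality.\<close>
        also have "W \<le> D + D powr (1 - r) * W powr r"
        proof (cases "W \<le> D")
          case True
          then show ?thesis using D by (simp add: add_increasing2)
        next
          case False
          then have "D powr (1 - r) * W powr r \<ge> W powr (1 - r) * W powr r"
            using D r by (intro mult_right_mono powr_mono2') auto
          moreover have "W powr (1 - r) * W powr r = W" using False D by (simp flip: powr_add)
          ultimately show ?thesis using D by linarith
        qed
        also have "W powr r = (\<Sum>j<m. P j \<omega> powr \<rho>)"
        proof -
          have "W powr r = (\<Sum>j<m. \<bar>pnorm 2 n (\<lambda>i. ?X i j)\<bar> powr r)"
            unfolding W_def mnorm_def using r by (intro pnorm_ereal_powr)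
          also have "\<dots> = (\<Sum>j<m. (P j \<omega> powr (1 / 2)) powr r)"
            unfolding P_def tail_sum_squares using pnorm_nonneg[OF two *(1)] by simp
          also have "\<dots> = (\<Sum>j<m. P j \<omega> powr \<rho>)" by (simp add: powr_powr \<rho>_def)
          finally show ?thesis .
        qed
        finally show ?thesis using K * by (simp add: mult_left_mono)
      qed
      have "mnorm r2 (ereal t) n l Z \<le> (\<Sum>k<l. pnorm (ereal t) n (\<lambda>i. Z i k) * v k)"
        unfolding v0(1)[symmetric] v_def
        by (intro sum_mono mult_left_mono pnorm_nonneg er *) auto
      also have "\<dots> \<le> (\<Sum>k<l. 2 * (\<integral>\<omega>. Q k \<omega> powr (1 / 2) \<partial>?U) * v k)"
        by (intro sum_mono mult_right_mono Q_ge v)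
      also have "\<dots> = 2 * (\<integral>\<omega>. (\<Sum>k<l. Q k \<omega> powr (1 / 2) * v k) \<partial>?U)"
        using Q_int by (subst Bochner_Integration.integral_sum) (auto simp: sum_distrib_left mult.assoc)
      also have "\<dots> \<le> 2 * (\<integral>\<omega>. K * C * (D + D powr (1 - r) * (\<Sum>j<m. P j \<omega> powr \<rho>)) \<partial>?U)"
      proof (intro mult_left_mono integral_mono pointwise)
        show "integrable ?U (\<lambda>\<omega>. \<Sum>k<l. Q k \<omega> powr (1 / 2) * v k)" using Q_int by auto
        have "integrable ?U (\<lambda>\<omega>. D + D powr (1 - r) * (\<Sum>j<m. P j \<omega> powr \<rho>))" using P_int by auto
        then show "integrable ?U (\<lambda>\<omega>. K * C * (D + D powr (1 - r) * (\<Sum>j<m. P j \<omega> powr \<rho>)))"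
          by (rule integrable_mult_right)
      qed simp
      also have "\<dots> = 2 * (K * C * (D + D powr (1 - r) * (\<Sum>j<m. (\<integral>\<omega>. P j \<omega> powr \<rho> \<partial>?U))))"
        using P_int by (simp add: unit_product.P.prob_space)
      also have "\<dots> \<le> 2 * (K * C * (D + D powr (1 - r) * (\<Sum>j<m. C0 * pnorm (ereal t) n (\<lambda>i. X i j) powr r)))"
        using K * by (intro mult_left_mono add_left_mono sum_mono P_le) auto
      also have "(\<Sum>j<m. C0 * pnorm (ereal t) n (\<lambda>i. X i j) powr r) = C0 * D powr r"
        using pnorm_ereal_powr[OF r(1), of m "\<lambda>j. pnorm (ereal t) n (\<lambda>i. X i j)"] pnorm_nonneg[OF er(2) *(1)]
        by (simp add: D_def mnorm_def sum_distrib_left)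
      also have "D powr (1 - r) * (C0 * D powr r) = C0 * D"
      proof -
        have "D powr (1 - r) * D powr r = D" using D by (simp flip: powr_add)
        then show ?thesis by (metis mult.left_commute)
      qed
      finally show ?thesis unfolding Z_def[abs_def] D_def[symmetric] by (simp add: algebra_simps)
    qed
  qed
qed

section \<open>Choice of the common exponent in the six cases\<close>

theorem bilin_regular_cases:
  assumes "1 \<le> r1" "1 \<le> r2" "1 \<le> p" "1 \<le> q"
  assumes "(q \<le> r1 \<and> r1 = r2 \<and> r2 \<le> p)
    \<or> (r1 = 1 \<and> r2 = 1 \<and> 1 \<le> q \<and> q \<le> p \<and> p \<le> \<infinity>)
    \<or> (r1 = \<infinity> \<and> r2 = \<infinity> \<and> 1 \<le> q \<and> q \<le> p \<and> p \<le> \<infinity>)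
    \<or> (1 \<le> r2 \<and> r2 \<le> r1 \<and> r1 < 2 \<and> (\<exists>t. q \<le> t \<and> t \<le> p \<and> r1 < t \<and> t \<le> 2))
    \<or> (2 < r2 \<and> r2 \<le> r1 \<and> r1 \<le> \<infinity> \<and> (\<exists>t. q \<le> t \<and> t \<le> p \<and> 2 \<le> t \<and> t < r2))
    \<or> (1 \<le> r2 \<and> r2 \<le> 2 \<and> 2 \<le> r1 \<and> r1 \<le> \<infinity> \<and> q \<le> 2 \<and> 2 \<le> p)"
  obtains t where "1 \<le> t" "q \<le> t" "t \<le> p" "bilin_regular r1 (conj_exp r2) t"
proof -
  \<comment> \<open>The averaging argument needs t / 2 < 1, hence t = 2 is taken from Grothendieck's
    inequality directly.\<close>
  have below: "bilin_regular r (conj_exp s) t" if rt: "1 \<le> r" "r < t" "t \<le> 2" "1 \<le> s" for r s t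
  proof (cases "t = 2")
    case True
    with bilin_regular_two[OF rt(1) one_le_conj_exp[OF rt(4)]] show ?thesis by (simp only:)
  next
    case False
    then have "t < 2" using rt by auto
    then obtain r' t' where "r = ereal r'" "t = ereal t'"
      using rt by (cases r; cases t) auto
    then show ?thesis using rt \<open>t < 2\<close> bilin_regular_below_two[of r' t' s] by simp
  qed
  from assms(5) show ?thesis
  proof (elim disjE conjE exE)
    assume "q \<le> r1" "r1 = r2" "r2 \<le> p"
    then show ?thesis using that[of r1] bilin_regular_diagonal[of r1] assms by simp
  next
    assume "r1 = 1" "r2 = 1" "q \<le> p"
    then show ?thesis using that[of p] bilin_regular_one[of p] assms by simp
  next
    assume "r1 = \<infinity>" "r2 = \<infinity>" "q \<le> p"
    then show ?thesis using that[of p] bilin_regular_PInf[of p] assms by simp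
  next
    fix t assume "q \<le> t" "t \<le> p" "r1 < t" "t \<le> 2"
    then show ?thesis using that[of t] below[of r1 t r2] assms by auto
  next
    fix t assume t: "q \<le> t" "t \<le> p" "2 \<le> t" "t < r2"
    have t1: "1 \<le> t" using t assms by auto
    \<comment> \<open>Conjugation turns 2 \<le> t < r2 into \<open>conj_exp r2 < conj_exp t\<close>
      and \<open>conj_exp t \<le> 2\<close>, the hypotheses of \<open>below\<close>.\<close>
    have "conj_exp r2 < conj_exp t" using t t1 by (intro conj_exp_strict_antimono)
    moreover have "conj_exp t \<le> conj_exp 2"
      using conj_exp_strict_antimono[of 2 t] t(3) by (cases "2 < t") auto
    then have "conj_exp t \<le> 2" unfolding conj_exp_simps .
    ultimately have "bilin_regular (conj_exp r2) (conj_exp (conj_exp r1)) (conj_exp t)"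
      using assms by (intro below) auto
    from bilin_regular_transpose[OF this] have "bilin_regular r1 (conj_exp r2) t"
      using assms t1 by (simp add: conj_exp_conj_exp)
    then show ?thesis using that[of t] t t1 by auto
  next
    assume "q \<le> 2" "2 \<le> p"
    then show ?thesis using that[of 2] bilin_regular_two[of r1 "conj_exp r2"] assms by auto
  qed
qed

section \<open>Approximation by step functions\<close>

text \<open>A finite exponent uses dominated convergence. For \<infinity>, where convergence must be
  uniform, values are rounded down to multiples of \<epsilon>.\<close>

lemma Lp_fun_simple_approx:
  assumes "1 \<le> r" "f \<in> Lp_fun r M" "0 < \<epsilon>"
  obtains s where "simple_function M s" "s \<in> Lp_fun r M" "Lp_fun_norm r M (\<lambda>x. f x - s x) \<le> \<epsilon>"
  using \<open>1 \<le> r\<close>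
proof (cases rule: exponent_cases)
  case inf
  define C where "C = Lp_fun_norm \<infinity> M f"
  \<comment> \<open>An essentially bounded function can be unbounded on a null set; clipping at C
    leaves finitely many values after rounding.\<close>
  define g where "g x = max (- C) (min C (f x))" for x
  define s where "s x = \<epsilon> * of_int \<lfloor>g x / \<epsilon>\<rfloor>" for x
  have [measurable]: "f \<in> borel_measurable M" using assms by (rule_tac Lp_fun_measurable)
  have C0: "0 \<le> C" by (simp add: C_def)
  have g: "- C \<le> g x" "g x \<le> C" for x using C0 by (auto simp: g_def)
  have gm [measurable]: "g \<in> borel_measurable M" unfolding g_def[abs_def] by measurable
  have sm [measurable]: "s \<in> borel_measurable M" unfolding s_def[abs_def] by measurable
  have "s ` space M \<subseteq> (\<lambda>k. \<epsilon> * of_int k) ` {\<lfloor>- C / \<epsilon>\<rfloor>..\<lfloor>C / \<epsilon>\<rfloor>}"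
  proof (intro image_subsetI)
    fix x
    have "- C / \<epsilon> \<le> g x / \<epsilon>" "g x / \<epsilon> \<le> C / \<epsilon>"
      using g assms(3) by (intro divide_right_mono; simp)+
    then show "s x \<in> (\<lambda>k. \<epsilon> * of_int k) ` {\<lfloor>- C / \<epsilon>\<rfloor>..\<lfloor>C / \<epsilon>\<rfloor>}"
      unfolding s_def by (intro imageI) (simp only: atLeastAtMost_iff floor_mono simp_thms)
  qed
  then have fin: "finite (s ` space M)" by (rule finite_subset) auto
  have simple: "simple_function M s"
    unfolding simple_function_def using fin by (auto intro!: measurable_sets[OF sm])
  have gs: "\<bar>g x - s x\<bar> \<le> \<epsilon>" for x
  proof -
    have "g x = \<epsilon> * (g x / \<epsilon>)" using assms(3) by simp
    moreover have "\<epsilon> * of_int \<lfloor>g x / \<epsilon>\<rfloor> \<le> \<epsilon> * (g x / \<epsilon>)"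
      using assms(3) by (intro mult_left_mono of_int_floor_le) simp
    moreover have "\<epsilon> * (g x / \<epsilon>) \<le> \<epsilon> * (of_int \<lfloor>g x / \<epsilon>\<rfloor> + 1)"
      using assms(3) by (intro mult_left_mono) linarith+
    ultimately have "s x \<le> g x" "g x \<le> s x + \<epsilon>" unfolding s_def by (simp_all add: distrib_left)
    then show ?thesis by auto
  qed
  have fg: "AE x in M. f x = g x"
    using Lp_fun_PInf_AE[OF assms(2)[unfolded inf]] unfolding C_def[symmetric]
    by eventually_elim (auto simp: g_def)
  have "AE x in M. \<bar>f x - s x\<bar> \<le> \<epsilon>" using fg by eventually_elim (use gs in auto)
  then have 1: "Lp_fun_norm \<infinity> M (\<lambda>x. f x - s x) \<le> \<epsilon>" using assms(3) by (intro Lp_fun_PInfI) auto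
  have "\<bar>s x\<bar> \<le> C + \<epsilon>" for x using gs[of x] g[of x] by auto
  then have "s \<in> Lp_fun \<infinity> M" using assms(3) C0 by (intro Lp_fun_PInfI[of _ _ "C + \<epsilon>"]) auto
  then show ?thesis using that simple 1 inf by blast
next
  case (fin p)
  have fm [measurable]: "f \<in> borel_measurable M" using assms by (rule_tac Lp_fun_measurable)
  from borel_measurable_implies_sequence_metric[OF fm, of 0] obtain s where
    s: "\<And>i. simple_function M (s i)" "\<And>x. x \<in> space M \<Longrightarrow> (\<lambda>i. s i x) \<longlonglongrightarrow> f x"
      "\<And>i x. x \<in> space M \<Longrightarrow> \<bar>s i x\<bar> \<le> 2 * \<bar>f x\<bar>"
    by simp metis
  have sm [measurable]: "s i \<in> borel_measurable M" for i using s(1) by (rule borel_measurable_simple_function)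
  have sLp: "s i \<in> Lp_fun r M" for i
    by (rule Lp_fun_mono(1)[OF assms(1) Lp_fun_scale(1)[OF assms(1,2), of 2]])
      (use s(3)[of _ i] in \<open>auto simp: abs_mult\<close>)
  \<comment> \<open>The dominating function: |f - s_i| \<le> |f| + 2 |f|.\<close>
  have int: "integrable M (\<lambda>x. \<bar>3 * f x\<bar> powr p)"
    using Lp_fun_scale(1)[OF assms(1,2), of 3] by (simp add: fin Lp_fun_ereal)
  have "(\<lambda>i. \<integral>x. \<bar>f x - s i x\<bar> powr p \<partial>M) \<longlonglongrightarrow> (\<integral>x. 0 \<partial>M)"
  proof (rule integral_dominated_convergence[OF _ _ int])
    show "AE x in M. (\<lambda>i. \<bar>f x - s i x\<bar> powr p) \<longlonglongrightarrow> 0"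
    proof (rule AE_I2)
      fix x assume "x \<in> space M"
      then have "(\<lambda>i. \<bar>f x - s i x\<bar>) \<longlonglongrightarrow> \<bar>f x - f x\<bar>" by (intro tendsto_intros s)
      then have "(\<lambda>i. \<bar>f x - s i x\<bar> powr p) \<longlonglongrightarrow> 0 powr p"
        using fin by (intro tendsto_powr') auto
      then show "(\<lambda>i. \<bar>f x - s i x\<bar> powr p) \<longlonglongrightarrow> 0" by simp
    qed
    show "AE x in M. norm (\<bar>f x - s i x\<bar> powr p) \<le> \<bar>3 * f x\<bar> powr p" for i
    proof (rule AE_I2)
      fix x assume "x \<in> space M"
      then have "\<bar>f x - s i x\<bar> \<le> \<bar>3 * f x\<bar>" using s(3)[of x i] by simp
      then show "norm (\<bar>f x - s i x\<bar> powr p) \<le> \<bar>3 * f x\<bar> powr p"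
        using fin by (simp add: powr_mono2)
    qed
  qed auto
  then have "\<forall>\<^sub>F i in sequentially. (\<integral>x. \<bar>f x - s i x\<bar> powr p \<partial>M) < \<epsilon> powr p"
    using assms(3) by (intro order_tendstoD) auto
  then obtain i where "(\<integral>x. \<bar>f x - s i x\<bar> powr p \<partial>M) < \<epsilon> powr p"
    by (auto simp: eventually_sequentially)
  then have "(\<integral>x. \<bar>f x - s i x\<bar> powr p \<partial>M) powr (1 / p) \<le> (\<epsilon> powr p) powr (1 / p)"
    using fin by (intro powr_mono2) auto
  then have "Lp_fun_norm r M (\<lambda>x. f x - s i x) \<le> \<epsilon>"
    using fin assms(3) by (simp add: Lp_fun_norm_ereal powr_powr)
  then show ?thesis using that s(1) sLp by blast
qed

text \<open>Null cells are made empty, and \<open>step_weight\<close> is \<open>1\<close> there, so that all weights are positive.\<close>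

definition step_family :: "ereal \<Rightarrow> 'a measure \<Rightarrow> nat \<Rightarrow> (nat \<Rightarrow> 'a set) \<Rightarrow> bool" where
  "step_family r M m A \<longleftrightarrow> disjoint_family_on A {..<m} \<and>
     (\<forall>j<m. A j \<in> sets M \<and> (indicator (A j) :: 'a \<Rightarrow> real) \<in> Lp_fun r M \<and> (A j = {} \<or> emeasure M (A j) \<noteq> 0))"

definition step :: "nat \<Rightarrow> (nat \<Rightarrow> 'a set) \<Rightarrow> (nat \<Rightarrow> real) \<Rightarrow> 'a \<Rightarrow> real" where
  "step m A c x = (\<Sum>j<m. c j * indicator (A j) x)"

definition step_weight :: "ereal \<Rightarrow> 'a measure \<Rightarrow> 'a set \<Rightarrow> real" where
  "step_weight r M A = (if A = {} \<or> r = \<infinity> then 1 else measure M A powr (1 / real_of_ereal r))"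

lemma step_eq:
  assumes "step_family r M m A" "j < m" "x \<in> A j"
  shows "step m A c x = c j"
proof -
  have "indicator (A i) x = (if i = j then 1 else 0 :: real)" if "i < m" for i
    using assms that by (auto simp: step_family_def disjoint_family_on_def indicator_def)
  then have "step m A c x = (\<Sum>i<m. if i = j then c i else 0)"
    unfolding step_def by (intro sum.cong) auto
  then show ?thesis using assms by simp
qed

lemma step_eq_0: "(\<And>j. j < m \<Longrightarrow> x \<notin> A j) \<Longrightarrow> step m A c x = 0"
  by (auto simp: step_def intro!: sum.neutral)

lemma step_in_Lp_fun:
  assumes "1 \<le> r" "step_family r M m A"
  shows "step m A c \<in> Lp_fun r M"
  unfolding step_def[abs_def] using assms
  by (intro Lp_fun_sum Lp_fun_scale) (auto simp: step_family_def)

text \<open>An operation on values can be carried out cell by cell; \<phi> must send 0 to 0 because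
  every step function vanishes outside the cells.\<close>

lemma step_compose:
  assumes "step_family r M m A" "\<phi> (\<lambda>i. 0) = 0"
  shows "\<phi> (\<lambda>i. step m A (u i) x) = step m A (\<lambda>j. \<phi> (\<lambda>i. u i j)) x"
proof (cases "\<exists>j<m. x \<in> A j")
  case True
  then show ?thesis using step_eq[OF assms(1)] by auto
next
  case False
  then show ?thesis using step_eq_0[of m x A] assms(2) by simp
qed

lemma step_sum: "(\<Sum>i\<in>I. d i * step m A (u i) x) = step m A (\<lambda>j. \<Sum>i\<in>I. d i * u i j) x"
  unfolding step_def sum_distrib_left sum_distrib_right by (subst sum.swap) (simp add: mult.assoc)

lemma indicator_Lp_fun_finite:
  assumes "1 \<le> p" "(indicator A :: 'a \<Rightarrow> real) \<in> Lp_fun (ereal p) M"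
  shows "integrable M (indicator A :: 'a \<Rightarrow> real)"
proof -
  have "\<bar>indicator A x :: real\<bar> powr p = indicator A x" for x using assms by (simp add: indicator_def)
  then show ?thesis using assms by (simp add: Lp_fun_ereal)
qed

lemma step_weight_pos:
  assumes "1 \<le> r" "step_family r M m A" "j < m"
  shows "0 < step_weight r M (A j)"
  using \<open>1 \<le> r\<close>
proof (cases rule: exponent_cases)
  case (fin p)
  show ?thesis
  proof (cases "A j = {}")
    case False
    have A: "A j \<in> sets M" "integrable M (indicator (A j) :: _ \<Rightarrow> real)" "emeasure M (A j) \<noteq> 0"
      using assms False fin by (auto simp: step_family_def intro: indicator_Lp_fun_finite)
    then have "emeasure M (A j) < \<infinity>" by (simp add: integrable_indicator_iff sets.Int_space_eq2)
    with A(3) have "measure M (A j) > 0" by (simp add: measure_def enn2real_positive_iff zero_less_iff_neq_zero)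
    then show ?thesis using False fin by (simp add: step_weight_def)
  qed (simp add: step_weight_def)
qed (simp add: step_weight_def)

text \<open>On a nonempty cell \<open>step_weight\<close> is the norm of the indicator, so weighting
  the coefficients identifies step functions isometrically with vectors in l_r. Coefficients on
  empty cells must be 0, since they would count on the right only.\<close>

lemma step_norm_eq:
  assumes r: "1 \<le> r" "1 \<le> m" and A: "step_family r M m A" and c: "\<And>j. j < m \<Longrightarrow> A j = {} \<Longrightarrow> c j = 0"
  shows "Lp_fun_norm r M (step m A c) = pnorm r m (\<lambda>j. step_weight r M (A j) * c j)"
  using \<open>1 \<le> r\<close>
proof (cases rule: exponent_cases)
  case inf
  have ne: "{..<m} \<noteq> {}" using r by (auto simp: lessThan_empty_iff)
  have Lp: "step m A c \<in> Lp_fun \<infinity> M" using step_in_Lp_fun[OF r(1) A] inf by simp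
  have w: "pnorm r m (\<lambda>j. step_weight r M (A j) * c j) = pnorm \<infinity> m c" using inf by (simp add: step_weight_def)
  have "\<bar>step m A c x\<bar> \<le> pnorm \<infinity> m c" for x
  proof (cases "\<exists>j<m. x \<in> A j")
    case True
    then obtain j where "j < m" "x \<in> A j" by auto
    then show ?thesis using step_eq[OF A, of j x c] abs_le_pnorm[of \<infinity> j m c] by simp
  next
    case False
    then show ?thesis using step_eq_0[of m x A c] pnorm_nonneg[of \<infinity> m c] r by auto
  qed
  then have "Lp_fun_norm \<infinity> M (step m A c) \<le> pnorm \<infinity> m c"
    using Lp_fun_measurable[OF Lp] pnorm_nonneg[of \<infinity> m c] r by (intro Lp_fun_PInfI(2)) auto
  moreover have "\<bar>c j\<bar> \<le> Lp_fun_norm \<infinity> M (step m A c)" if j: "j < m" for j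
  proof (cases "A j = {}")
    case False
    then have Aj: "A j \<in> sets M" "emeasure M (A j) \<noteq> 0" using A j by (auto simp: step_family_def)
    show ?thesis
    proof (rule ccontr)
      assume neg: "\<not> ?thesis"
      \<comment> \<open>A cell of positive measure cannot be avoided almost everywhere, so the
        essential supremum sees the value \<open>c j\<close>.\<close>
      have "AE x in M. x \<notin> A j" using Lp_fun_PInf_AE[OF Lp]
        by eventually_elim (use neg step_eq[OF A j, of _ c] in auto)
      then have "emeasure M (A j) = 0" using Aj(1) by (simp add: AE_iff_measurable[OF Aj(1)] sets.sets_into_space[OF Aj(1)] Int_absorb1 Collect_conj_eq)
      then show False using Aj by simp
    qed
  qed (use c j in simp)
  then have "pnorm \<infinity> m c \<le> Lp_fun_norm \<infinity> M (step m A c)"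
    unfolding pnorm_PInf using ne by (subst Max_le_iff) auto
  ultimately show ?thesis using w inf by simp
next
  case (fin p)
  have int: "integrable M (indicator (A j) :: _ \<Rightarrow> real)" "A j \<in> sets M" if "j < m" for j
    using A that fin by (auto simp: step_family_def intro: indicator_Lp_fun_finite)
  have "\<bar>step m A c x\<bar> powr p = step m A (\<lambda>j. \<bar>c j\<bar> powr p) x" for x
    using step_compose[OF A, of "\<lambda>v. \<bar>v 0\<bar> powr p" "\<lambda>_. c" x] fin by simp
  then have "(\<integral>x. \<bar>step m A c x\<bar> powr p \<partial>M) = (\<integral>x. (\<Sum>j<m. \<bar>c j\<bar> powr p * indicator (A j) x) \<partial>M)"
    by (simp only: step_def)
  also have "\<dots> = (\<Sum>j<m. (\<integral>x. \<bar>c j\<bar> powr p * indicator (A j) x \<partial>M))"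
    by (intro Bochner_Integration.integral_sum integrable_mult_right int) simp
  also have "\<dots> = (\<Sum>j<m. \<bar>c j\<bar> powr p * measure M (A j))"
    using int by (intro sum.cong) (simp_all add: sets.Int_space_eq2)
  also have "\<dots> = (\<Sum>j<m. \<bar>step_weight r M (A j) * c j\<bar> powr p)"
    using c fin by (intro sum.cong) (auto simp: step_weight_def abs_mult powr_mult powr_powr)
  finally show ?thesis by (simp add: fin Lp_fun_norm_ereal pnorm_ereal)
qed

text \<open>Used where the coefficients run through all vectors, those on empty cells
  included.\<close>

lemma step_norm_le:
  assumes r: "1 \<le> r" "1 \<le> m" and A: "step_family r M m A"
  shows "Lp_fun_norm r M (step m A c) \<le> pnorm r m (\<lambda>j. step_weight r M (A j) * c j)"
proof -
  let ?c = "\<lambda>j. if A j = {} then 0 else c j"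
  have "step m A c = step m A ?c" by (auto simp: step_def fun_eq_iff intro!: sum.cong)
  then have "Lp_fun_norm r M (step m A c) = pnorm r m (\<lambda>j. step_weight r M (A j) * ?c j)"
    by (simp only:) (rule step_norm_eq[OF assms], simp)
  also have "\<dots> \<le> pnorm r m (\<lambda>j. step_weight r M (A j) * c j)"
    by (intro pnorm_mono r) (auto simp: abs_mult)
  finally show ?thesis .
qed

text \<open>One partition serves all n functions: the cells are level sets of the vector of their
  values.\<close>

lemma simple_functions_step:
  fixes n :: nat
  assumes r: "1 \<le> r" and f: "\<And>i. i < n \<Longrightarrow> simple_function M (f i)" "\<And>i. i < n \<Longrightarrow> f i \<in> Lp_fun r M"
  obtains m A u where "1 \<le> m" "step_family r M m A"
    "\<And>i. i < n \<Longrightarrow> AE x in M. f i x = step m A (u i) x"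
    "\<And>i j. i < n \<Longrightarrow> j < m \<Longrightarrow> A j = {} \<Longrightarrow> u i j = 0"
proof -
  define val where "val x = (\<lambda>i\<in>{..<n}. f i x)" for x
  define cell where "cell v = {x \<in> space M. val x = v}" for v
  \<comment> \<open>The zero vector is left out because its level set may have infinite measure,
    null level sets because they are invisible almost everywhere.\<close>
  define V where "V = {v \<in> val ` space M. (\<exists>i<n. v i \<noteq> 0) \<and> emeasure M (cell v) \<noteq> 0}"
  have "val ` space M \<subseteq> PiE {..<n} (\<lambda>i. f i ` space M)"
    by (intro image_subsetI) (simp add: val_def restrict_PiE_iff)
  moreover have "finite (PiE {..<n} (\<lambda>i. f i ` space M))"
    using f(1) by (intro finite_PiE) (auto simp: simple_function_def)
  ultimately have finR: "finite (val ` space M)" by (rule finite_subset)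
  then have finV: "finite V" by (auto simp: V_def)
  have cell: "cell v \<in> sets M" if "v \<in> val ` space M" for v
  proof -
    have "cell v = {x \<in> space M. \<forall>i\<in>{..<n}. f i x = v i}"
      using that by (auto simp: cell_def val_def fun_eq_iff restrict_def split: if_splits)
    moreover have "{x \<in> space M. f i x = v i} \<in> sets M" if "i \<in> {..<n}" for i
      using borel_measurable_simple_function[OF f(1)[of i]] that by simp
    ultimately show ?thesis by (simp add: sets.sets_Collect_finite_All del: Ball_def lessThan_iff)
  qed
  obtain e where e: "bij_betw e {..<card V} V"
    using ex_bij_betw_nat_finite[OF finV] by (auto simp: atLeast0LessThan)
  define A where "A j = (if j < card V then cell (e j) else {})" for j
  define u where "u i j = (if j < card V then e j i else 0)" for i j
  have eV: "e j \<in> V" if "j < card V" for j using e that by (auto simp: bij_betw_def)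
  show ?thesis
  \<comment> \<open>An extra empty cell makes the number of cells positive even if V is
    empty.\<close>
  proof (rule that[of "Suc (card V)" A u])
    show fam: "step_family r M (Suc (card V)) A"
      unfolding step_family_def
    proof (intro conjI allI impI)
      show "disjoint_family_on A {..<Suc (card V)}"
        using e by (auto simp: disjoint_family_on_def A_def cell_def bij_betw_def inj_on_def)
      fix j
      show sets: "A j \<in> sets M" using cell eV[of j] by (auto simp: A_def V_def)
      show "A j = {} \<or> emeasure M (A j) \<noteq> 0" using eV[of j] by (auto simp: A_def V_def)
      show "(indicator (A j) :: _ \<Rightarrow> real) \<in> Lp_fun r M"
      proof (cases "j < card V")
        case True
        then obtain i where i: "i < n" "e j i \<noteq> 0" using eV[OF True] by (auto simp: V_def)
        have "f i x = e j i" if "x \<in> A j" for x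
        proof -
          have "val x = e j" using that True by (simp add: A_def cell_def)
          then show ?thesis using i(1) by (simp add: val_def flip: \<open>val x = e j\<close>)
        qed
        \<comment> \<open>Some function of the family is a nonzero constant on the cell, so a
          multiple of it dominates the indicator.\<close>
        then have "AE x in M. \<bar>indicator (A j) x :: real\<bar> \<le> \<bar>1 / e j i * f i x\<bar>"
          using i by (intro AE_I2) (simp add: indicator_def)
        then show ?thesis
          using Lp_fun_mono(1)[OF r Lp_fun_scale(1)[OF r f(2)[OF i(1)], of "1 / e j i"], of "indicator (A j)"] sets
          by simp
      qed (use r in \<open>simp add: A_def indicator_def[abs_def]\<close>)
    qed
    fix i assume i: "i < n"
    have "AE x in M. x \<notin> cell v" if "v \<in> val ` space M" "emeasure M (cell v) = 0" for v
      using cell[OF that(1)] that(2) by (intro AE_not_in) (auto simp: null_sets_def)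
    then have "AE x in M. \<forall>v\<in>{v \<in> val ` space M. emeasure M (cell v) = 0}. x \<notin> cell v"
      using finR by (intro AE_finite_allI) auto
    then show "AE x in M. f i x = step (Suc (card V)) A (u i) x"
    proof (rule AE_mp, intro AE_I2 impI)
      fix x assume x: "x \<in> space M"
        and nn: "\<forall>v\<in>{v \<in> val ` space M. emeasure M (cell v) = 0}. x \<notin> cell v"
      have xc: "x \<in> cell (val x)" using x by (simp add: cell_def)
      show "f i x = step (Suc (card V)) A (u i) x"
      proof (cases "val x \<in> V")
        case True
        then have "val x \<in> e ` {..<card V}" using e by (simp add: bij_betw_def)
        then obtain j where j: "j < card V" "e j = val x" by auto
        then have "step (Suc (card V)) A (u i) x = u i j"
          using xc by (intro step_eq[OF fam]) (auto simp: A_def)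
        then show ?thesis using j i by (simp add: u_def val_def)
      next
        case False
        then have "val x i = 0" using nn xc x i by (auto simp: V_def)
        then have "f i x = 0" using i by (simp add: val_def)
        moreover have "x \<notin> A j" for j using False eV[of j] by (auto simp: A_def cell_def)
        ultimately show ?thesis by (simp add: step_eq_0)
      qed
    qed
    fix j assume "A j = {}"
    then show "u i j = 0" using eV[of j] by (auto simp: A_def u_def V_def)
  qed simp
qed

lemma Lp_fun_step_approx:
  fixes n :: nat
  assumes r: "1 \<le> r" and f: "\<And>i. i < n \<Longrightarrow> f i \<in> Lp_fun r M" and "0 < \<epsilon>"
  obtains m A u where "1 \<le> m" "step_family r M m A"
    "\<And>i. i < n \<Longrightarrow> Lp_fun_norm r M (\<lambda>x. f i x - step m A (u i) x) \<le> \<epsilon>"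
    "\<And>i j. i < n \<Longrightarrow> j < m \<Longrightarrow> A j = {} \<Longrightarrow> u i j = 0"
proof -
  have "\<exists>s. simple_function M s \<and> s \<in> Lp_fun r M \<and> Lp_fun_norm r M (\<lambda>x. f i x - s x) \<le> \<epsilon>" if "i < n" for i
    using Lp_fun_simple_approx[OF r f[OF that] assms(3)] by metis
  then obtain s where s: "\<And>i. i < n \<Longrightarrow> simple_function M (s i)" "\<And>i. i < n \<Longrightarrow> s i \<in> Lp_fun r M"
    "\<And>i. i < n \<Longrightarrow> Lp_fun_norm r M (\<lambda>x. f i x - s i x) \<le> \<epsilon>" by metis
  obtain m A u where A: "1 \<le> m" "step_family r M m A"
    "\<And>i. i < n \<Longrightarrow> AE x in M. s i x = step m A (u i) x"
    "\<And>i j. i < n \<Longrightarrow> j < m \<Longrightarrow> A j = {} \<Longrightarrow> u i j = 0"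
    by (rule simple_functions_step[OF r s(1,2)]) blast+
  show ?thesis
  proof (rule that[OF A(1,2) _ A(4)])
    fix i assume i: "i < n"
    have "Lp_fun_norm r M (\<lambda>x. f i x - step m A (u i) x) = Lp_fun_norm r M (\<lambda>x. f i x - s i x)"
    proof (rule Lp_fun_norm_cong_AE)
      show "AE x in M. f i x - step m A (u i) x = f i x - s i x" using A(3)[OF i] by eventually_elim simp
      show "(\<lambda>x. f i x - step m A (u i) x) \<in> borel_measurable M" "(\<lambda>x. f i x - s i x) \<in> borel_measurable M"
        using Lp_fun_diff[OF r f[OF i] step_in_Lp_fun[OF r A(2)]] Lp_fun_diff[OF r f[OF i] s(2)[OF i]]
        by (auto dest: Lp_fun_measurable)
    qed
    then show "Lp_fun_norm r M (\<lambda>x. f i x - step m A (u i) x) \<le> \<epsilon>" using s(3)[OF i] by simp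
  qed
qed

section \<open>Reduction to matrices\<close>

lemma Lp_fun_pnorm:
  assumes "1 \<le> r" "1 \<le> p" "1 \<le> n" "\<And>i. i < n \<Longrightarrow> f i \<in> Lp_fun r M"
  shows "(\<lambda>x. pnorm p n (\<lambda>i. f i x)) \<in> Lp_fun r M"
    "Lp_fun_norm r M (\<lambda>x. pnorm p n (\<lambda>i. f i x)) \<le> (\<Sum>i<n. Lp_fun_norm r M (f i))"
proof -
  have m: "(\<lambda>x. pnorm p n (\<lambda>i. f i x)) \<in> borel_measurable M"
    using assms by (intro pnorm_measurable) (auto dest: Lp_fun_measurable)
  have abs: "(\<lambda>x. \<bar>f i x\<bar>) \<in> Lp_fun r M" if "i < n" for i
    using Lp_fun_abs(1)[OF assms(1) assms(4)[OF that]] .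
  have sum: "(\<lambda>x. \<Sum>i<n. \<bar>f i x\<bar>) \<in> Lp_fun r M"
    using abs by (intro Lp_fun_sum(1) assms) auto
  have le: "AE x in M. \<bar>pnorm p n (\<lambda>i. f i x)\<bar> \<le> \<bar>\<Sum>i<n. \<bar>f i x\<bar>\<bar>"
    using pnorm_nonneg[OF assms(2,3)] pnorm_le_sum_abs[OF assms(2,3)] by (intro AE_I2) (simp add: sum_nonneg)
  show "(\<lambda>x. pnorm p n (\<lambda>i. f i x)) \<in> Lp_fun r M" by (rule Lp_fun_mono(1)[OF assms(1) sum m le])
  have "Lp_fun_norm r M (\<lambda>x. pnorm p n (\<lambda>i. f i x)) \<le> Lp_fun_norm r M (\<lambda>x. \<Sum>i<n. \<bar>f i x\<bar>)"
    by (rule Lp_fun_mono(2)[OF assms(1) sum m le])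
  also have "\<dots> \<le> (\<Sum>i<n. Lp_fun_norm r M (\<lambda>x. \<bar>f i x\<bar>))"
    using abs by (intro Lp_fun_sum(2) assms) auto
  also have "\<dots> = (\<Sum>i<n. Lp_fun_norm r M (f i))"
    using assms by (intro sum.cong refl Lp_fun_abs(2)) auto
  finally show "Lp_fun_norm r M (\<lambda>x. pnorm p n (\<lambda>i. f i x)) \<le> (\<Sum>i<n. Lp_fun_norm r M (f i))" .
qed

text \<open>Perturbing the functions raises the norm of their lattice sum by at most the sum of the
  individual errors. This may grow with n, but the family is fixed while the errors tend to
  0.\<close>

lemma Lp_fun_pnorm_triangle:
  assumes "1 \<le> r" "1 \<le> p" "1 \<le> n"
    and f: "\<And>i. i < n \<Longrightarrow> f i \<in> Lp_fun r M" and g: "\<And>i. i < n \<Longrightarrow> g i \<in> Lp_fun r M"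
  shows "Lp_fun_norm r M (\<lambda>x. pnorm p n (\<lambda>i. f i x))
    \<le> Lp_fun_norm r M (\<lambda>x. pnorm p n (\<lambda>i. g i x)) + (\<Sum>i<n. Lp_fun_norm r M (\<lambda>x. f i x - g i x))"
proof -
  have d: "(\<lambda>x. f i x - g i x) \<in> Lp_fun r M" if "i < n" for i
    by (rule Lp_fun_diff[OF assms(1) f[OF that] g[OF that]])
  have G: "(\<lambda>x. pnorm p n (\<lambda>i. g i x)) \<in> Lp_fun r M"
    using Lp_fun_pnorm(1)[OF assms(1-3), of g] g by blast
  have D: "(\<lambda>x. pnorm p n (\<lambda>i. f i x - g i x)) \<in> Lp_fun r M"
    using Lp_fun_pnorm(1)[OF assms(1-3), of "\<lambda>i x. f i x - g i x"] d by blast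
  have F: "(\<lambda>x. pnorm p n (\<lambda>i. f i x)) \<in> borel_measurable M"
    using Lp_fun_pnorm(1)[OF assms(1-3), of f] f by (blast intro: Lp_fun_measurable)
  have "pnorm p n (\<lambda>i. f i x) \<le> pnorm p n (\<lambda>i. g i x) + pnorm p n (\<lambda>i. f i x - g i x)" for x
    using pnorm_add[OF assms(2,3), of "\<lambda>i. g i x" "\<lambda>i. f i x - g i x"] by simp
  then have le: "AE x in M. \<bar>pnorm p n (\<lambda>i. f i x)\<bar> \<le> \<bar>pnorm p n (\<lambda>i. g i x) + pnorm p n (\<lambda>i. f i x - g i x)\<bar>"
    using pnorm_nonneg[OF assms(2,3)] by (intro AE_I2) (simp add: add_nonneg_nonneg)
  have "Lp_fun_norm r M (\<lambda>x. pnorm p n (\<lambda>i. f i x))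
      \<le> Lp_fun_norm r M (\<lambda>x. pnorm p n (\<lambda>i. g i x) + pnorm p n (\<lambda>i. f i x - g i x))"
    by (rule Lp_fun_mono(2)[OF assms(1) Lp_fun_add(1)[OF assms(1) G D] F le])
  also have "\<dots> \<le> Lp_fun_norm r M (\<lambda>x. pnorm p n (\<lambda>i. g i x))
      + Lp_fun_norm r M (\<lambda>x. pnorm p n (\<lambda>i. f i x - g i x))"
    by (rule Lp_fun_add(2)[OF assms(1) G D])
  also have "Lp_fun_norm r M (\<lambda>x. pnorm p n (\<lambda>i. f i x - g i x)) \<le> (\<Sum>i<n. Lp_fun_norm r M (\<lambda>x. f i x - g i x))"
    using Lp_fun_pnorm(2)[OF assms(1-3), of "\<lambda>i x. f i x - g i x"] d by blast
  finally show ?thesis by simp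
qed

lemma Lp_fun_pnorm_mono_exponent:
  assumes "1 \<le> r" "1 \<le> q" "q \<le> p" "1 \<le> n" "\<And>i. i < n \<Longrightarrow> f i \<in> Lp_fun r M"
  shows "Lp_fun_norm r M (\<lambda>x. pnorm p n (\<lambda>i. f i x)) \<le> Lp_fun_norm r M (\<lambda>x. pnorm q n (\<lambda>i. f i x))"
proof -
  have p: "1 \<le> p" using assms by simp
  have *: "(\<lambda>x. pnorm s n (\<lambda>i. f i x)) \<in> Lp_fun r M" if "1 \<le> s" for s
    using Lp_fun_pnorm(1)[OF assms(1) that assms(4), of f] assms(5) by blast
  have "AE x in M. \<bar>pnorm p n (\<lambda>i. f i x)\<bar> \<le> \<bar>pnorm q n (\<lambda>i. f i x)\<bar>"
    using pnorm_nonneg[OF p assms(4)] pnorm_nonneg[OF assms(2,4)] pnorm_antimono_exponent[OF assms(2-4)]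
    by (intro AE_I2) simp
  then show ?thesis
    by (rule Lp_fun_mono(2)[OF assms(1) *[OF assms(2)] Lp_fun_measurable[OF *[OF p]]])
qed

lemma le_of_forall_pos_le_add_mult:
  fixes a b c :: real
  assumes "0 \<le> c" "\<And>\<epsilon>. 0 < \<epsilon> \<Longrightarrow> a \<le> b + c * \<epsilon>"
  shows "a \<le> b"
proof (rule field_le_epsilon)
  fix e :: real assume "0 < e"
  then have "a \<le> b + c * (e / (c + 1))" using assms(1) by (intro assms(2)) simp
  also have "c * (e / (c + 1)) \<le> e" using assms(1) \<open>0 < e\<close> by (simp add: field_simps)
  finally show "a \<le> b + e" by simp
qed

text \<open>The approximation of the images \<open>\<tau> (indicator (A j))\<close> by step functions costs the additive
  \<open>1\<close> in \<open>C + 1\<close>.\<close>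

lemma operator_pnorm_bound:
  fixes \<tau> :: "('a \<Rightarrow> real) \<Rightarrow> ('b \<Rightarrow> real)"
  assumes r: "1 \<le> r1" "1 \<le> r2" "1 \<le> t" and reg: "bilin_regular r1 (conj_exp r2) t"
    and \<tau>: "\<And>f. f \<in> Lp_fun r1 M \<Longrightarrow> \<tau> f \<in> Lp_fun r2 N"
    and \<tau>_add: "\<And>f g. f \<in> Lp_fun r1 M \<Longrightarrow> g \<in> Lp_fun r1 M \<Longrightarrow> AE x in N. \<tau> (\<lambda>x. f x + g x) x = \<tau> f x + \<tau> g x"
    and \<tau>_scale: "\<And>c f. f \<in> Lp_fun r1 M \<Longrightarrow> AE x in N. \<tau> (\<lambda>x. c * f x) x = c * \<tau> f x"
    and C: "0 \<le> C" "\<And>f. f \<in> Lp_fun r1 M \<Longrightarrow> Lp_fun_norm r2 N (\<tau> f) \<le> C * Lp_fun_norm r1 M f"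
  obtains K where "0 \<le> K" "\<And>n f. 1 \<le> n \<Longrightarrow> (\<And>i. i < n \<Longrightarrow> f i \<in> Lp_fun r1 M) \<Longrightarrow>
    Lp_fun_norm r2 N (\<lambda>x. pnorm t n (\<lambda>i. \<tau> (f i) x)) \<le> K * Lp_fun_norm r1 M (\<lambda>x. pnorm t n (\<lambda>i. f i x))"
proof -
  have \<tau>_sum: "AE x in N. \<tau> (\<lambda>x. \<Sum>j\<in>J. c j * g j x) x = (\<Sum>j\<in>J. c j * \<tau> (g j) x)"
    if "finite J" "\<And>j. j \<in> J \<Longrightarrow> g j \<in> Lp_fun r1 M" for J :: "nat set" and c g
    using that
  proof (induction J)
    case empty
    show ?case using \<tau>_scale[OF Lp_fun_zero(1)[OF r(1)], of 0] by simp
  next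
    case (insert k J)
    have 1: "(\<lambda>x. c k * g k x) \<in> Lp_fun r1 M" using insert by (intro Lp_fun_scale r) auto
    have 2: "(\<lambda>x. \<Sum>j\<in>J. c j * g j x) \<in> Lp_fun r1 M" using insert by (intro Lp_fun_sum Lp_fun_scale r) auto
    have 3: "AE x in N. \<tau> (\<lambda>x. \<Sum>j\<in>J. c j * g j x) x = (\<Sum>j\<in>J. c j * \<tau> (g j) x)" using insert by auto
    have 4: "AE x in N. \<tau> (\<lambda>x. c k * g k x) x = c k * \<tau> (g k) x" using insert by (intro \<tau>_scale) auto
    show ?case using \<tau>_add[OF 1 2] 3 4 insert(1,2) by (auto elim!: eventually_elim2)
  qed
  obtain K where K: "0 \<le> K" "\<And>n m l A C X. 1 \<le> n \<Longrightarrow> 1 \<le> m \<Longrightarrow> 1 \<le> l \<Longrightarrow> 0 \<le> C \<Longrightarrow>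
      (\<And>u. pnorm r2 l (\<lambda>k. \<Sum>j<m. A j k * u j) \<le> C * pnorm r1 m u) \<Longrightarrow>
      mnorm r2 t n l (\<lambda>i k. \<Sum>j<m. A j k * X i j) \<le> K * C * mnorm r1 t n m X"
    by (rule bilin_regularE[OF reg r]) blast
  \<comment> \<open>The coefficient of \<epsilon> depends on n, K and C only, so letting \<epsilon>
    tend to 0 removes the last term.\<close>
  have bound: "Lp_fun_norm r2 N (\<lambda>x. pnorm t n (\<lambda>i. \<tau> (f i) x))
      \<le> K * (C + 1) * Lp_fun_norm r1 M (\<lambda>x. pnorm t n (\<lambda>i. f i x)) + (K * (C + 1) * n + C * n + 1) * \<epsilon>"
    if n: "1 \<le> n" and f: "\<And>i. i < n \<Longrightarrow> f i \<in> Lp_fun r1 M" and \<epsilon>: "0 < \<epsilon>" for n f and \<epsilon> :: real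
  proof -
    obtain m A u where A: "1 \<le> m" "step_family r1 M m A"
      and u: "\<And>i. i < n \<Longrightarrow> Lp_fun_norm r1 M (\<lambda>x. f i x - step m A (u i) x) \<le> \<epsilon>"
      "\<And>i j. i < n \<Longrightarrow> j < m \<Longrightarrow> A j = {} \<Longrightarrow> u i j = 0"
      by (rule Lp_fun_step_approx[OF r(1) f \<epsilon>]) blast+
    define w where "w j = step_weight r1 M (A j)" for j
    have w: "0 < w j" if "j < m" for j using step_weight_pos[OF r(1) A(2) that] by (simp add: w_def)
    define h where "h j = \<tau> (indicator (A j))" for j
    have Ai: "(indicator (A j) :: 'a \<Rightarrow> real) \<in> Lp_fun r1 M" if "j < m" for j
      using A(2) that by (simp add: step_family_def)
    have h: "h j \<in> Lp_fun r2 N" if "j < m" for j unfolding h_def by (intro \<tau> Ai that)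
    have \<tau>_step: "AE x in N. \<tau> (step m A c) x = (\<Sum>j<m. c j * h j x)" for c
      using \<tau>_sum[of "{..<m}" "\<lambda>j. indicator (A j)" c] Ai unfolding step_def[abs_def] h_def by simp
    \<comment> \<open>Chosen after the cells A and the coefficients u. The first bound lets the
      replaced images change the norm of the operator by at most 1; the second keeps the total error
      in the images of the given step functions at most \<epsilon>.\<close>
    define \<delta> where "\<delta> = min (1 / (1 + (\<Sum>j<m. 1 / w j))) (\<epsilon> / (1 + (\<Sum>i<n. \<Sum>j<m. \<bar>u i j\<bar>)))"
    have sw: "0 \<le> (\<Sum>j<m. 1 / w j)" using w by (intro sum_nonneg) (simp add: less_imp_le)
    have su: "0 \<le> (\<Sum>i<n. \<Sum>j<m. \<bar>u i j\<bar>)" by (intro sum_nonneg) simp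
    have \<delta>: "0 < \<delta>" using sw su \<epsilon> by (simp add: \<delta>_def)
    have \<delta>w: "\<delta> * (\<Sum>j<m. 1 / w j) \<le> 1"
    proof -
      have "\<delta> * (\<Sum>j<m. 1 / w j) \<le> 1 / (1 + (\<Sum>j<m. 1 / w j)) * (\<Sum>j<m. 1 / w j)"
        using sw by (intro mult_right_mono) (auto simp: \<delta>_def)
      also have "\<dots> \<le> 1" using sw by (simp add: divide_le_eq)
      finally show ?thesis .
    qed
    have \<delta>u: "\<delta> * (\<Sum>i<n. \<Sum>j<m. \<bar>u i j\<bar>) \<le> \<epsilon>"
    proof -
      have "\<delta> * (\<Sum>i<n. \<Sum>j<m. \<bar>u i j\<bar>) \<le> \<epsilon> / (1 + (\<Sum>i<n. \<Sum>j<m. \<bar>u i j\<bar>)) * (\<Sum>i<n. \<Sum>j<m. \<bar>u i j\<bar>)"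
        using su by (intro mult_right_mono) (auto simp: \<delta>_def)
      also have "\<dots> \<le> \<epsilon>" using su \<epsilon> by (simp add: divide_le_eq algebra_simps)
      finally show ?thesis .
    qed
    obtain l B b where B: "1 \<le> l" "step_family r2 N l B"
      and b: "\<And>j. j < m \<Longrightarrow> Lp_fun_norm r2 N (\<lambda>x. h j x - step l B (b j) x) \<le> \<delta>"
      "\<And>j k. j < m \<Longrightarrow> k < l \<Longrightarrow> B k = {} \<Longrightarrow> b j k = 0"
      by (rule Lp_fun_step_approx[OF r(2) h \<delta>]) blast+
    define z where "z k = step_weight r2 N (B k)" for k
    \<comment> \<open>The approximating operator on coefficient vectors: it sends the j-th indicator
      to the step function that replaces its image.\<close>
    define G where "G c = step l B (\<lambda>k. \<Sum>j<m. c j * b j k)" for c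
    have G: "G c \<in> Lp_fun r2 N" for c unfolding G_def by (rule step_in_Lp_fun[OF r(2) B(2)])
    have comb: "(\<lambda>x. \<Sum>j<m. c j * h j x) \<in> Lp_fun r2 N" for c
      using h by (intro Lp_fun_sum Lp_fun_scale r) auto
    have err: "Lp_fun_norm r2 N (\<lambda>x. (\<Sum>j<m. c j * h j x) - G c x) \<le> \<delta> * (\<Sum>j<m. \<bar>c j\<bar>)" for c
    proof -
      have d: "(\<lambda>x. h j x - step l B (b j) x) \<in> Lp_fun r2 N" if "j < m" for j
        by (rule Lp_fun_diff[OF r(2) h[OF that] step_in_Lp_fun[OF r(2) B(2)]])
      have "(\<Sum>j<m. c j * h j x) - G c x = (\<Sum>j<m. c j * (h j x - step l B (b j) x))" for x
        unfolding G_def step_sum[symmetric] by (simp add: right_diff_distrib sum_subtractf)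
      then have "Lp_fun_norm r2 N (\<lambda>x. (\<Sum>j<m. c j * h j x) - G c x)
          = Lp_fun_norm r2 N (\<lambda>x. \<Sum>j<m. c j * (h j x - step l B (b j) x))" by simp
      also have "\<dots> \<le> (\<Sum>j<m. Lp_fun_norm r2 N (\<lambda>x. c j * (h j x - step l B (b j) x)))"
        using d by (intro Lp_fun_sum Lp_fun_scale r) auto
      also have "\<dots> = (\<Sum>j<m. \<bar>c j\<bar> * Lp_fun_norm r2 N (\<lambda>x. h j x - step l B (b j) x))"
        using d by (intro sum.cong refl Lp_fun_scale r) auto
      also have "\<dots> \<le> (\<Sum>j<m. \<bar>c j\<bar> * \<delta>)"
        using b by (intro sum_mono mult_left_mono) auto
      finally show ?thesis by (simp add: sum_distrib_left mult.commute)
    qed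
    have comb_norm: "Lp_fun_norm r2 N (\<lambda>x. \<Sum>j<m. c j * h j x) \<le> C * Lp_fun_norm r1 M (step m A c)" for c
    proof -
      have "Lp_fun_norm r2 N (\<lambda>x. \<Sum>j<m. c j * h j x) = Lp_fun_norm r2 N (\<tau> (step m A c))"
        using \<tau>_step[of c] \<tau>[OF step_in_Lp_fun[OF r(1) A(2)]] comb
        by (intro Lp_fun_norm_cong_AE) (auto dest: Lp_fun_measurable)
      then show ?thesis using C(2)[OF step_in_Lp_fun[OF r(1) A(2)], of c] by simp
    qed
    \<comment> \<open>The matrix of G: dividing by \<open>w j\<close> and multiplying by
      \<open>z k\<close> turns both norms of step functions into plain sequence norms.\<close>
    define a where "a j k = b j k * z k / w j" for j k
    have norm_G: "Lp_fun_norm r2 N (G c) = pnorm r2 l (\<lambda>k. z k * (\<Sum>j<m. c j * b j k))" for c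
      unfolding G_def z_def using b(2) by (intro step_norm_eq r B) auto
    have matrix: "pnorm r2 l (\<lambda>k. \<Sum>j<m. a j k * c j) \<le> (C + 1) * pnorm r1 m c" for c
    proof -
      \<comment> \<open>Undo the weights: the step function with these coefficients has norm at most
        that of the vector c.\<close>
      let ?d = "\<lambda>j. c j / w j"
      have "pnorm r2 l (\<lambda>k. \<Sum>j<m. a j k * c j) = Lp_fun_norm r2 N (G ?d)"
        unfolding norm_G a_def by (intro pnorm_cong arg_cong[where f=abs]) (simp add: sum_distrib_left mult_ac)
      also have "\<dots> = Lp_fun_norm r2 N (\<lambda>x. (\<Sum>j<m. ?d j * h j x) + (- 1) * ((\<Sum>j<m. ?d j * h j x) - G ?d x))"
        by simp
      also have "\<dots> \<le> Lp_fun_norm r2 N (\<lambda>x. \<Sum>j<m. ?d j * h j x)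
          + Lp_fun_norm r2 N (\<lambda>x. (- 1) * ((\<Sum>j<m. ?d j * h j x) - G ?d x))"
        by (intro Lp_fun_add Lp_fun_scale Lp_fun_diff r comb G)
      also have "Lp_fun_norm r2 N (\<lambda>x. (- 1) * ((\<Sum>j<m. ?d j * h j x) - G ?d x))
          = \<bar>- 1\<bar> * Lp_fun_norm r2 N (\<lambda>x. (\<Sum>j<m. ?d j * h j x) - G ?d x)"
        by (intro Lp_fun_scale Lp_fun_diff r comb G)
      also have "\<bar>- 1\<bar> * Lp_fun_norm r2 N (\<lambda>x. (\<Sum>j<m. ?d j * h j x) - G ?d x) \<le> pnorm r1 m c"
      proof -
        have "Lp_fun_norm r2 N (\<lambda>x. (\<Sum>j<m. ?d j * h j x) - G ?d x) \<le> \<delta> * (\<Sum>j<m. \<bar>?d j\<bar>)" by (rule err)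
        also have "\<dots> \<le> \<delta> * (\<Sum>j<m. pnorm r1 m c * (1 / w j))"
        proof (intro mult_left_mono sum_mono)
          fix j assume "j \<in> {..<m}"
          then show "\<bar>?d j\<bar> \<le> pnorm r1 m c * (1 / w j)"
            using w[of j] abs_le_pnorm[OF r(1), of j m c] by (simp add: divide_right_mono)
        qed (use \<delta> in simp)
        also have "\<dots> = pnorm r1 m c * (\<delta> * (\<Sum>j<m. 1 / w j))" by (simp add: sum_distrib_left mult_ac)
        also have "\<dots> \<le> pnorm r1 m c" by (intro mult_left_le \<delta>w pnorm_nonneg r A)
        finally show ?thesis by simp
      qed
      also have "Lp_fun_norm r2 N (\<lambda>x. \<Sum>j<m. ?d j * h j x) \<le> C * pnorm r1 m c"
      proof -
        have "Lp_fun_norm r1 M (step m A ?d) \<le> pnorm r1 m (\<lambda>j. w j * ?d j)"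
          unfolding w_def by (rule step_norm_le[OF r(1) A])
        also have "\<dots> = pnorm r1 m c" using w by (intro pnorm_cong) fastforce
        finally show ?thesis using comb_norm[of ?d] C(1) by (meson mult_left_mono order_trans)
      qed
      finally show ?thesis by (simp add: algebra_simps)
    qed
    have main: "Lp_fun_norm r2 N (\<lambda>x. pnorm t n (\<lambda>i. G (u i) x))
        \<le> K * (C + 1) * Lp_fun_norm r1 M (\<lambda>x. pnorm t n (\<lambda>i. step m A (u i) x))"
    proof -
      have p0: "pnorm t n (\<lambda>i. 0) = 0" by (rule pnorm_zero[OF r(3) n])
      let ?e = "\<lambda>i k. \<Sum>j<m. u i j * b j k"
      have scale: "pnorm t n (\<lambda>i. d * v i) = d * pnorm t n v" if "0 \<le> d" for d v
        using pnorm_scale[OF r(3) n] that by simp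
      have z: "0 \<le> z k" if "k < l" for k using step_weight_pos[OF r(2) B(2) that] by (simp add: z_def)
      \<comment> \<open>The t-norm of step functions on common cells is again a step function, so
        the matrix inequality applies with entries \<open>w j * u i j\<close>.\<close>
      have "(\<lambda>x. pnorm t n (\<lambda>i. G (u i) x)) = step l B (\<lambda>k. pnorm t n (\<lambda>i. ?e i k))"
        unfolding G_def by (rule ext) (rule step_compose[where \<phi> = "pnorm t n", OF B(2) p0])
      then have "Lp_fun_norm r2 N (\<lambda>x. pnorm t n (\<lambda>i. G (u i) x))
          = pnorm r2 l (\<lambda>k. z k * pnorm t n (\<lambda>i. ?e i k))"
        unfolding z_def using b(2) p0 by (simp only:) (rule step_norm_eq[OF r(2) B], simp)
      also have "\<dots> = mnorm r2 t n l (\<lambda>i k. \<Sum>j<m. a j k * (w j * u i j))"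
        unfolding mnorm_def
      proof (rule pnorm_cong)
        fix k assume k: "k < l"
        have "(\<Sum>j<m. a j k * (w j * u i j)) = z k * ?e i k" for i
          unfolding sum_distrib_left a_def using w by (intro sum.cong) fastforce+
        then show "\<bar>z k * pnorm t n (\<lambda>i. ?e i k)\<bar> = \<bar>pnorm t n (\<lambda>i. \<Sum>j<m. a j k * (w j * u i j))\<bar>"
          using scale[OF z[OF k]] by simp
      qed
      also have "\<dots> \<le> K * (C + 1) * mnorm r1 t n m (\<lambda>i j. w j * u i j)"
        using C(1) by (intro K(2) n A B matrix) auto
      also have "mnorm r1 t n m (\<lambda>i j. w j * u i j) = pnorm r1 m (\<lambda>j. w j * pnorm t n (\<lambda>i. u i j))"
        unfolding mnorm_def using w by (intro pnorm_cong) (simp add: scale less_imp_le)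
      also have "\<dots> = Lp_fun_norm r1 M (step m A (\<lambda>j. pnorm t n (\<lambda>i. u i j)))"
        unfolding w_def
      proof (rule step_norm_eq[OF r(1) A, symmetric])
        fix j assume "j < m" "A j = {}"
        then have "pnorm t n (\<lambda>i. u i j) = pnorm t n (\<lambda>i. 0)" using u(2) by (intro pnorm_cong) simp
        then show "pnorm t n (\<lambda>i. u i j) = 0" using p0 by simp
      qed
      also have "step m A (\<lambda>j. pnorm t n (\<lambda>i. u i j)) = (\<lambda>x. pnorm t n (\<lambda>i. step m A (u i) x))"
        by (rule ext) (rule step_compose[where \<phi> = "pnorm t n", OF A(2) p0, symmetric])
      finally show ?thesis .
    qed
    have diff: "Lp_fun_norm r2 N (\<lambda>x. \<tau> (f i) x - G (u i) x) \<le> C * \<epsilon> + \<delta> * (\<Sum>j<m. \<bar>u i j\<bar>)"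
      if i: "i < n" for i
    proof -
      let ?s = "step m A (u i)"
      have s: "?s \<in> Lp_fun r1 M" by (rule step_in_Lp_fun[OF r(1) A(2)])
      have fs: "(\<lambda>x. f i x - ?s x) \<in> Lp_fun r1 M" by (rule Lp_fun_diff[OF r(1) f[OF i] s])
      let ?g = "\<lambda>x. (\<Sum>j<m. u i j * h j x) - G (u i) x"
      have g: "?g \<in> Lp_fun r2 N" by (intro Lp_fun_diff r comb G)
      have "AE x in N. \<tau> (f i) x = \<tau> (\<lambda>x. f i x - ?s x) x + \<tau> ?s x"
        using \<tau>_add[OF fs s] by simp
      then have "AE x in N. \<tau> (f i) x - G (u i) x = \<tau> (\<lambda>x. f i x - ?s x) x + ?g x"
        using \<tau>_step[of "u i"] by eventually_elim simp
      then have "Lp_fun_norm r2 N (\<lambda>x. \<tau> (f i) x - G (u i) x)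
          = Lp_fun_norm r2 N (\<lambda>x. \<tau> (\<lambda>x. f i x - ?s x) x + ?g x)"
        by (intro Lp_fun_norm_cong_AE Lp_fun_measurable[OF Lp_fun_diff[OF r(2) \<tau>[OF f[OF i]] G]]
            Lp_fun_measurable[OF Lp_fun_add(1)[OF r(2) \<tau>[OF fs] g]])
      also have "\<dots> \<le> Lp_fun_norm r2 N (\<tau> (\<lambda>x. f i x - ?s x)) + Lp_fun_norm r2 N ?g"
        by (rule Lp_fun_add(2)[OF r(2) \<tau>[OF fs] g])
      also have "\<dots> \<le> C * \<epsilon> + \<delta> * (\<Sum>j<m. \<bar>u i j\<bar>)"
      proof (rule add_mono[OF _ err])
        have "Lp_fun_norm r2 N (\<tau> (\<lambda>x. f i x - ?s x)) \<le> C * Lp_fun_norm r1 M (\<lambda>x. f i x - ?s x)"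
          by (rule C(2)[OF fs])
        also have "\<dots> \<le> C * \<epsilon>" by (intro mult_left_mono u(1) i C(1))
        finally show "Lp_fun_norm r2 N (\<tau> (\<lambda>x. f i x - ?s x)) \<le> C * \<epsilon>" .
      qed
      finally show ?thesis .
    qed
    have step_norm: "Lp_fun_norm r1 M (\<lambda>x. pnorm t n (\<lambda>i. step m A (u i) x))
        \<le> Lp_fun_norm r1 M (\<lambda>x. pnorm t n (\<lambda>i. f i x)) + n * \<epsilon>"
    proof -
      have "Lp_fun_norm r1 M (\<lambda>x. step m A (u i) x - f i x) \<le> \<epsilon>" if "i < n" for i
        using Lp_fun_scale(2)[OF r(1) Lp_fun_diff[OF r(1) f[OF that] step_in_Lp_fun[OF r(1) A(2)]], of "- 1" "u i"] u(1)[OF that]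
        by simp
      then have "(\<Sum>i<n. Lp_fun_norm r1 M (\<lambda>x. step m A (u i) x - f i x)) \<le> (\<Sum>i<n. \<epsilon>)"
        by (intro sum_mono) auto
      moreover have "Lp_fun_norm r1 M (\<lambda>x. pnorm t n (\<lambda>i. step m A (u i) x))
        \<le> Lp_fun_norm r1 M (\<lambda>x. pnorm t n (\<lambda>i. f i x)) + (\<Sum>i<n. Lp_fun_norm r1 M (\<lambda>x. step m A (u i) x - f i x))"
        using step_in_Lp_fun[OF r(1) A(2)] f by (intro Lp_fun_pnorm_triangle r n) auto
      ultimately show ?thesis by simp
    qed
    have "Lp_fun_norm r2 N (\<lambda>x. pnorm t n (\<lambda>i. \<tau> (f i) x))
        \<le> Lp_fun_norm r2 N (\<lambda>x. pnorm t n (\<lambda>i. G (u i) x))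
          + (\<Sum>i<n. Lp_fun_norm r2 N (\<lambda>x. \<tau> (f i) x - G (u i) x))"
      using \<tau> f G by (intro Lp_fun_pnorm_triangle r n) auto
    also have "(\<Sum>i<n. Lp_fun_norm r2 N (\<lambda>x. \<tau> (f i) x - G (u i) x)) \<le> (\<Sum>i<n. C * \<epsilon> + \<delta> * (\<Sum>j<m. \<bar>u i j\<bar>))"
      using diff by (intro sum_mono) auto
    also have "\<dots> = C * n * \<epsilon> + \<delta> * (\<Sum>i<n. \<Sum>j<m. \<bar>u i j\<bar>)"
      by (simp add: sum.distrib sum_distrib_left)
    also have "\<dots> \<le> C * n * \<epsilon> + \<epsilon>" using \<delta>u by simp
    also have "Lp_fun_norm r2 N (\<lambda>x. pnorm t n (\<lambda>i. G (u i) x))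
        \<le> K * (C + 1) * (Lp_fun_norm r1 M (\<lambda>x. pnorm t n (\<lambda>i. f i x)) + n * \<epsilon>)"
      using K(1) C(1) step_norm by (intro order_trans[OF main] mult_left_mono) auto
    finally show ?thesis by (simp add: algebra_simps)
  qed
  show ?thesis
  proof (rule that[of "K * (C + 1)"])
    fix n f assume nf: "1 \<le> (n::nat)" "\<And>i. i < n \<Longrightarrow> f i \<in> Lp_fun r1 M"
    show "Lp_fun_norm r2 N (\<lambda>x. pnorm t n (\<lambda>i. \<tau> (f i) x))
        \<le> K * (C + 1) * Lp_fun_norm r1 M (\<lambda>x. pnorm t n (\<lambda>i. f i x))"
      by (rule le_of_forall_pos_le_add_mult[OF _ bound[OF nf]]) (use K C in auto)
  qed (use K C in simp)
qed

section \<open>Equivalence classes\<close>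

lemma ae_rep_ae_class:
  assumes "f \<in> borel_measurable M"
  shows "ae_rep (ae_class M f) \<in> borel_measurable M" "AE x in M. ae_rep (ae_class M f) x = f x"
proof -
  have "f \<in> ae_class M f" using assms by (simp add: ae_class_def)
  then have "ae_rep (ae_class M f) \<in> ae_class M f" unfolding ae_rep_def by (rule someI[where P = "\<lambda>g. g \<in> ae_class M f"])
  then show "ae_rep (ae_class M f) \<in> borel_measurable M" "AE x in M. ae_rep (ae_class M f) x = f x"
    by (auto simp: ae_class_def)
qed

lemma ae_class_eqI: "AE x in M. f x = g x \<Longrightarrow> ae_class M f = ae_class M g"
  unfolding ae_class_def by (intro Collect_cong conj_cong refl iffI) (auto elim: eventually_elim2)

lemma ae_rep_Lp:
  assumes "1 \<le> r" "F \<in> Lp r M"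
  shows "ae_rep F \<in> Lp_fun r M" "ae_class M (ae_rep F) = F"
proof -
  obtain f where f: "f \<in> Lp_fun r M" "F = ae_class M f" using assms by (auto simp: Lp_def)
  note rep = ae_rep_ae_class[OF Lp_fun_measurable[OF f(1)]]
  show "ae_rep F \<in> Lp_fun r M" unfolding f(2) by (rule Lp_fun_cong_AE(1)[OF assms(1) f(1) rep])
  show "ae_class M (ae_rep F) = F" unfolding f(2) by (rule ae_class_eqI[OF rep(2)])
qed

lemma Lp_norm_ae_class:
  assumes "f \<in> borel_measurable M"
  shows "Lp_norm r M (ae_class M f) = Lp_fun_norm r M f"
  unfolding Lp_norm_def using ae_rep_ae_class[OF assms] assms by (intro Lp_fun_norm_cong_AE)

lemma Lp_norm_Lp_psum:
  assumes "1 \<le> r" "1 \<le> p" "1 \<le> n" "\<And>i. i < n \<Longrightarrow> F i \<in> Lp r M"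
  shows "Lp_norm r M (Lp_psum p M n F) = Lp_fun_norm r M (\<lambda>x. pnorm p n (\<lambda>i. ae_rep (F i) x))"
  unfolding Lp_psum_def using assms ae_rep_Lp(1)[OF assms(1)]
  by (intro Lp_norm_ae_class pnorm_measurable) (auto dest: Lp_fun_measurable)

lemma pnorm_single:
  assumes "1 \<le> p"
  shows "pnorm p 1 a = \<bar>a 0\<bar>"
proof -
  have "pnorm p 1 a = pnorm p 1 (\<lambda>i. if i = 0 then a 0 else 0)" by (intro pnorm_cong) auto
  also have "\<dots> = \<bar>a 0\<bar>" by (intro pnorm_unit assms) simp
  finally show ?thesis .
qed

section \<open>The two inclusions between the operator classes\<close>

lemma regular_ops_subset_bounded_ops:
  assumes "1 \<le> r1" "1 \<le> r2" "1 \<le> p" "1 \<le> q"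
  shows "regular_ops p q r1 M r2 N \<subseteq> bounded_ops r1 M r2 N"
proof
  fix T assume T: "T \<in> regular_ops p q r1 M r2 N"
  then have lin: "T \<in> linear_ops r1 M r2 N" by (simp add: regular_ops_def)
  from T obtain K where K: "\<And>n F. 1 \<le> n \<Longrightarrow> (\<And>i. i < n \<Longrightarrow> F i \<in> Lp r1 M) \<Longrightarrow>
       Lp_norm r2 N (Lp_psum p N n (\<lambda>i. T (F i))) \<le> K * Lp_norm r1 M (Lp_psum q M n F)"
    unfolding regular_ops_def by auto
  \<comment> \<open>For one vector the lattice expression is |F| for every exponent, so regularity
    with n = 1 is boundedness.\<close>
  have single: "Lp_norm r L (Lp_psum s L 1 (\<lambda>_. F)) = Lp_norm r L F"
    if "1 \<le> r" "1 \<le> s" "F \<in> Lp r L" for r s F and L :: "'c measure"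
    using Lp_norm_Lp_psum[OF that(1,2), of 1 "\<lambda>_. F" L] that(3) pnorm_single[OF that(2)]
      Lp_fun_abs(2)[OF that(1) ae_rep_Lp(1)[OF that(1,3)]]
    by (simp add: Lp_norm_def)
  have "Lp_norm r2 N (T F) \<le> K * Lp_norm r1 M F" if F: "F \<in> Lp r1 M" for F
  proof -
    have "T F \<in> Lp r2 N" using lin F by (auto simp: linear_ops_def)
    then show ?thesis
      using K[of 1 "\<lambda>_. F"] F single[OF assms(1,4) F] single[OF assms(2,3), of "T F" N] by simp
  qed
  then show "T \<in> bounded_ops r1 M r2 N" using lin by (auto simp: bounded_ops_def)
qed

text \<open>On representatives T becomes a map \<tau> that is linear only almost everywhere. After
  the estimate for the common exponent t, the p-th sum of the images is at most their t-th sum, and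
  the t-th sum of the arguments at most their q-th.\<close>

lemma bounded_ops_subset_regular_ops:
  assumes r: "1 \<le> r1" "1 \<le> r2" and pq: "1 \<le> q" "q \<le> t" "t \<le> p"
    and reg: "bilin_regular r1 (conj_exp r2) t"
  shows "bounded_ops r1 M r2 N \<subseteq> regular_ops p q r1 M r2 N"
proof
  have t: "1 \<le> t" "1 \<le> p" using pq by auto
  fix T assume T: "T \<in> bounded_ops r1 M r2 N"
  then have lin: "T \<in> linear_ops r1 M r2 N" by (simp add: bounded_ops_def)
  then have T_Lp: "T F \<in> Lp r2 N" if "F \<in> Lp r1 M" for F using that by (auto simp: linear_ops_def)
  from T obtain C where C: "\<And>F. F \<in> Lp r1 M \<Longrightarrow> Lp_norm r2 N (T F) \<le> C * Lp_norm r1 M F"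
    by (auto simp: bounded_ops_def)
  define \<tau> where "\<tau> f = ae_rep (T (ae_class M f))" for f
  have cls: "ae_class M f \<in> Lp r1 M" if "f \<in> Lp_fun r1 M" for f using that by (simp add: Lp_def)
  have \<tau>_Lp: "\<tau> f \<in> Lp_fun r2 N" if "f \<in> Lp_fun r1 M" for f
    unfolding \<tau>_def by (intro ae_rep_Lp(1) r T_Lp cls that)
  obtain K where K: "0 \<le> K" "\<And>n f. 1 \<le> n \<Longrightarrow> (\<And>i. i < n \<Longrightarrow> f i \<in> Lp_fun r1 M) \<Longrightarrow>
    Lp_fun_norm r2 N (\<lambda>x. pnorm t n (\<lambda>i. \<tau> (f i) x)) \<le> K * Lp_fun_norm r1 M (\<lambda>x. pnorm t n (\<lambda>i. f i x))"
  \<comment> \<open>The constant in the definition of boundedness may be negative, hence the maximum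
    with 0.\<close>
  proof (rule operator_pnorm_bound[OF r t(1) reg \<tau>_Lp, where C = "max C 0"])
    fix f g assume f: "f \<in> Lp_fun r1 M" and g: "g \<in> Lp_fun r1 M"
    have "AE x in M. ae_rep (ae_class M f) x + ae_rep (ae_class M g) x = f x + g x"
      using ae_rep_ae_class(2)[OF Lp_fun_measurable[OF f]] ae_rep_ae_class(2)[OF Lp_fun_measurable[OF g]]
      by eventually_elim simp
    then have "ae_class M (\<lambda>x. f x + g x) = Lp_add M (ae_class M f) (ae_class M g)"
      unfolding Lp_add_def by (rule ae_class_eqI[symmetric])
    then have "T (ae_class M (\<lambda>x. f x + g x)) = ae_class N (\<lambda>x. \<tau> f x + \<tau> g x)"
      using lin cls[OF f] cls[OF g] by (simp add: linear_ops_def Lp_add_def \<tau>_def)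
    then show "AE x in N. \<tau> (\<lambda>x. f x + g x) x = \<tau> f x + \<tau> g x"
      using ae_rep_ae_class(2)[OF Lp_fun_measurable[OF Lp_fun_add(1)[OF r(2) \<tau>_Lp[OF f] \<tau>_Lp[OF g]]]]
      by (simp add: \<tau>_def)
  next
    fix c f assume f: "f \<in> Lp_fun r1 M"
    have "AE x in M. c * ae_rep (ae_class M f) x = c * f x"
      using ae_rep_ae_class(2)[OF Lp_fun_measurable[OF f]] by eventually_elim simp
    then have "ae_class M (\<lambda>x. c * f x) = Lp_scale M c (ae_class M f)"
      unfolding Lp_scale_def by (rule ae_class_eqI[symmetric])
    then have "T (ae_class M (\<lambda>x. c * f x)) = ae_class N (\<lambda>x. c * \<tau> f x)"
      using lin cls[OF f] by (simp add: linear_ops_def Lp_scale_def \<tau>_def)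
    then show "AE x in N. \<tau> (\<lambda>x. c * f x) x = c * \<tau> f x"
      using ae_rep_ae_class(2)[OF Lp_fun_measurable[OF Lp_fun_scale(1)[OF r(2) \<tau>_Lp[OF f], of c]]]
      by (simp add: \<tau>_def)
  next
    fix f assume f: "f \<in> Lp_fun r1 M"
    have "Lp_fun_norm r2 N (\<tau> f) \<le> C * Lp_fun_norm r1 M f"
      using C[OF cls[OF f]] Lp_norm_ae_class[OF Lp_fun_measurable[OF f], of r1] by (simp add: \<tau>_def Lp_norm_def)
    also have "\<dots> \<le> max C 0 * Lp_fun_norm r1 M f" by (intro mult_right_mono) auto
    finally show "Lp_fun_norm r2 N (\<tau> f) \<le> max C 0 * Lp_fun_norm r1 M f" .
  qed auto
  \<comment> \<open>Regularity asks for a strictly positive constant, hence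
    \<open>K + 1\<close>.\<close>
  have "Lp_norm r2 N (Lp_psum p N n (\<lambda>i. T (F i))) \<le> (K + 1) * Lp_norm r1 M (Lp_psum q M n F)"
    if n: "1 \<le> n" and F: "\<And>i. i < n \<Longrightarrow> F i \<in> Lp r1 M" for n F
  proof -
    let ?f = "\<lambda>i. ae_rep (F i)"
    have f: "?f i \<in> Lp_fun r1 M" if "i < n" for i by (rule ae_rep_Lp(1)[OF r(1) F[OF that]])
    have \<tau>f: "\<tau> (?f i) = ae_rep (T (F i))" if "i < n" for i
      unfolding \<tau>_def by (simp add: ae_rep_Lp(2)[OF r(1) F[OF that]])
    have "Lp_norm r2 N (Lp_psum p N n (\<lambda>i. T (F i))) = Lp_fun_norm r2 N (\<lambda>x. pnorm p n (\<lambda>i. ae_rep (T (F i)) x))"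
      using T_Lp F by (intro Lp_norm_Lp_psum r t n) auto
    also have "\<dots> \<le> Lp_fun_norm r2 N (\<lambda>x. pnorm t n (\<lambda>i. ae_rep (T (F i)) x))"
      using ae_rep_Lp(1)[OF r(2) T_Lp] F by (intro Lp_fun_pnorm_mono_exponent r t pq n) auto
    also have "(\<lambda>x. pnorm t n (\<lambda>i. ae_rep (T (F i)) x)) = (\<lambda>x. pnorm t n (\<lambda>i. \<tau> (?f i) x))"
      by (intro ext pnorm_cong) (simp add: \<tau>f)
    also have "Lp_fun_norm r2 N \<dots> \<le> K * Lp_fun_norm r1 M (\<lambda>x. pnorm t n (\<lambda>i. ?f i x))"
      by (intro K(2) n f)
    also have "\<dots> \<le> (K + 1) * Lp_fun_norm r1 M (\<lambda>x. pnorm q n (\<lambda>i. ?f i x))"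
      using K(1) f by (intro mult_mono Lp_fun_pnorm_mono_exponent r pq n) auto
    also have "Lp_fun_norm r1 M (\<lambda>x. pnorm q n (\<lambda>i. ?f i x)) = Lp_norm r1 M (Lp_psum q M n F)"
      using F by (intro Lp_norm_Lp_psum[symmetric] r pq n) auto
    finally show ?thesis .
  qed
  moreover have "0 < K + 1" using K(1) by simp
  ultimately show "T \<in> regular_ops p q r1 M r2 N" using lin unfolding regular_ops_def by blast
qed

theorem corollary4p5:
  fixes r1 r2 p q :: ereal and M :: "'a measure" and N :: "'b measure"
  assumes "1 \<le> r1" and "1 \<le> r2" and "1 \<le> p" and "1 \<le> q"
  assumes "(q \<le> r1 \<and> r1 = r2 \<and> r2 \<le> p)
    \<or> (r1 = 1 \<and> r2 = 1 \<and> 1 \<le> q \<and> q \<le> p \<and> p \<le> \<infinity>)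
    \<or> (r1 = \<infinity> \<and> r2 = \<infinity> \<and> 1 \<le> q \<and> q \<le> p \<and> p \<le> \<infinity>)
    \<or> (1 \<le> r2 \<and> r2 \<le> r1 \<and> r1 < 2 \<and> (\<exists>t. q \<le> t \<and> t \<le> p \<and> r1 < t \<and> t \<le> 2))
    \<or> (2 < r2 \<and> r2 \<le> r1 \<and> r1 \<le> \<infinity> \<and> (\<exists>t. q \<le> t \<and> t \<le> p \<and> 2 \<le> t \<and> t < r2))
    \<or> (1 \<le> r2 \<and> r2 \<le> 2 \<and> 2 \<le> r1 \<and> r1 \<le> \<infinity> \<and> q \<le> 2 \<and> 2 \<le> p)"
  shows "regular_ops p q r1 M r2 N = bounded_ops r1 M r2 N"
proof -
  obtain t where "1 \<le> t" "q \<le> t" "t \<le> p" "bilin_regular r1 (conj_exp r2) t"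
    using assms by (rule bilin_regular_cases)
  then show ?thesis
    using regular_ops_subset_bounded_ops[OF assms(1-4)] bounded_ops_subset_regular_ops[OF assms(1,2,4)]
    by (intro antisym) blast+
qed

end
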